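(* Let $H$ be a Hamiltonian (Hermitian operator) acting on $n$ qudits of dimension $d$, and let $T\geq 0$ be a temperature. Let $0\le \epsilon\le\frac12$. Then for any $\epsilon$-approximate Markovian MPDO $\rho$ over these $n$ qudits, $$\min_{\sigma\ge0,\ \mathrm{tr}(\sigma)=1}F(\sigma)\le \mathrm{tr}(\rho H)-T\Big(\sum_{i=2}^nS(\{i-1,i\})_\rho-\sum_{i=2}^{n-1}S(\{i\})_\rho\Big)+T(n-2)\big(4\epsilon\log d+2H_b(2\epsilon)\big),$$ where $F(\sigma)=\mathrm{tr}(\sigma H)-TS(\sigma)$.
   Context: Sites are labelled $1,\dots,n$; site $i$ has Hilbert space $\mathcal{H}_i$ with $\dim \mathcal{H}_i=d<\infty$. For a set $X$ of sites, $\mathcal{I}_X$ is the identity superoperator on the operators on $X$, $\mathrm{tr}_X$ is the partial trace over $X$, $\rho^X$ is the reduced density matrix of $\rho$ on $X$, $S(\rho)=-\mathrm{tr}(\rho\log\rho)$ and $S(X)_\rho=S(\rho^X)$. $\|\cdot\|_1$ is the trace norm. $H_b(p)=-p\log p-(1-p)\log(1-p)$ (with $0\log 0=0$), same logarithm throughout. Definition ($\epsilon$-approximate Markovian MPDO over $n\ge 2$ qudits of dimension $d$). A density matrix $\rho$ on $\mathcal{H}_1\otimes\cdots\otimes\mathcal{H}_n$ is an $\epsilon$-approximate Markovian MPDO (matrix product density operator) if there are completely positive trace preserving maps $\Phi_{\{i\}}^{\{i,i+1\}}:\mathcal{B}(\mathcal{H}_i)\to\mathcal{B}(\mathcal{H}_i\otimes\mathcal{H}_{i+1})$,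 $1\le i\le n-1$, and a density matrix $\tilde\rho^{\{1\}}$ on $\mathcal{H}_1$ such that $$\rho = (\mathcal{I}_{\{1,\ldots,n-2\}}\otimes \Phi_{\{n-1\}}^{\{n-1,n\}})\circ \cdots \circ (\mathcal{I}_{\{1\}} \otimes \Phi_{\{2\}}^{\{2,3\}}) \circ \Phi_{\{1\}}^{\{1,2\}}(\tilde{\rho}^{\{1\}})$$ and, for each $i=2,\dots,n-1$, $$\big\|\Phi_{\{i-1\}}^{\{i-1,i\}}(\tilde{\rho}^{\{i-1\}}) - \mathrm{tr}_{i+1}\big[(\mathcal{I}_{\{i-1\}} \otimes \Phi_{\{i\}}^{\{i,i+1\}})\circ \Phi_{\{i-1\}}^{\{i-1,i\}}(\tilde{\rho}^{\{i-1\}})\big]\big\|_1 \leq \epsilon,$$ where $\tilde{\rho}^{\{i\}} := \mathrm{tr}_{1,\ldots,i-1}\big[(\mathcal{I}_{\{1,\ldots,i-2\}} \otimes \Phi_{\{i-1\}}^{\{i-1,i\}})\circ\cdots\circ\Phi_{\{1\}}^{\{1,2\}}(\tilde{\rho}^{\{1\}})\big]$. *)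

theory Defs
  imports Complex_Main "Jordan_Normal_Form.Schur_Decomposition"
begin

(* The Hilbert space of a qudit is C^d with its standard basis, that of the sites 1, ..., n is
   C^(d^n): the basis vector e_{x_1} (x) ... (x) e_{x_n} has the index whose base-d digits, most
   significant first, are x_1, ..., x_n.  Hence C^k (x) C^m is C^(k * m) with e_a (x) e_i having
   index a * m + i, and operators on neighbouring groups of sites are handled by splitting
   indices with div and mod. *)

section \<open>Matrices\<close>

definition mat_trace :: "complex mat \<Rightarrow> complex" where
  "mat_trace A = (\<Sum>i<dim_row A. A $$ (i, i))"

definition hermitian :: "nat \<Rightarrow> complex mat \<Rightarrow> bool" where
  "hermitian n A \<longleftrightarrow> A \<in> carrier_mat n n \<and> mat_adjoint A = A"

definition unitary :: "nat \<Rightarrow> complex mat \<Rightarrow> bool" where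
  "unitary n U \<longleftrightarrow> U \<in> carrier_mat n n \<and> mat_adjoint U * U = 1\<^sub>m n \<and> U * mat_adjoint U = 1\<^sub>m n"

(* The order on complex numbers is the one of HOL-Library.Complex_Order: 0 \<le> z says that z is real
   and nonnegative. *)
definition psd :: "nat \<Rightarrow> complex mat \<Rightarrow> bool" where
  "psd n A \<longleftrightarrow> hermitian n A \<and> (\<forall>v \<in> carrier_vec n. 0 \<le> (A *\<^sub>v v) \<bullet>c v)"

definition density :: "nat \<Rightarrow> complex mat \<Rightarrow> bool" where
  "density n \<rho> \<longleftrightarrow> psd n \<rho> \<and> mat_trace \<rho> = 1"

definition real_diag :: "nat \<Rightarrow> (nat \<Rightarrow> real) \<Rightarrow> complex mat" where
  "real_diag n e = mat n n (\<lambda>(i, j). if i = j then complex_of_real (e i) else 0)"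

(* The functional calculus f(A) of a Hermitian matrix A: the result does not depend on the chosen
   diagonalization.  Only used for Hermitian A. *)
definition mat_fun :: "(real \<Rightarrow> real) \<Rightarrow> complex mat \<Rightarrow> complex mat" where
  "mat_fun f A = (THE B. \<exists>U e. unitary (dim_row A) U \<and>
     A = U * real_diag (dim_row A) e * mat_adjoint U \<and>
     B = U * real_diag (dim_row A) (\<lambda>i. f (e i)) * mat_adjoint U)"

definition trace_norm :: "complex mat \<Rightarrow> real" where
  "trace_norm A = Re (mat_trace (mat_fun sqrt (mat_adjoint A * A)))"

section \<open>Entropy\<close>

(* The base b of the logarithm is a parameter.  On the kernel of \<rho> the value chosen for the
   logarithm at 0 is irrelevant, as it is multiplied by 0; this is the convention 0 log 0 = 0. *)
definition vn_entropy :: "real \<Rightarrow> complex mat \<Rightarrow> real" where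
  "vn_entropy b \<rho> = - Re (mat_trace (\<rho> * mat_fun (log b) \<rho>))"

definition bin_entropy :: "real \<Rightarrow> real \<Rightarrow> real" where
  "bin_entropy b p = - p * log b p - (1 - p) * log b (1 - p)"

definition free_energy :: "real \<Rightarrow> real \<Rightarrow> complex mat \<Rightarrow> complex mat \<Rightarrow> real" where
  "free_energy b T H \<sigma> = Re (mat_trace (\<sigma> * H)) - T * vn_entropy b \<sigma>"

section \<open>Partial traces and reduced density matrices\<close>

(* Traces over the first, resp. second, factor of C^k (x) C^m. *)
definition ptrace_left :: "nat \<Rightarrow> nat \<Rightarrow> complex mat \<Rightarrow> complex mat" where
  "ptrace_left k m A = mat m m (\<lambda>(i, j). \<Sum>a<k. A $$ (a * m + i, a * m + j))"

definition ptrace_right :: "nat \<Rightarrow> nat \<Rightarrow> complex mat \<Rightarrow> complex mat" where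
  "ptrace_right k m A = mat k k (\<lambda>(a, b). \<Sum>i<m. A $$ (a * m + i, b * m + i))"

(* The reduced matrix on the sites i, ..., j of a matrix on the sites 1, ..., n, for
   1 \<le> i \<le> j \<le> n: the sites j + 1, ..., n are traced out first, then 1, ..., i - 1. *)
definition reduced :: "nat \<Rightarrow> nat \<Rightarrow> nat \<Rightarrow> nat \<Rightarrow> complex mat \<Rightarrow> complex mat" where
  "reduced d n i j \<rho> =
     ptrace_left (d ^ (i - 1)) (d ^ (j + 1 - i)) (ptrace_right (d ^ j) (d ^ (n - j)) \<rho>)"

section \<open>Quantum channels\<close>

definition superop :: "nat \<Rightarrow> nat \<Rightarrow> (complex mat \<Rightarrow> complex mat) \<Rightarrow> bool" where
  "superop m p \<Phi> \<longleftrightarrow>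
     (\<forall>A \<in> carrier_mat m m. \<Phi> A \<in> carrier_mat p p) \<and>
     (\<forall>A \<in> carrier_mat m m. \<forall>B \<in> carrier_mat m m. \<Phi> (A + B) = \<Phi> A + \<Phi> B) \<and>
     (\<forall>c. \<forall>A \<in> carrier_mat m m. \<Phi> (c \<cdot>\<^sub>m A) = c \<cdot>\<^sub>m \<Phi> A)"

definition mat_block :: "nat \<Rightarrow> complex mat \<Rightarrow> nat \<Rightarrow> nat \<Rightarrow> complex mat" where
  "mat_block m A a b = mat m m (\<lambda>(i, j). A $$ (a * m + i, b * m + j))"

(* The superoperator I (x) \<Phi> on C^k (x) C^m, where \<Phi> takes m x m to p x p matrices.  A matrix on
   C^k (x) C^m is a sum of matrices E_ab (x) A_ab, with E_ab the matrix units of size k and A_ab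
   the block (a, b) of size m; it is sent to the sum of the matrices E_ab (x) \<Phi>(A_ab). *)
definition id_tensor :: "nat \<Rightarrow> nat \<Rightarrow> nat \<Rightarrow> (complex mat \<Rightarrow> complex mat) \<Rightarrow> complex mat \<Rightarrow> complex mat"
  where
  "id_tensor k m p \<Phi> A =
     mat (k * p) (k * p) (\<lambda>(r, s). \<Phi> (mat_block m A (r div p) (s div p)) $$ (r mod p, s mod p))"

definition completely_positive :: "nat \<Rightarrow> nat \<Rightarrow> (complex mat \<Rightarrow> complex mat) \<Rightarrow> bool" where
  "completely_positive m p \<Phi> \<longleftrightarrow> (\<forall>k A. psd (k * m) A \<longrightarrow> psd (k * p) (id_tensor k m p \<Phi> A))"

definition trace_preserving :: "nat \<Rightarrow> (complex mat \<Rightarrow> complex mat) \<Rightarrow> bool" where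
  "trace_preserving m \<Phi> \<longleftrightarrow> (\<forall>A \<in> carrier_mat m m. mat_trace (\<Phi> A) = mat_trace A)"

definition cptp :: "nat \<Rightarrow> nat \<Rightarrow> (complex mat \<Rightarrow> complex mat) \<Rightarrow> bool" where
  "cptp m p \<Phi> \<longleftrightarrow> superop m p \<Phi> \<and> completely_positive m p \<Phi> \<and> trace_preserving m \<Phi>"

section \<open>Markovian matrix product density operators\<close>

(* \<Phi> i is the channel from site i to the sites i, i + 1.  After the first m channels have been
   applied to the matrix \<tau> on site 1, the result mpdo_chain d \<Phi> \<tau> m lives on the sites
   1, ..., m + 1. *)
primrec mpdo_chain ::
  "nat \<Rightarrow> (nat \<Rightarrow> complex mat \<Rightarrow> complex mat) \<Rightarrow> complex mat \<Rightarrow> nat \<Rightarrow> complex mat" where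
  "mpdo_chain d \<Phi> \<tau> 0 = \<tau>"
| "mpdo_chain d \<Phi> \<tau> (Suc m) = id_tensor (d ^ m) d (d ^ 2) (\<Phi> (Suc m)) (mpdo_chain d \<Phi> \<tau> m)"

(* The matrix on site i that the channel \<Phi> i is applied to; this is \<tau> for i = 1. *)
definition mpdo_site ::
  "nat \<Rightarrow> (nat \<Rightarrow> complex mat \<Rightarrow> complex mat) \<Rightarrow> complex mat \<Rightarrow> nat \<Rightarrow> complex mat" where
  "mpdo_site d \<Phi> \<tau> i = ptrace_left (d ^ (i - 1)) d (mpdo_chain d \<Phi> \<tau> (i - 1))"

definition approx_markovian_mpdo :: "real \<Rightarrow> nat \<Rightarrow> nat \<Rightarrow> complex mat \<Rightarrow> bool" where
  "approx_markovian_mpdo \<epsilon> d n \<rho> \<longleftrightarrow> density (d ^ n) \<rho> \<and>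
     (\<exists>\<Phi> \<tau>. (\<forall>i \<in> {1..n - 1}. cptp d (d ^ 2) (\<Phi> i)) \<and> density d \<tau> \<and>
       \<rho> = mpdo_chain d \<Phi> \<tau> (n - 1) \<and>
       (\<forall>i \<in> {2..n - 1}.
          let \<omega> = \<Phi> (i - 1) (mpdo_site d \<Phi> \<tau> (i - 1))
          in trace_norm (\<omega> - ptrace_right (d ^ 2) d (id_tensor d d (d ^ 2) (\<Phi> i) \<omega>)) \<le> \<epsilon>))"

end

(* Umegaki's relative entropy D(A|B) = tr A ln A - tr A ln B satisfies
     D(A|B) = lim (G(s) - tr A * ln s) - G(0+)   as s tends to infinity,
   where G(s) = sum_ij |<u_i|v_j>|^2 e_i ln (g_j + s e_i) for eigenpairs (e_i, u_i) of A and
   (g_j, v_j) of B.  The derivative of G at s is the maximum over all X of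
     2 Re tr (A X) - tr (X B X') - s tr (X' A X),   where X' is the adjoint of X,
   which is linear in (A, B).  Hence every inequality between these maxima for all s > 0 yields an
   inequality of relative entropies.  This gives joint subadditivity, the monotonicity in B, and,
   with X the image of Y under the adjoint of a channel and the Schwarz inequality for that adjoint,
   the data processing inequality.

   Data processing for A versus 1 (x) tr_1 A says that a channel acting on the last site does not
   decrease the conditional entropy of the earlier sites given the last one.  Applied to every
   channel of the MPDO and summed, it bounds S(rho) below by the sum of the pair entropies minus
   the sum of the site entropies of the intermediate states Phi_i(tau_i).  These states are
   epsilon-close to the marginals of rho, so the Alicki-Fannes-Winter argument compares their
   conditional entropies.  Finally, the minimal free energy is at most the free energy of rho. *)
theory Submission
  imports Defs "Jordan_Normal_Form.Spectral_Radius"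
begin

section \<open>Matrices and positivity\<close>

text \<open>The maximum over X is explicit because the superoperators X -> s A X and X -> X B
  commute: the matrix units |u_i><v_j| of the two eigenbases diagonalize both, so the problem splits
  into scalar quadratic ones with maxima |<u_i|v_j>|^2 e_i^2 / (g_j + s e_i). What shapes the proof
  are kernels: with ln 0 = 0 the limit G(0+) is tr A ln B only if ker B is contained in ker A, and
  the predicate \<open>dominated\<close> carries this condition along. The inequalities are proved
  for positive matrices of arbitrary trace, so subadditivity takes the place of convexity and
  mixtures carry no weights. The constant in the theorem is generous: with t half the trace norm
  distance, hence t <= eps/2, one conditional entropy costs at most 3 t ln d + (1 + t) ln (1 + t) -
  t ln t, and for d >= 2 this is absorbed by 4 eps ln d - 4 eps ln (2 eps). The marginal on the last
  pair is exact, which leaves n - 2 errors. Logarithms are natural until the final division by ln b.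
  The minimum is an attained one: a ground state for T = 0, the Gibbs state for T > 0.\<close>

lemma adjoint_index [simp]:
  "i < dim_col A \<Longrightarrow> j < dim_row A \<Longrightarrow> mat_adjoint A $$ (i, j) = cnj (A $$ (j, i))" for A :: "complex mat"
  unfolding mat_adjoint_def by (simp add: mat_of_rows_index)

lemma adjoint_dim [simp]:
  "dim_row (mat_adjoint A) = dim_col A" "dim_col (mat_adjoint A) = dim_row A" for A :: "complex mat"
  unfolding mat_adjoint_def by auto

lemma adjoint_carrier [simp, intro]:
  "A \<in> carrier_mat n m \<Longrightarrow> mat_adjoint A \<in> carrier_mat m n" for A :: "complex mat"
  by (intro carrier_matI) auto

lemma adjoint_adjoint [simp]: "mat_adjoint (mat_adjoint A) = A" for A :: "complex mat"
  by (rule eq_matI) auto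

lemma mult_index:
  "A \<in> carrier_mat n m \<Longrightarrow> B \<in> carrier_mat m k \<Longrightarrow> i < n \<Longrightarrow> j < k \<Longrightarrow>
    (A * B) $$ (i, j) = (\<Sum>l<m. A $$ (i, l) * B $$ (l, j))"
  by (simp add: scalar_prod_def atLeast0LessThan)

lemma adjoint_mult:
  fixes A B :: "complex mat"
  assumes "dim_col A = dim_row B"
  shows "mat_adjoint (A * B) = mat_adjoint B * mat_adjoint A"
  using assms
  by (intro eq_matI) (auto simp: scalar_prod_def intro!: sum.cong)

lemma adjoint_add:
  fixes A B :: "complex mat"
  assumes "dim_row A = dim_row B" "dim_col A = dim_col B"
  shows "mat_adjoint (A + B) = mat_adjoint A + mat_adjoint B"
  using assms by (intro eq_matI) auto

lemma adjoint_minus: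
  fixes A B :: "complex mat"
  assumes "dim_row A = dim_row B" "dim_col A = dim_col B"
  shows "mat_adjoint (A - B) = mat_adjoint A - mat_adjoint B"
  using assms by (intro eq_matI) auto

lemma adjoint_smult: "mat_adjoint (c \<cdot>\<^sub>m A) = cnj c \<cdot>\<^sub>m mat_adjoint A" for A :: "complex mat"
  by (intro eq_matI) auto

lemma adjoint_one [simp]: "mat_adjoint (1\<^sub>m n :: complex mat) = 1\<^sub>m n"
  by (intro eq_matI) auto

text \<open>The side conditions are equations between dimensions, so \<open>simp\<close> can
  discharge them and normalize long products to right-nested form.\<close>

lemma mult_assoc_dim:
  fixes A :: "complex mat"
  assumes "dim_col A = dim_row B" "dim_col B = dim_row C"
  shows "A * B * C = A * (B * C)"
  using assms by (intro assoc_mult_mat) (auto intro: carrier_matI)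

lemma trace_add:
  "A \<in> carrier_mat n n \<Longrightarrow> B \<in> carrier_mat n n \<Longrightarrow> mat_trace (A + B) = mat_trace A + mat_trace B"
  by (simp add: mat_trace_def sum.distrib)

lemma trace_minus:
  "A \<in> carrier_mat n n \<Longrightarrow> B \<in> carrier_mat n n \<Longrightarrow> mat_trace (A - B) = mat_trace A - mat_trace B"
  by (simp add: mat_trace_def sum_subtractf)

lemma trace_smult: "A \<in> carrier_mat n n \<Longrightarrow> mat_trace (c \<cdot>\<^sub>m A) = c * mat_trace A"
  by (simp add: mat_trace_def sum_distrib_left)

lemma trace_adjoint: "A \<in> carrier_mat n n \<Longrightarrow> mat_trace (mat_adjoint A) = cnj (mat_trace A)"
  by (simp add: mat_trace_def)

lemma trace_mult:
  "A \<in> carrier_mat n m \<Longrightarrow> B \<in> carrier_mat m n \<Longrightarrow>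
    mat_trace (A * B) = (\<Sum>i<n. \<Sum>j<m. A $$ (i, j) * B $$ (j, i))"
  unfolding mat_trace_def by (auto simp: mult_index simp del: index_mult_mat(1) intro!: sum.cong)

lemma trace_comm:
  assumes "A \<in> carrier_mat n m" "B \<in> carrier_mat m n"
  shows "mat_trace (A * B) = mat_trace (B * A)"
  unfolding trace_mult[OF assms] trace_mult[OF assms(2,1)]
  by (subst sum.swap) (simp add: mult.commute)

lemma trace_comm_dim:
  assumes "dim_row A = dim_col B" "dim_col A = dim_row B"
  shows "mat_trace (A * B) = mat_trace (B * A)"
  using assms by (intro trace_comm) (auto intro: carrier_matI)

lemma sandwich_index:
  assumes "R \<in> carrier_mat k n" "T \<in> carrier_mat n n" "S \<in> carrier_mat l n" "i < k" "j < l"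
  shows "(R * T * mat_adjoint S) $$ (i, j) =
    (\<Sum>r<n. \<Sum>s<n. R $$ (i, r) * T $$ (r, s) * cnj (S $$ (j, s)))"
proof -
  have "(R * T * mat_adjoint S) $$ (i, j) = (\<Sum>s<n. (R * T) $$ (i, s) * mat_adjoint S $$ (s, j))"
    using assms by (intro mult_index[of _ k]) auto
  also have "\<dots> = (\<Sum>s<n. \<Sum>r<n. R $$ (i, r) * T $$ (r, s) * cnj (S $$ (j, s)))"
    using assms by (intro sum.cong refl) (simp add: mult_index[of R k n T n] sum_distrib_right del: index_mult_mat(1))
  finally show ?thesis by (subst sum.swap)
qed

section \<open>Hermitian and positive semidefinite matrices\<close>

lemma hermitianD:
  assumes "hermitian n A"
  shows "A \<in> carrier_mat n n" "mat_adjoint A = A" "i < n \<Longrightarrow> j < n \<Longrightarrow> A $$ (i, j) = cnj (A $$ (j, i))"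
proof -
  show A: "A \<in> carrier_mat n n" "mat_adjoint A = A" using assms by (auto simp: hermitian_def)
  assume "i < n" "j < n"
  then have "mat_adjoint A $$ (i, j) = cnj (A $$ (j, i))" using A(1) by (intro adjoint_index) auto
  then show "A $$ (i, j) = cnj (A $$ (j, i))" unfolding A(2) .
qed

lemma hermitianI:
  assumes "A \<in> carrier_mat n n" "\<And>i j. i < n \<Longrightarrow> j < n \<Longrightarrow> A $$ (i, j) = cnj (A $$ (j, i))"
  shows "hermitian n A"
proof -
  have "mat_adjoint A = A"
    using assms(1) by (intro eq_matI) (auto simp: assms(2)[symmetric])
  then show ?thesis using assms(1) by (simp add: hermitian_def)
qed

lemma quadratic_form_index:
  assumes "A \<in> carrier_mat n n" "v \<in> carrier_vec n"
  shows "(A *\<^sub>v v) \<bullet>c v = (\<Sum>i<n. \<Sum>j<n. cnj (v $ i) * A $$ (i, j) * v $ j)"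
  using assms
  by (auto simp: scalar_prod_def atLeast0LessThan sum_distrib_left sum_distrib_right mult_ac intro!: sum.cong)

text \<open>With functions on indices in place of vectors, the form can be evaluated at functions
  given by case distinctions, and its sums can be split into blocks.\<close>

lemma psd_iff:
  "psd n A \<longleftrightarrow> hermitian n A \<and>
    (\<forall>f. 0 \<le> (\<Sum>i<n. \<Sum>j<n. cnj (f i) * A $$ (i, j) * f j))"
proof -
  have "(\<forall>v \<in> carrier_vec n. 0 \<le> (A *\<^sub>v v) \<bullet>c v) \<longleftrightarrow>
    (\<forall>f. 0 \<le> (\<Sum>i<n. \<Sum>j<n. cnj (f i) * A $$ (i, j) * f j))" if A: "A \<in> carrier_mat n n"
  proof (intro iffI allI ballI)
    fix f assume *: "\<forall>v \<in> carrier_vec n. 0 \<le> (A *\<^sub>v v) \<bullet>c v"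
    have "0 \<le> (A *\<^sub>v vec n f) \<bullet>c vec n f" using * by simp
    also have "\<dots> = (\<Sum>i<n. \<Sum>j<n. cnj (f i) * A $$ (i, j) * f j)"
      by (subst quadratic_form_index[OF A]) auto
    finally show "0 \<le> \<dots>" .
  next
    fix v :: "complex vec"
    assume v: "v \<in> carrier_vec n" and *: "\<forall>f. 0 \<le> (\<Sum>i<n. \<Sum>j<n. cnj (f i) * A $$ (i, j) * f j)"
    show "0 \<le> (A *\<^sub>v v) \<bullet>c v"
      unfolding quadratic_form_index[OF A v] using *[rule_format, of "\<lambda>i. v $ i"] .
  qed
  then show ?thesis unfolding psd_def hermitian_def by blast
qed

lemma psdI:
  assumes "hermitian n A" "\<And>f. 0 \<le> (\<Sum>i<n. \<Sum>j<n. cnj (f i) * A $$ (i, j) * f j)"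
  shows "psd n A"
  using assms by (simp add: psd_iff)

lemma psd_form_nonneg: "psd n A \<Longrightarrow> 0 \<le> (\<Sum>i<n. \<Sum>j<n. cnj (f i) * A $$ (i, j) * f j)"
  by (simp add: psd_iff)

lemma psd_hermitian: "psd n A \<Longrightarrow> hermitian n A"
  by (simp add: psd_def)

lemma psd_carrier: "psd n A \<Longrightarrow> A \<in> carrier_mat n n"
  by (simp add: psd_def hermitian_def)

lemma psd_diag:
  assumes A: "psd n A" and k: "k < n"
  shows "0 \<le> A $$ (k, k)"
proof -
  have "0 \<le> (\<Sum>i<n. \<Sum>j<n. cnj (if i = k then 1 else 0) * A $$ (i, j) * (if j = k then 1 else 0))"
    by (rule psd_form_nonneg[OF A])
  also have "\<dots> = (\<Sum>i<n. if i = k then A $$ (i, k) else 0)"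
    using k by (intro sum.cong refl) (simp add: if_distrib[of "\<lambda>x. _ * x"] cong: if_cong)
  also have "\<dots> = A $$ (k, k)" using k by simp
  finally show ?thesis .
qed

lemma psd_trace:
  assumes "psd n A"
  shows "0 \<le> mat_trace A"
proof -
  have "dim_row A = n" using psd_carrier[OF assms] by simp
  then show ?thesis unfolding mat_trace_def using psd_diag[OF assms] by (auto intro: sum_nonneg)
qed

text \<open>The quadratic form at f is that of T at the image of f under the adjoint of R. The
  matrix R may be rectangular, as is needed for rows and columns of blocks.\<close>

lemma psd_sandwich:
  assumes T: "psd n T" and R: "R \<in> carrier_mat k n"
  shows "psd k (R * T * mat_adjoint R)"
proof (rule psdI)
  have Tc: "T \<in> carrier_mat n n" and Ta: "mat_adjoint T = T"
    using T by (auto simp: psd_def hermitian_def)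
  have "mat_adjoint (R * T * mat_adjoint R) = R * T * mat_adjoint R"
    using R Tc Ta by (simp add: adjoint_mult mult_assoc_dim)
  then show "hermitian k (R * T * mat_adjoint R)"
    using R Tc unfolding hermitian_def by (auto intro: carrier_matI)
  fix f
  have "(\<Sum>i<k. \<Sum>j<k. cnj (f i) * (R * T * mat_adjoint R) $$ (i, j) * f j)
      = (\<Sum>i<k. \<Sum>j<k. \<Sum>r<n. \<Sum>s<n. (cnj (f i) * R $$ (i, r)) * T $$ (r, s) * (cnj (R $$ (j, s)) * f j))"
    by (intro sum.cong refl)
      (simp add: sandwich_index[OF R Tc R] sum_distrib_left sum_distrib_right mult_ac del: index_mult_mat(1))
  also have "\<dots> = (\<Sum>r<n. \<Sum>s<n. \<Sum>i<k. \<Sum>j<k. (cnj (f i) * R $$ (i, r)) * T $$ (r, s) * (cnj (R $$ (j, s)) * f j))"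
    apply (subst (2) sum.swap)
    apply (subst (3) sum.swap)
    apply (subst sum.swap)
    apply (subst (2) sum.swap)
    ..
  also have "\<dots> = (\<Sum>r<n. \<Sum>s<n. cnj (\<Sum>i<k. cnj (R $$ (i, r)) * f i) * T $$ (r, s) * (\<Sum>j<k. cnj (R $$ (j, s)) * f j))"
    by (intro sum.cong refl) (simp add: sum_distrib_left sum_distrib_right mult_ac)
  also have "0 \<le> \<dots>" by (rule psd_form_nonneg[OF T])
  finally show "0 \<le> (\<Sum>i<k. \<Sum>j<k. cnj (f i) * (R * T * mat_adjoint R) $$ (i, j) * f j)" .
qed

lemma hermitian_add: "hermitian n A \<Longrightarrow> hermitian n B \<Longrightarrow> hermitian n (A + B)"
  by (auto simp: hermitian_def adjoint_add)

lemma hermitian_minus: "hermitian n A \<Longrightarrow> hermitian n B \<Longrightarrow> hermitian n (A - B)"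
  by (auto simp: hermitian_def adjoint_minus)

lemma psd_add:
  assumes "psd n A" "psd n B"
  shows "psd n (A + B)"
proof (rule psdI)
  show "hermitian n (A + B)" using assms by (intro hermitian_add psd_hermitian)
  have c: "A \<in> carrier_mat n n" "B \<in> carrier_mat n n" using assms by (auto dest: psd_carrier)
  fix f
  have "(\<Sum>i<n. \<Sum>j<n. cnj (f i) * (A + B) $$ (i, j) * f j) =
    (\<Sum>i<n. \<Sum>j<n. cnj (f i) * A $$ (i, j) * f j) + (\<Sum>i<n. \<Sum>j<n. cnj (f i) * B $$ (i, j) * f j)"
    unfolding sum.distrib[symmetric] using c by (intro sum.cong refl) (auto simp: algebra_simps)
  also have "0 \<le> \<dots>" using assms by (intro add_nonneg_nonneg psd_form_nonneg)
  finally show "0 \<le> (\<Sum>i<n. \<Sum>j<n. cnj (f i) * (A + B) $$ (i, j) * f j)" .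
qed

section \<open>Real diagonal and unitary matrices\<close>

lemma real_diag_carrier [simp, intro]: "real_diag n e \<in> carrier_mat n n"
  by (simp add: real_diag_def)

lemma real_diag_dim [simp]: "dim_row (real_diag n e) = n" "dim_col (real_diag n e) = n"
  by (simp_all add: real_diag_def)

lemma real_diag_index: "i < n \<Longrightarrow> j < n \<Longrightarrow> real_diag n e $$ (i, j) = (if i = j then of_real (e i) else 0)"
  by (simp add: real_diag_def)

lemma adjoint_real_diag [simp]: "mat_adjoint (real_diag n e) = real_diag n e"
  by (rule eq_matI) (auto simp: real_diag_index)

lemma mult_real_diag_index:
  assumes "A \<in> carrier_mat k n" "i < k" "j < n"
  shows "(A * real_diag n e) $$ (i, j) = A $$ (i, j) * of_real (e j)"
proof -
  have "(A * real_diag n e) $$ (i, j) = (\<Sum>l<n. A $$ (i, l) * real_diag n e $$ (l, j))"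
    using assms by (intro mult_index) auto
  also have "\<dots> = (\<Sum>l<n. if l = j then A $$ (i, j) * of_real (e j) else 0)"
    using assms by (intro sum.cong refl) (auto simp: real_diag_index)
  finally show ?thesis using assms by simp
qed

lemma real_diag_mult_index:
  assumes "A \<in> carrier_mat n k" "i < n" "j < k"
  shows "(real_diag n e * A) $$ (i, j) = of_real (e i) * A $$ (i, j)"
proof -
  have "(real_diag n e * A) $$ (i, j) = (\<Sum>l<n. real_diag n e $$ (i, l) * A $$ (l, j))"
    using assms by (intro mult_index) auto
  also have "\<dots> = (\<Sum>l<n. if l = i then of_real (e i) * A $$ (i, j) else 0)"
    using assms by (intro sum.cong refl) (auto simp: real_diag_index)
  finally show ?thesis using assms by simp
qed

lemma psd_real_diag:
  assumes "\<And>i. i < n \<Longrightarrow> 0 \<le> e i"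
  shows "psd n (real_diag n e)"
proof (rule psdI)
  show "hermitian n (real_diag n e)" by (simp add: hermitian_def)
  fix f
  have "(\<Sum>i<n. \<Sum>j<n. cnj (f i) * real_diag n e $$ (i, j) * f j) =
     (\<Sum>i<n. \<Sum>j<n. if j = i then of_real (e i * (cmod (f i))\<^sup>2) else 0)"
    by (intro sum.cong refl) (auto simp: real_diag_index complex_norm_square mult_ac simp del: of_real_power)
  also have "\<dots> = of_real (\<Sum>i<n. e i * (cmod (f i))\<^sup>2)" by simp
  also have "0 \<le> \<dots>" using assms by (auto simp: less_eq_complex_def intro!: sum_nonneg)
  finally show "0 \<le> (\<Sum>i<n. \<Sum>j<n. cnj (f i) * real_diag n e $$ (i, j) * f j)" .
qed

lemma unitaryD:
  assumes "unitary n U"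
  shows "U \<in> carrier_mat n n" "mat_adjoint U * U = 1\<^sub>m n" "U * mat_adjoint U = 1\<^sub>m n"
    "dim_row U = n" "dim_col U = n"
  using assms by (auto simp: unitary_def)

lemma unitary_cancel:
  assumes "unitary n U" "dim_row X = n"
  shows "mat_adjoint U * (U * X) = X" "U * (mat_adjoint U * X) = X"
proof -
  note U = unitaryD[OF assms(1)]
  have X: "X \<in> carrier_mat n (dim_col X)" using assms(2) by (intro carrier_matI) auto
  show "mat_adjoint U * (U * X) = X"
    using assoc_mult_mat[OF adjoint_carrier[OF U(1)] U(1) X] U(2) left_mult_one_mat[OF X] by argo
  show "U * (mat_adjoint U * X) = X"
    using assoc_mult_mat[OF U(1) adjoint_carrier[OF U(1)] X] U(3) left_mult_one_mat[OF X] by argo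
qed

lemma unitaryI:
  assumes "U \<in> carrier_mat n n" "mat_adjoint U * U = 1\<^sub>m n"
  shows "unitary n U"
  using assms mat_mult_left_right_inverse[of "mat_adjoint U" n U] by (auto simp: unitary_def)

lemma unitary_mult:
  assumes U: "unitary n U" and V: "unitary n V"
  shows "unitary n (U * V)"
proof (rule unitaryI)
  note U' = unitaryD[OF U] and V' = unitaryD[OF V]
  show "U * V \<in> carrier_mat n n" using U'(1) V'(1) by simp
  have "mat_adjoint (U * V) * (U * V) = mat_adjoint V * (mat_adjoint U * (U * V))"
    using U'(4,5) V'(4,5) by (simp add: adjoint_mult mult_assoc_dim)
  then show "mat_adjoint (U * V) * (U * V) = 1\<^sub>m n"
    using unitary_cancel(1)[OF U, of V] V'(2,4) by simp
qed

lemma unitary_adjoint: "unitary n U \<Longrightarrow> unitary n (mat_adjoint U)"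
  by (auto simp: unitary_def)

section \<open>The spectral theorem and functional calculus\<close>

definition diagonalizes :: "nat \<Rightarrow> complex mat \<Rightarrow> (nat \<Rightarrow> real) \<Rightarrow> complex mat \<Rightarrow> bool" where
  "diagonalizes n U e A \<longleftrightarrow> unitary n U \<and> A = U * real_diag n e * mat_adjoint U"

text \<open>Gram-Schmidt applied to a basis starting with v keeps v in first place. It remains to
  normalize the columns, which is where the factor c comes from.\<close>

lemma unitary_first_column:
  assumes v: "v \<in> carrier_vec n" and v0: "v \<noteq> 0\<^sub>v n"
  shows "\<exists>W c. unitary n W \<and> (\<forall>i<n. W $$ (i, 0) = c * v $ i)"
proof -
  interpret cof_vec_space n "TYPE(complex)" .
  define b where "b = basis_completion v"
  define ws where "ws = gram_schmidt n b"
  note bc = basis_completion[OF v v0, folded b_def]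
  have n: "n \<noteq> 0" using v v0 by (metis carrier_vecD eq_vecI not_less_zero zero_carrier_vec)
  from bc(6,7) n obtain vs where bv: "b = v # vs" by (cases b) auto
  from gram_schmidt_result[OF bc(2) bc(4) bc(5) refl, folded ws_def]
  have ws: "set ws \<subseteq> carrier_vec n" "corthogonal ws" "length ws = n"
    using bc(6) by auto
  from gram_schmidt_hd[OF v, of vs, folded bv] have hdws: "hd ws = v" unfolding ws_def .
  then have ws0: "ws ! 0 = v" using ws(3) n by (cases ws) auto
  have wsc: "ws ! i \<in> carrier_vec n" if "i < n" for i using ws that by auto
  define s where "s i = Re (ws ! i \<bullet>c ws ! i)" for i
  have s: "ws ! i \<bullet>c ws ! i = of_real (s i)" "s i > 0" if "i < n" for i
  proof -
    have "0 \<le> ws ! i \<bullet>c ws ! i" by (rule conjugate_square_ge_0_vec)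
    moreover have "ws ! i \<bullet>c ws ! i \<noteq> 0" using corthogonalD[OF ws(2), of i i] that ws(3) by auto
    ultimately show "ws ! i \<bullet>c ws ! i = of_real (s i)" "s i > 0"
      unfolding s_def by (auto simp: less_eq_complex_def complex_eq_iff)
  qed
  define W where "W = mat n n (\<lambda>(i, j). ws ! j $ i / of_real (sqrt (s j)))"
  have W: "W \<in> carrier_mat n n" by (simp add: W_def)
  have "mat_adjoint W * W = 1\<^sub>m n"
  proof (rule eq_matI)
    fix i j assume "i < dim_row (1\<^sub>m n :: complex mat)" "j < dim_col (1\<^sub>m n :: complex mat)"
    then have ij: "i < n" "j < n" by auto
    have "(mat_adjoint W * W) $$ (i, j) = (\<Sum>k<n. mat_adjoint W $$ (i, k) * W $$ (k, j))"
      using W ij by (intro mult_index) auto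
    also have "\<dots> = (\<Sum>k<n. ws ! j $ k * cnj (ws ! i $ k) / of_real (sqrt (s i) * sqrt (s j)))"
      using W ij by (intro sum.cong refl) (auto simp: W_def)
    also have "\<dots> = (ws ! j \<bullet>c ws ! i) / of_real (sqrt (s i) * sqrt (s j))"
      unfolding scalar_prod_def using wsc[OF ij(1)] wsc[OF ij(2)]
      by (simp add: sum_divide_distrib atLeast0LessThan)
    also have "\<dots> = 1\<^sub>m n $$ (i, j)"
      using corthogonalD[OF ws(2), of j i] ij ws(3) s[OF ij(1)] by (cases "i = j") auto
    finally show "(mat_adjoint W * W) $$ (i, j) = 1\<^sub>m n $$ (i, j)" .
  qed (use W in auto)
  then have "unitary n W" by (rule unitaryI[OF W])
  moreover have "\<forall>i<n. W $$ (i, 0) = (1 / of_real (sqrt (s 0))) * v $ i"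
    using n by (simp add: W_def ws0)
  ultimately show ?thesis by blast
qed

text \<open>W has an eigenvector as its first column. Only the first column of the transformed
  matrix is described, since Hermitian symmetry then determines the first row.\<close>

lemma hermitian_deflation:
  assumes A: "hermitian n A" and n: "n \<noteq> 0"
  shows "\<exists>W l. unitary n W \<and> (\<forall>i<n. (mat_adjoint W * A * W) $$ (i, 0) = (if i = 0 then of_real l else 0))"
proof -
  note Ac = hermitianD(1)[OF A]
  obtain z v where ev: "eigenvector A v z"
    using spectrum_non_empty[OF Ac] n unfolding spectrum_def eigenvalue_def by auto
  then have v: "v \<in> carrier_vec n" "v \<noteq> 0\<^sub>v n" "A *\<^sub>v v = z \<cdot>\<^sub>v v"
    using Ac unfolding eigenvector_def by auto
  obtain W c where W: "unitary n W" and Wc: "\<And>i. i < n \<Longrightarrow> W $$ (i, 0) = c * v $ i"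
    using unitary_first_column[OF v(1,2)] by auto
  note W' = unitaryD[OF W]
  have AW: "(A * W) $$ (i, 0) = z * W $$ (i, 0)" if i: "i < n" for i
  proof -
    have "(A * W) $$ (i, 0) = (\<Sum>k<n. A $$ (i, k) * W $$ (k, 0))"
      using W' Ac n i by (intro mult_index) auto
    also have "\<dots> = c * (\<Sum>k<n. A $$ (i, k) * v $ k)"
      unfolding sum_distrib_left by (intro sum.cong refl) (simp add: Wc)
    also have "(\<Sum>k<n. A $$ (i, k) * v $ k) = (A *\<^sub>v v) $ i"
      using Ac v(1) i by (simp add: scalar_prod_def atLeast0LessThan)
    finally show ?thesis using v i by (simp add: Wc)
  qed
  let ?T = "mat_adjoint W * A * W"
  have T: "?T = mat_adjoint W * (A * W)" using W' Ac by (intro mult_assoc_dim) auto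
  have col: "?T $$ (i, 0) = z * (if i = 0 then 1 else 0)" if i: "i < n" for i
  proof -
    have "?T $$ (i, 0) = (\<Sum>k<n. mat_adjoint W $$ (i, k) * (A * W) $$ (k, 0))"
      unfolding T using W' Ac n i by (intro mult_index[of _ n n _ n]) auto
    also have "\<dots> = z * (\<Sum>k<n. mat_adjoint W $$ (i, k) * W $$ (k, 0))"
      unfolding sum_distrib_left by (intro sum.cong refl) (simp add: AW del: index_mult_mat(1))
    also have "(\<Sum>k<n. mat_adjoint W $$ (i, k) * W $$ (k, 0)) = (mat_adjoint W * W) $$ (i, 0)"
      using W' n i by (intro mult_index[symmetric, of _ n n _ n]) auto
    also have "\<dots> = (if i = 0 then 1 else 0)" unfolding W'(2) using i n by auto
    finally show ?thesis .
  qed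
  \<comment> \<open>The eigenvalue is the corner entry of a Hermitian matrix, hence real.\<close>
  have "mat_adjoint ?T = ?T"
    using W' Ac hermitianD(2)[OF A] by (simp add: adjoint_mult mult_assoc_dim)
  then have "cnj (?T $$ (0, 0)) = ?T $$ (0, 0)"
    using adjoint_index[of 0 ?T 0] W' n by (simp del: index_mult_mat(1))
  then have "cnj z = z" using col[of 0] n by simp
  then have "z = of_real (Re z)" by (simp add: complex_eq_iff)
  then show ?thesis using W col by (intro exI[of _ W] exI[of _ "Re z"]) auto
qed

text \<open>Induction on the size: after deflation by one eigenvector the matrix is block diagonal,
  and the induction hypothesis applies to the block that omits the first row and column.\<close>

theorem hermitian_diagonalizable:
  "hermitian n A \<Longrightarrow> \<exists>U e. diagonalizes n U e A"
proof (induction n arbitrary: A)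
  case 0
  then have "A = 1\<^sub>m 0 * real_diag 0 (\<lambda>_. 0) * mat_adjoint (1\<^sub>m 0)"
    by (intro eq_matI) (auto simp: hermitian_def)
  moreover have "unitary 0 (1\<^sub>m 0)" by (rule unitaryI) auto
  ultimately show ?case unfolding diagonalizes_def by blast
next
  case (Suc n A)
  note Ac = hermitianD(1)[OF Suc.prems]
  obtain W l where W: "unitary (Suc n) W"
    and col: "\<And>i. i < Suc n \<Longrightarrow> (mat_adjoint W * A * W) $$ (i, 0) = (if i = 0 then of_real l else 0)"
    using hermitian_deflation[OF Suc.prems] by auto
  note W' = unitaryD[OF W]
  define T where "T = mat_adjoint W * A * W"
  have "mat_adjoint T = T"
    unfolding T_def using W' Ac hermitianD(2)[OF Suc.prems] by (simp add: adjoint_mult mult_assoc_dim)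
  then have T: "hermitian (Suc n) T" using W' Ac unfolding hermitian_def T_def by auto
  note Tc = hermitianD(1)[OF T]
  define A3 where "A3 = mat n n (\<lambda>(i, j). T $$ (Suc i, Suc j))"
  have "hermitian n A3"
  proof (rule hermitianI)
    fix i j assume "i < n" "j < n"
    then show "A3 $$ (i, j) = cnj (A3 $$ (j, i))"
      using hermitianD(3)[OF T, of "Suc i" "Suc j"] by (simp add: A3_def)
  qed (simp add: A3_def)
  then obtain U e where Ue: "diagonalizes n U e A3" using Suc.IH by blast
  then have U: "unitary n U" and A3: "A3 = U * real_diag n e * mat_adjoint U" by (auto simp: diagonalizes_def)
  note U' = unitaryD[OF U]
  \<comment> \<open>The direct sum of the scalar a and the matrix X; products and adjoints act on
    the two summands separately.\<close>
  let ?B = "\<lambda>a X. four_block_mat (a \<cdot>\<^sub>m 1\<^sub>m 1) (0\<^sub>m 1 n) (0\<^sub>m n 1) X :: complex mat"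
  have B_mult: "?B a X * ?B c Y = ?B (a * c) (X * Y)" if "X \<in> carrier_mat n n" "Y \<in> carrier_mat n n" for a c X Y
  proof -
    have "?B a X * ?B c Y = four_block_mat (a \<cdot>\<^sub>m 1\<^sub>m 1 * (c \<cdot>\<^sub>m 1\<^sub>m 1) + 0\<^sub>m 1 n * 0\<^sub>m n 1)
        (a \<cdot>\<^sub>m 1\<^sub>m 1 * 0\<^sub>m 1 n + 0\<^sub>m 1 n * Y) (0\<^sub>m n 1 * (c \<cdot>\<^sub>m 1\<^sub>m 1) + X * 0\<^sub>m n 1)
        (0\<^sub>m n 1 * 0\<^sub>m 1 n + X * Y)"
      using that by (intro mult_four_block_mat[of _ 1 1 _ n _ n]) auto
    also have "\<dots> = ?B (a * c) (X * Y)"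
      using that by (intro cong_four_block_mat eq_matI) (auto simp: scalar_prod_def)
    finally show ?thesis .
  qed
  have B_adj: "mat_adjoint (?B 1 X) = ?B 1 (mat_adjoint X)" if "X \<in> carrier_mat n n" for X
    using that by (intro eq_matI) auto
  define V where "V = ?B 1 U"
  define g where "g i = (case i of 0 \<Rightarrow> l | Suc k \<Rightarrow> e k)" for i
  have V: "unitary (Suc n) V"
  proof (rule unitaryI)
    show "V \<in> carrier_mat (Suc n) (Suc n)" using U' unfolding V_def by (intro carrier_matI) auto
    have "mat_adjoint V * V = ?B 1 (1\<^sub>m n)"
      unfolding V_def B_adj[OF U'(1)] B_mult[OF adjoint_carrier[OF U'(1)] U'(1)] U'(2) by simp
    also have "\<dots> = 1\<^sub>m (Suc n)" by (intro eq_matI) auto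
    finally show "mat_adjoint V * V = 1\<^sub>m (Suc n)" .
  qed
  note V' = unitaryD[OF V]
  have D: "real_diag (Suc n) g = ?B (of_real l) (real_diag n e)"
    by (rule eq_matI) (auto simp: real_diag_index g_def split: nat.split)
  have "V * real_diag (Suc n) g * mat_adjoint V = ?B (of_real l) A3"
    unfolding V_def D A3 B_adj[OF U'(1)] B_mult[OF U'(1) real_diag_carrier]
      B_mult[OF mult_carrier_mat[OF U'(1) real_diag_carrier] adjoint_carrier[OF U'(1)]] by simp
  also have "\<dots> = T"
  proof (rule eq_matI)
    fix i j assume "i < dim_row T" "j < dim_col T"
    then have ij: "i < Suc n" "j < Suc n" using Tc by auto
    have c0: "T $$ (i, 0) = (if i = 0 then of_real l else 0)" if "i < Suc n" for i
      using col[OF that] by (simp add: T_def)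
    show "?B (of_real l) A3 $$ (i, j) = T $$ (i, j)"
      using ij c0[of i] c0[of j] hermitianD(3)[OF T, of i j]
      by (cases i; cases j) (auto simp: A3_def)
  qed (use Tc in \<open>auto simp: A3_def\<close>)
  finally have T_eq: "T = V * real_diag (Suc n) g * mat_adjoint V" by simp
  have "A = W * T * mat_adjoint W"
    using W' Ac unitary_cancel[OF W] unfolding T_def
    by (simp add: mult_assoc_dim)
  also have "\<dots> = (W * V) * real_diag (Suc n) g * mat_adjoint (W * V)"
    unfolding T_eq using W' V' by (simp add: adjoint_mult mult_assoc_dim)
  finally show ?case
    using unitary_mult[OF W V] unfolding diagonalizes_def by blast
qed

lemma diagonalizesD:
  assumes "diagonalizes n U e A"
  shows "unitary n U" "A = U * real_diag n e * mat_adjoint U" "A \<in> carrier_mat n n" "hermitian n A"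
    "U \<in> carrier_mat n n" "dim_row U = n" "dim_col U = n"
proof -
  show U: "unitary n U" and A: "A = U * real_diag n e * mat_adjoint U"
    using assms by (auto simp: diagonalizes_def)
  show U': "U \<in> carrier_mat n n" "dim_row U = n" "dim_col U = n" using unitaryD[OF U] by auto
  show "A \<in> carrier_mat n n" unfolding A by (metis U'(1) adjoint_carrier mult_carrier_mat real_diag_carrier)
  then show "hermitian n A" using U' unfolding hermitian_def A
    by (simp add: adjoint_mult mult_assoc_dim)
qed

text \<open>The unitary W = V'U intertwines the two diagonal matrices, so its entry (i, j) vanishes
  unless \<open>e j = g i\<close>. Hence it also intertwines their images under any f. This
  justifies the definite description in \<open>mat_fun\<close>.\<close>

lemma diagonalizes_fun_unique:
  assumes "diagonalizes n U e A" "diagonalizes n V g A"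
  shows "U * real_diag n (\<lambda>i. f (e i)) * mat_adjoint U = V * real_diag n (\<lambda>i. f (g i)) * mat_adjoint V"
proof -
  note U = diagonalizesD[OF assms(1)] and V = diagonalizesD[OF assms(2)]
  define W where "W = mat_adjoint V * U"
  have W: "W \<in> carrier_mat n n" using U V unfolding W_def by auto
  have "W * real_diag n e = mat_adjoint V * (A * U)"
    unfolding W_def U(2) using U(5-) V(5-) unitaryD(2)[OF U(1)]
    by (simp add: mult_assoc_dim right_mult_one_mat[of _ n n])
  also have "\<dots> = real_diag n g * W"
    unfolding W_def V(2) using U(5-) V(5-) unitary_cancel[OF V(1)]
    by (simp add: mult_assoc_dim)
  finally have comm: "W * real_diag n e = real_diag n g * W" .
  have "W * real_diag n (\<lambda>i. f (e i)) = real_diag n (\<lambda>i. f (g i)) * W"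
  proof (rule eq_matI)
    fix i j assume "i < dim_row (real_diag n (\<lambda>i. f (g i)) * W)" "j < dim_col (real_diag n (\<lambda>i. f (g i)) * W)"
    then have ij: "i < n" "j < n" using W by auto
    have "W $$ (i, j) * of_real (e j) = of_real (g i) * W $$ (i, j)"
      using arg_cong[OF comm, of "\<lambda>M. M $$ (i, j)"] ij W
      by (simp add: mult_real_diag_index real_diag_mult_index del: index_mult_mat(1))
    then have "W $$ (i, j) = 0 \<or> e j = g i" by (simp add: mult.commute)
    then show "(W * real_diag n (\<lambda>i. f (e i))) $$ (i, j) = (real_diag n (\<lambda>i. f (g i)) * W) $$ (i, j)"
      using ij W by (auto simp: mult_real_diag_index real_diag_mult_index simp del: index_mult_mat(1))
  qed (use W in auto)
  then have "V * (W * real_diag n (\<lambda>i. f (e i))) * mat_adjoint U = V * (real_diag n (\<lambda>i. f (g i)) * W) * mat_adjoint U"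
    by simp
  then show ?thesis
    unfolding W_def using U(5-) V(5-) unitary_cancel[OF V(1)] unitary_cancel[OF U(1)] unitaryD(3)[OF U(1)]
    by (simp add: mult_assoc_dim right_mult_one_mat[of _ n n])
qed

lemma mat_fun_eq:
  assumes "diagonalizes n U e A"
  shows "mat_fun f A = U * real_diag n (\<lambda>i. f (e i)) * mat_adjoint U"
proof -
  have n: "dim_row A = n" using diagonalizesD(3)[OF assms] by simp
  show ?thesis unfolding mat_fun_def n
  proof (rule the_equality)
    show "\<exists>U' e'. unitary n U' \<and> A = U' * real_diag n e' * mat_adjoint U' \<and>
       U * real_diag n (\<lambda>i. f (e i)) * mat_adjoint U = U' * real_diag n (\<lambda>i. f (e' i)) * mat_adjoint U'"
      using assms unfolding diagonalizes_def by blast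
  qed (use diagonalizes_fun_unique[OF _ assms] in \<open>auto simp: diagonalizes_def\<close>)
qed

lemma diagonalizes_mat_fun:
  "diagonalizes n U e A \<Longrightarrow> diagonalizes n U (\<lambda>i. f (e i)) (mat_fun f A)"
  using mat_fun_eq[of n U e A f] by (simp add: diagonalizes_def)

section \<open>A variational formula\<close>

text \<open>The transition probabilities between two orthonormal bases. They form a doubly
  stochastic matrix, by the row and column sums below.\<close>

definition overlap :: "complex mat \<Rightarrow> complex mat \<Rightarrow> nat \<Rightarrow> nat \<Rightarrow> real" where
  "overlap U V i j = (cmod ((mat_adjoint U * V) $$ (i, j)))\<^sup>2"

lemma overlap_nonneg [simp]: "0 \<le> overlap U V i j"
  by (simp add: overlap_def)

lemma unitary_row_sum:
  assumes U: "unitary n U" and i: "i < n"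
  shows "(\<Sum>j<n. (cmod (U $$ (i, j)))\<^sup>2) = 1"
proof -
  note U' = unitaryD[OF U]
  have "1 = (U * mat_adjoint U) $$ (i, i)" using U' i by simp
  also have "\<dots> = (\<Sum>j<n. U $$ (i, j) * mat_adjoint U $$ (j, i))"
    using U' i by (intro mult_index[of _ n]) auto
  also have "\<dots> = of_real (\<Sum>j<n. (cmod (U $$ (i, j)))\<^sup>2)"
    unfolding of_real_sum using U' i by (intro sum.cong refl) (simp add: complex_norm_square del: of_real_power)
  finally show ?thesis by (metis of_real_eq_1_iff)
qed

lemma overlap_row_sum:
  assumes "unitary n U" "unitary n V" "i < n"
  shows "(\<Sum>j<n. overlap U V i j) = 1"
  unfolding overlap_def
  using assms by (intro unitary_row_sum unitary_mult unitary_adjoint)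

lemma overlap_commute:
  assumes "unitary n U" "unitary n V" "i < n" "j < n"
  shows "overlap U V i j = overlap V U j i"
proof -
  have "mat_adjoint V * U = mat_adjoint (mat_adjoint U * V)"
    using unitaryD[OF assms(1)] unitaryD[OF assms(2)] by (simp add: adjoint_mult)
  moreover have "mat_adjoint (mat_adjoint U * V) $$ (j, i) = cnj ((mat_adjoint U * V) $$ (i, j))"
    using assms unitaryD[OF assms(1)] unitaryD[OF assms(2)] by (intro adjoint_index) auto
  ultimately show ?thesis unfolding overlap_def by (simp del: index_mult_mat(1))
qed

lemma overlap_col_sum:
  assumes "unitary n U" "unitary n V" "j < n"
  shows "(\<Sum>i<n. overlap U V i j) = 1"
  using overlap_row_sum[OF assms(2,1,3)] overlap_commute[OF assms(1,2) _ assms(3)] by simp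

lemma overlap_self:
  assumes "unitary n U" "i < n" "j < n"
  shows "overlap U U i j = (if i = j then 1 else 0)"
  using assms unitaryD(2)[OF assms(1)] by (simp add: overlap_def)

lemma diag_in_basis:
  assumes A: "diagonalizes n U e A" and V: "unitary n V" and j: "j < n"
  shows "(mat_adjoint V * A * V) $$ (j, j) = of_real (\<Sum>i<n. e i * overlap U V i j)"
proof -
  note A' = diagonalizesD[OF A] and V' = unitaryD[OF V]
  have eq: "mat_adjoint V * A * V = (mat_adjoint V * U) * real_diag n e * mat_adjoint (mat_adjoint V * U)"
    unfolding A'(2) using A'(5-) V' by (simp add: adjoint_mult mult_assoc_dim)
  have "(mat_adjoint V * A * V) $$ (j, j) = (\<Sum>r<n. \<Sum>s<n. (mat_adjoint V * U) $$ (j, r) *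
      real_diag n e $$ (r, s) * cnj ((mat_adjoint V * U) $$ (j, s)))"
    unfolding eq using A'(5-) V' j by (intro sandwich_index) auto
  also have "\<dots> = (\<Sum>r<n. \<Sum>s<n. if s = r then of_real (e r * overlap V U j r) else 0)"
    by (intro sum.cong refl)
      (auto simp: real_diag_index overlap_def complex_norm_square mult_ac simp del: index_mult_mat(1) of_real_power)
  also have "\<dots> = of_real (\<Sum>i<n. e i * overlap U V i j)"
    using overlap_commute[OF V A'(1) j] by simp
  finally show ?thesis .
qed

lemma trace_mult_diagonal:
  assumes M: "M \<in> carrier_mat n n" and V: "V \<in> carrier_mat n n"
  shows "mat_trace (M * (V * real_diag n g * mat_adjoint V)) = (\<Sum>j<n. (mat_adjoint V * M * V) $$ (j, j) * of_real (g j))"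
proof -
  have "mat_trace (M * (V * real_diag n g * mat_adjoint V)) = mat_trace ((M * V * real_diag n g) * mat_adjoint V)"
    using M V by (simp add: mult_assoc_dim)
  also have "\<dots> = mat_trace (mat_adjoint V * (M * V * real_diag n g))"
    using M V by (intro trace_comm_dim) auto
  also have "\<dots> = mat_trace (mat_adjoint V * M * V * real_diag n g)"
    using M V by (simp add: mult_assoc_dim)
  also have "\<dots> = (\<Sum>j<n. (mat_adjoint V * M * V) $$ (j, j) * of_real (g j))"
    unfolding mat_trace_def using V mult_real_diag_index[OF mult_carrier_mat[OF mult_carrier_mat[OF adjoint_carrier[OF V] M] V], of _ _ g]
    by (auto simp del: index_mult_mat(1) intro!: sum.cong)
  finally show ?thesis .
qed

lemma trace_mult_mat_fun:
  assumes A: "diagonalizes n U e A" and B: "diagonalizes n V g B"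
  shows "mat_trace (A * mat_fun f B) = of_real (\<Sum>i<n. \<Sum>j<n. overlap U V i j * (e i * f (g j)))"
proof -
  note A' = diagonalizesD[OF A] and B' = diagonalizesD[OF B]
  have "mat_trace (A * mat_fun f B) = (\<Sum>j<n. (mat_adjoint V * A * V) $$ (j, j) * of_real (f (g j)))"
    unfolding mat_fun_eq[OF B] by (rule trace_mult_diagonal[OF A'(3) B'(5)])
  also have "\<dots> = (\<Sum>j<n. of_real (\<Sum>i<n. overlap U V i j * (e i * f (g j))))"
    using diag_in_basis[OF A B'(1)] by (intro sum.cong refl) (simp add: sum_distrib_left sum_distrib_right mult_ac del: index_mult_mat(1))
  also have "\<dots> = of_real (\<Sum>i<n. \<Sum>j<n. overlap U V i j * (e i * f (g j)))"
    unfolding of_real_sum by (rule sum.swap)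
  finally show ?thesis .
qed

lemma trace_mult_mat_fun_self:
  assumes A: "diagonalizes n U e A"
  shows "mat_trace (A * mat_fun f A) = of_real (\<Sum>i<n. e i * f (e i))"
proof -
  have "(\<Sum>i<n. \<Sum>j<n. overlap U U i j * (e i * f (e j))) = (\<Sum>i<n. \<Sum>j<n. if j = i then e i * f (e i) else 0)"
    using overlap_self[OF diagonalizesD(1)[OF A]] by (intro sum.cong refl) auto
  then show ?thesis unfolding trace_mult_mat_fun[OF A A] by simp
qed

lemma trace_diagonalizes:
  assumes A: "diagonalizes n U e A"
  shows "mat_trace A = of_real (\<Sum>i<n. e i)"
proof -
  note A' = diagonalizesD[OF A]
  have "mat_trace A = mat_trace (U * (real_diag n e * mat_adjoint U))"
    unfolding A'(2) using A'(5-) by (simp add: mult_assoc_dim)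
  also have "\<dots> = mat_trace (real_diag n e * mat_adjoint U * U)"
    using A'(5-) by (intro trace_comm_dim) auto
  also have "\<dots> = mat_trace (real_diag n e)"
    using A'(5-) unitaryD(2)[OF A'(1)] by (simp add: mult_assoc_dim right_mult_one_mat[of _ n n])
  also have "\<dots> = of_real (\<Sum>i<n. e i)" by (simp add: mat_trace_def real_diag_index)
  finally show ?thesis .
qed

lemma psd_eigenvalue_nonneg:
  assumes A: "diagonalizes n U e A" and p: "psd n A" and j: "j < n"
  shows "0 \<le> e j"
proof -
  note A' = diagonalizesD[OF A]
  have "psd n (mat_adjoint U * A * mat_adjoint (mat_adjoint U))"
    using A'(5) by (intro psd_sandwich[OF p]) auto
  then have "0 \<le> (mat_adjoint U * A * U) $$ (j, j)" using psd_diag j by fastforce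
  also have "(mat_adjoint U * A * U) $$ (j, j) = of_real (\<Sum>i<n. e i * overlap U U i j)"
    by (rule diag_in_basis[OF A A'(1) j])
  also have "(\<Sum>i<n. e i * overlap U U i j) = (\<Sum>i<n. if i = j then e j else 0)"
    using overlap_self[OF A'(1) _ j] by (intro sum.cong refl) auto
  finally show ?thesis using j by (simp add: less_eq_complex_def)
qed

lemma psd_diagonalizes:
  assumes "diagonalizes n U e A" "\<And>i. i < n \<Longrightarrow> 0 \<le> e i"
  shows "psd n A"
  using psd_sandwich[OF psd_real_diag[of n e] diagonalizesD(5)[OF assms(1)]] assms(2)
    diagonalizesD(2)[OF assms(1)] by simp

section \<open>Kernel containment and the variational functional in eigenbases\<close>

definition quad :: "nat \<Rightarrow> complex mat \<Rightarrow> (nat \<Rightarrow> complex) \<Rightarrow> complex" where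
  "quad n A f = (\<Sum>i<n. \<Sum>j<n. cnj (f i) * A $$ (i, j) * f j)"

text \<open>Zeros of the form instead of kernel vectors: in this shape the condition passes directly
  to sums and to partial traces.\<close>

definition dominated :: "nat \<Rightarrow> complex mat \<Rightarrow> complex mat \<Rightarrow> bool" where
  "dominated n A B \<longleftrightarrow> (\<forall>f. quad n B f = 0 \<longrightarrow> quad n A f = 0)"

lemma quad_column:
  assumes "A \<in> carrier_mat n n" "V \<in> carrier_mat n n" "j < n"
  shows "quad n A (\<lambda>i. V $$ (i, j)) = (mat_adjoint V * A * V) $$ (j, j)"
  using sandwich_index[of "mat_adjoint V" n n A "mat_adjoint V" n j j] assms
  by (simp add: quad_def del: index_mult_mat(1))

text \<open>A column of V with eigenvalue 0 is a zero of the form of B, hence of that of A. The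
  value of the latter is a sum of nonnegative terms \<open>e i * overlap U V i j\<close>, so each of
  them vanishes.\<close>

lemma dominated_overlap:
  assumes A: "diagonalizes n U e A" "psd n A" and B: "diagonalizes n V g B"
    and dom: "dominated n A B" and ij: "i < n" "j < n" and g: "g j = 0"
  shows "overlap U V i j * e i = 0"
proof -
  note A' = diagonalizesD[OF A(1)] and B' = diagonalizesD[OF B]
  have "(\<Sum>i<n. g i * overlap V V i j) = (\<Sum>i<n. if i = j then g j else 0)"
    using overlap_self[OF B'(1) _ ij(2)] by (intro sum.cong refl) auto
  then have "quad n B (\<lambda>i. V $$ (i, j)) = 0"
    unfolding quad_column[OF B'(3,5) ij(2)] diag_in_basis[OF B B'(1) ij(2)] using ij g by simp
  then have "quad n A (\<lambda>i. V $$ (i, j)) = 0" using dom by (simp add: dominated_def)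
  then have "(\<Sum>i<n. e i * overlap U V i j) = 0"
    unfolding quad_column[OF A'(3) B'(5) ij(2)] diag_in_basis[OF A(1) B'(1) ij(2)] of_real_eq_0_iff .
  moreover have "0 \<le> e i * overlap U V i j" if "i < n" for i
    using psd_eigenvalue_nonneg[OF A that] by simp
  ultimately have "\<forall>i\<in>{..<n}. e i * overlap U V i j = 0"
    by (subst (asm) sum_nonneg_eq_0_iff) auto
  then show ?thesis using ij by (auto simp: mult.commute)
qed

definition variational :: "real \<Rightarrow> complex mat \<Rightarrow> complex mat \<Rightarrow> complex mat \<Rightarrow> real" where
  "variational s A B X = 2 * Re (mat_trace (A * X)) - Re (mat_trace (X * B * mat_adjoint X))
     - s * Re (mat_trace (mat_adjoint X * A * X))"

text \<open>Both quadratic terms of \<open>variational\<close> take this shape once X is expanded in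
  the eigenbases; the isometry V drops out by cyclicity of the trace.\<close>

lemma trace_sandwich_diagonal:
  assumes M: "M \<in> carrier_mat k n" and U: "unitary n U" and V: "V \<in> carrier_mat m k" "mat_adjoint V * V = 1\<^sub>m k"
  shows "mat_trace ((V * M * mat_adjoint U) * (U * real_diag n e * mat_adjoint U) * mat_adjoint (V * M * mat_adjoint U))
     = of_real (\<Sum>i<k. \<Sum>j<n. e j * (cmod (M $$ (i, j)))\<^sup>2)"
proof -
  note U' = unitaryD[OF U]
  have "mat_trace ((V * M * mat_adjoint U) * (U * real_diag n e * mat_adjoint U) * mat_adjoint (V * M * mat_adjoint U))
    = mat_trace (V * (M * real_diag n e * mat_adjoint M * mat_adjoint V))"
    using M U' V unitary_cancel[OF U] by (simp add: adjoint_mult mult_assoc_dim)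
  also have "\<dots> = mat_trace ((M * real_diag n e * mat_adjoint M * mat_adjoint V) * V)"
    using M V by (intro trace_comm_dim) auto
  also have "(M * real_diag n e * mat_adjoint M * mat_adjoint V) * V = M * real_diag n e * mat_adjoint M * (mat_adjoint V * V)"
    using M V by (intro mult_assoc_dim) auto
  also have "\<dots> = M * real_diag n e * mat_adjoint M"
    unfolding V(2) using M by (intro right_mult_one_mat[of _ k k]) auto
  also have "mat_trace \<dots> = (\<Sum>i<k. (M * real_diag n e * mat_adjoint M) $$ (i, i))"
    using M by (simp add: mat_trace_def)
  also have "\<dots> = (\<Sum>i<k. \<Sum>r<n. \<Sum>s<n. M $$ (i, r) * real_diag n e $$ (r, s) * cnj (M $$ (i, s)))"
    using M by (intro sum.cong refl sandwich_index) auto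
  also have "\<dots> = (\<Sum>i<k. \<Sum>r<n. \<Sum>s<n. if s = r then of_real (e r * (cmod (M $$ (i, r)))\<^sup>2) else 0)"
    by (intro sum.cong refl) (auto simp: real_diag_index complex_norm_square mult_ac simp del: of_real_power)
  also have "\<dots> = of_real (\<Sum>i<k. \<Sum>j<n. e j * (cmod (M $$ (i, j)))\<^sup>2)" by simp
  finally show ?thesis .
qed

text \<open>Left multiplication by A and right multiplication by B are both diagonal in the
  coordinates M of X, so the functional decouples into one scalar quadratic polynomial per
  entry.\<close>

lemma variational_eq:
  assumes A: "diagonalizes n U e A" and B: "diagonalizes n V g B" and M: "M \<in> carrier_mat n n"
  shows "variational s A B (U * M * mat_adjoint V) =
    (\<Sum>i<n. \<Sum>j<n. 2 * e i * Re (M $$ (i, j) * cnj ((mat_adjoint U * V) $$ (i, j)))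
       - (g j + s * e i) * (cmod (M $$ (i, j)))\<^sup>2)"
proof -
  note A' = diagonalizesD[OF A] and B' = diagonalizesD[OF B]
  let ?X = "U * M * mat_adjoint V"
  let ?W = "mat_adjoint U * V"
  have W: "?W \<in> carrier_mat n n" using A' B' by auto
  have "mat_trace (A * ?X) = mat_trace (U * (real_diag n e * M * mat_adjoint V))"
    unfolding A'(2) using A'(5-) B'(5-) M unitary_cancel[OF A'(1)] by (simp add: mult_assoc_dim)
  also have "\<dots> = mat_trace (real_diag n e * M * mat_adjoint V * U)"
    using A'(5-) B'(5-) M by (intro trace_comm_dim) auto
  also have "real_diag n e * M * mat_adjoint V * U = real_diag n e * M * mat_adjoint ?W"
    using A'(5-) B'(5-) M by (simp add: adjoint_mult mult_assoc_dim)
  also have "mat_trace \<dots> = (\<Sum>i<n. \<Sum>j<n. (real_diag n e * M) $$ (i, j) * mat_adjoint ?W $$ (j, i))"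
    using M W by (intro trace_mult) auto
  also have "\<dots> = (\<Sum>i<n. \<Sum>j<n. of_real (e i) * (M $$ (i, j) * cnj (?W $$ (i, j))))"
    using M W by (intro sum.cong refl, subst adjoint_index) (auto simp: real_diag_mult_index[of _ n n] simp del: index_mult_mat(1))
  finally have 1: "Re (mat_trace (A * ?X)) = (\<Sum>i<n. \<Sum>j<n. e i * Re (M $$ (i, j) * cnj (?W $$ (i, j))))"
    by (simp del: index_mult_mat(1))
  have 2: "Re (mat_trace (?X * B * mat_adjoint ?X)) = (\<Sum>i<n. \<Sum>j<n. g j * (cmod (M $$ (i, j)))\<^sup>2)"
    unfolding B'(2) using trace_sandwich_diagonal[OF M B'(1) A'(5) unitaryD(2)[OF A'(1)], of g] by simp
  have Xa: "mat_adjoint ?X = V * mat_adjoint M * mat_adjoint U"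
    using A'(5-) B'(5-) M by (simp add: adjoint_mult mult_assoc_dim)
  have "Re (mat_trace (mat_adjoint ?X * A * mat_adjoint (mat_adjoint ?X))) =
    (\<Sum>j<n. \<Sum>i<n. e i * (cmod (mat_adjoint M $$ (j, i)))\<^sup>2)"
    unfolding Xa A'(2) using trace_sandwich_diagonal[OF adjoint_carrier[OF M] A'(1) B'(5) unitaryD(2)[OF B'(1)], of e] by simp
  also have "\<dots> = (\<Sum>j<n. \<Sum>i<n. e i * (cmod (M $$ (i, j)))\<^sup>2)"
    using M by (intro sum.cong refl) simp
  finally have 3: "Re (mat_trace (mat_adjoint ?X * A * ?X)) = (\<Sum>i<n. \<Sum>j<n. e i * (cmod (M $$ (i, j)))\<^sup>2)"
    by (subst sum.swap) simp
  show ?thesis unfolding variational_def 1 2 3 sum_distrib_left sum_subtractf[symmetric]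
    by (intro sum.cong refl) (simp add: algebra_simps)
qed

text \<open>This is the Hilbert-Schmidt form <A, K A> where K is the inverse of X -> s A X + X B.
  Written with the quotient e_i / (g_j + s e_i), its terms are those obtained by differentiating e_i
  ln (g_j + s e_i), and they are 0 for e_i = 0 even if the denominator vanishes.\<close>

definition resolvent_sum ::
  "nat \<Rightarrow> complex mat \<Rightarrow> (nat \<Rightarrow> real) \<Rightarrow> complex mat \<Rightarrow> (nat \<Rightarrow> real) \<Rightarrow> real \<Rightarrow> real" where
  "resolvent_sum n U e V g s = (\<Sum>i<n. \<Sum>j<n. overlap U V i j * (e i * (e i / (g j + s * e i))))"

lemma variational_le:
  assumes A: "diagonalizes n U e A" "psd n A" and B: "diagonalizes n V g B" "psd n B"
    and X: "X \<in> carrier_mat n n" and s: "s > 0"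
  shows "variational s A B X \<le> resolvent_sum n U e V g s"
proof -
  note A' = diagonalizesD[OF A(1)] and B' = diagonalizesD[OF B(1)]
  define M where "M = mat_adjoint U * X * V"
  have M: "M \<in> carrier_mat n n" using A' B' X unfolding M_def by auto
  have "U * M * mat_adjoint V = X"
    unfolding M_def using A'(5-) B'(5-) X unitary_cancel[OF A'(1)] unitaryD(3)[OF B'(1)]
    by (simp add: mult_assoc_dim right_mult_one_mat[of _ n n])
  then have "variational s A B X = (\<Sum>i<n. \<Sum>j<n. 2 * e i * Re (M $$ (i, j) * cnj ((mat_adjoint U * V) $$ (i, j)))
       - (g j + s * e i) * (cmod (M $$ (i, j)))\<^sup>2)"
    using variational_eq[OF A(1) B(1) M, of s] by simp
  also have "\<dots> \<le> resolvent_sum n U e V g s"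
    unfolding resolvent_sum_def
  proof (intro sum_mono)
    fix i j assume ij: "i \<in> {..<n}" "j \<in> {..<n}"
    let ?m = "M $$ (i, j)" and ?w = "(mat_adjoint U * V) $$ (i, j)"
    have e: "0 \<le> e i" and g: "0 \<le> g j"
      using ij psd_eigenvalue_nonneg[OF A] psd_eigenvalue_nonneg[OF B] by auto
    show "2 * e i * Re (?m * cnj ?w) - (g j + s * e i) * (cmod ?m)\<^sup>2
      \<le> overlap U V i j * (e i * (e i / (g j + s * e i)))"
    proof (cases "e i = 0")
      case True
      then show ?thesis using g by simp
    next
      case False
      define c where "c = g j + s * e i"
      have c: "c > 0" using False e g s unfolding c_def by (simp add: add_nonneg_pos)
      \<comment> \<open>Completing the square; equality holds at m = e_i w / c.\<close>
      have "0 \<le> (cmod (of_real c * ?m - of_real (e i) * ?w))\<^sup>2" by simp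
      also have "\<dots> = c * (c * (cmod ?m)\<^sup>2 - 2 * e i * Re (?m * cnj ?w)) + (e i)\<^sup>2 * (cmod ?w)\<^sup>2"
        unfolding cmod_power2 by (simp add: power2_eq_square algebra_simps del: index_mult_mat(1))
      finally have "c * (2 * e i * Re (?m * cnj ?w) - c * (cmod ?m)\<^sup>2) \<le> (e i)\<^sup>2 * (cmod ?w)\<^sup>2"
        by (simp add: algebra_simps del: index_mult_mat(1))
      then have "2 * e i * Re (?m * cnj ?w) - c * (cmod ?m)\<^sup>2 \<le> (e i)\<^sup>2 * (cmod ?w)\<^sup>2 / c"
        using c by (simp add: pos_le_divide_eq mult.commute del: index_mult_mat(1))
      also have "\<dots> = overlap U V i j * (e i * (e i / c))"
        by (simp add: overlap_def power2_eq_square del: index_mult_mat(1))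
      finally show ?thesis unfolding c_def .
    qed
  qed
  finally show ?thesis .
qed

lemma Re_of_real_mult_cnj: "Re (of_real a * z * cnj z) = a * (cmod z)\<^sup>2"
  unfolding cmod_power2 by (simp add: power2_eq_square algebra_simps)

lemma variational_attained:
  assumes A: "diagonalizes n U e A" "psd n A" and B: "diagonalizes n V g B" "psd n B"
    and s: "s > 0"
  shows "\<exists>X\<in>carrier_mat n n. variational s A B X = resolvent_sum n U e V g s"
proof -
  note A' = diagonalizesD[OF A(1)] and B' = diagonalizesD[OF B(1)]
  \<comment> \<open>The maximizer found by completing the square, entry by entry. It is 0 where
    \<open>e i = 0\<close>, whatever the denominator.\<close>
  define M where "M = mat n n (\<lambda>(i, j). of_real (e i / (g j + s * e i)) * (mat_adjoint U * V) $$ (i, j))"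
  have M: "M \<in> carrier_mat n n" by (simp add: M_def)
  have "variational s A B (U * M * mat_adjoint V) =
    (\<Sum>i<n. \<Sum>j<n. 2 * e i * Re (M $$ (i, j) * cnj ((mat_adjoint U * V) $$ (i, j)))
       - (g j + s * e i) * (cmod (M $$ (i, j)))\<^sup>2)"
    by (rule variational_eq[OF A(1) B(1) M])
  also have "\<dots> = resolvent_sum n U e V g s"
    unfolding resolvent_sum_def
  proof (intro sum.cong refl)
    fix i j assume ij: "i \<in> {..<n}" "j \<in> {..<n}"
    let ?w = "(mat_adjoint U * V) $$ (i, j)"
    define c where "c = g j + s * e i"
    have e: "0 \<le> e i" and g: "0 \<le> g j"
      using ij psd_eigenvalue_nonneg[OF A] psd_eigenvalue_nonneg[OF B] by auto
    have m: "M $$ (i, j) = of_real (e i / c) * ?w" using ij by (simp add: M_def c_def)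
    have c: "e i = 0 \<or> c > 0" using e g s unfolding c_def by (cases "e i = 0") (auto simp: add_nonneg_pos)
    have "Re (M $$ (i, j) * cnj ?w) = e i / c * overlap U V i j"
      unfolding m overlap_def by (rule Re_of_real_mult_cnj)
    moreover have "(cmod (M $$ (i, j)))\<^sup>2 = (e i / c)\<^sup>2 * overlap U V i j"
      unfolding m overlap_def norm_mult power_mult_distrib norm_of_real power2_abs ..
    ultimately have "2 * e i * Re (M $$ (i, j) * cnj ?w) - c * (cmod (M $$ (i, j)))\<^sup>2 =
       overlap U V i j * (2 * e i * (e i / c) - c * (e i / c)\<^sup>2)"
      by (simp add: algebra_simps)
    also have "2 * e i * (e i / c) - c * (e i / c)\<^sup>2 = e i * (e i / c)"
      using c by (auto simp: power2_eq_square field_simps)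
    finally show "2 * e i * Re (M $$ (i, j) * cnj ?w) - (g j + s * e i) * (cmod (M $$ (i, j)))\<^sup>2 =
       overlap U V i j * (e i * (e i / (g j + s * e i)))" unfolding c_def .
  qed
  finally show ?thesis using A' B' M by (intro bexI[of _ "U * M * mat_adjoint V"]) auto
qed

section \<open>Relative entropy\<close>

text \<open>The difference h - f is nondecreasing on the positive reals, so its limit at 0 is at
  most its limit at infinity. The divergent part u is common to both functions and cancels
  there.\<close>

lemma derivative_comparison:
  fixes f h f' h' :: "real \<Rightarrow> real"
  assumes df: "\<And>s. s > 0 \<Longrightarrow> (f has_real_derivative f' s) (at s)"
    and dh: "\<And>s. s > 0 \<Longrightarrow> (h has_real_derivative h' s) (at s)"
    and le: "\<And>s. s > 0 \<Longrightarrow> f' s \<le> h' s"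
    and f0: "(f \<longlongrightarrow> f0) (at_right 0)" and h0: "(h \<longlongrightarrow> h0) (at_right 0)"
    and f1: "((\<lambda>s. f s - u s) \<longlongrightarrow> f1) at_top" and h1: "((\<lambda>s. h s - u s) \<longlongrightarrow> h1) at_top"
  shows "f1 - f0 \<le> h1 - h0"
proof -
  define p where "p s = h s - f s" for s
  have mono: "p s \<le> p t" if "0 < s" "s \<le> t" for s t
  proof (rule DERIV_nonneg_imp_nondecreasing[OF that(2)])
    fix x assume "s \<le> x"
    then have "x > 0" using that by simp
    then have "(p has_real_derivative (h' x - f' x)) (at x)"
      unfolding p_def by (intro DERIV_diff df dh)
    then show "\<exists>y. (p has_real_derivative y) (at x) \<and> 0 \<le> y" using le \<open>x > 0\<close> by force
  qed
  have p0: "(p \<longlongrightarrow> h0 - f0) (at_right 0)"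
    unfolding p_def by (intro tendsto_diff f0 h0)
  have "((\<lambda>s. (h s - u s) - (f s - u s)) \<longlongrightarrow> h1 - f1) at_top" by (intro tendsto_diff f1 h1)
  then have p1: "(p \<longlongrightarrow> h1 - f1) at_top" by (simp add: p_def[abs_def])
  have "h0 - f0 \<le> p t" if "t > 0" for t
  proof (rule tendsto_upperbound[OF p0])
    show "\<forall>\<^sub>F s in at_right 0. p s \<le> p t"
      unfolding eventually_at_right_field using that mono by (intro exI[of _ t]) auto
  qed simp
  then have "\<forall>\<^sub>F t in at_top. h0 - f0 \<le> p t"
    by (intro eventually_mono[OF eventually_gt_at_top[of 0]])
  then have "h0 - f0 \<le> h1 - f1" by (intro tendsto_lowerbound[OF p1]) auto
  then show ?thesis by simp
qed

section \<open>The function interpolating between the two terms of the relative entropy\<close>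

definition log_sum ::
  "nat \<Rightarrow> complex mat \<Rightarrow> (nat \<Rightarrow> real) \<Rightarrow> complex mat \<Rightarrow> (nat \<Rightarrow> real) \<Rightarrow> real \<Rightarrow> real" where
  "log_sum n U e V g s = (\<Sum>i<n. \<Sum>j<n. overlap U V i j * (e i * ln (g j + s * e i)))"

lemma log_sum_derivative:
  assumes e: "\<And>i. i < n \<Longrightarrow> 0 \<le> e i" and g: "\<And>j. j < n \<Longrightarrow> 0 \<le> g j" and s: "s > 0"
  shows "(log_sum n U e V g has_real_derivative resolvent_sum n U e V g s) (at s)"
  unfolding log_sum_def[abs_def] resolvent_sum_def
proof (intro DERIV_sum)
  fix i j assume ij: "i \<in> {..<n}" "j \<in> {..<n}"
  show "((\<lambda>s. overlap U V i j * (e i * ln (g j + s * e i))) has_real_derivative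
      overlap U V i j * (e i * (e i / (g j + s * e i)))) (at s)"
  proof (cases "e i = 0")
    case False
    then have "e i > 0" "g j \<ge> 0" using e[of i] g[of j] ij by auto
    then have "g j + s * e i > 0" using s by (simp add: add_nonneg_pos)
    then show ?thesis by (auto intro!: derivative_eq_intros)
  qed simp
qed

text \<open>A term with \<open>g j = 0\<close> and \<open>e i > 0\<close> would diverge like ln s.
  The assumption makes its coefficient 0, which agrees with the value ln 0 = 0 in the limit.\<close>

lemma log_sum_at_0:
  assumes dom: "\<And>i j. i < n \<Longrightarrow> j < n \<Longrightarrow> g j = 0 \<Longrightarrow> overlap U V i j * e i = 0"
  shows "(log_sum n U e V g \<longlongrightarrow> (\<Sum>i<n. \<Sum>j<n. overlap U V i j * (e i * ln (g j)))) (at_right 0)"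
  unfolding log_sum_def[abs_def]
proof (intro tendsto_sum)
  fix i j assume ij: "i \<in> {..<n}" "j \<in> {..<n}"
  show "((\<lambda>s. overlap U V i j * (e i * ln (g j + s * e i))) \<longlongrightarrow> overlap U V i j * (e i * ln (g j))) (at_right 0)"
  proof (cases "g j = 0")
    case True
    then have "overlap U V i j = 0 \<or> e i = 0" using dom[of i j] ij by auto
    then show ?thesis by auto
  next
    case False
    have "((\<lambda>s. g j + s * e i) \<longlongrightarrow> g j + 0 * e i) (at_right 0)" by (intro tendsto_intros)
    then have "((\<lambda>s. ln (g j + s * e i)) \<longlongrightarrow> ln (g j)) (at_right 0)"
      using False by (intro tendsto_ln) auto
    then show ?thesis by (intro tendsto_mult tendsto_const)
  qed
qed

text \<open>For e_i > 0, ln (g_j + s e_i) = ln s + ln (g_j / s + e_i). The second summand tends to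
  ln e_i, which is independent of j, so the row sums of \<open>overlap\<close> collapse the double
  sum.\<close>

lemma log_sum_at_top:
  assumes U: "unitary n U" and V: "unitary n V"
    and e: "\<And>i. i < n \<Longrightarrow> 0 \<le> e i" and g: "\<And>j. j < n \<Longrightarrow> 0 \<le> g j"
  shows "((\<lambda>s. log_sum n U e V g s - (\<Sum>i<n. e i) * ln s) \<longlongrightarrow> (\<Sum>i<n. e i * ln (e i))) at_top"
proof -
  have marginal: "(\<Sum>i<n. \<Sum>j<n. overlap U V i j * (e i * c i)) = (\<Sum>i<n. e i * c i)" for c
    using overlap_row_sum[OF U V] by (simp add: sum_distrib_right[symmetric])
  have "((\<lambda>s. \<Sum>i<n. \<Sum>j<n. overlap U V i j * (e i * ln (g j * inverse s + e i))) \<longlongrightarrow>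
     (\<Sum>i<n. \<Sum>j<n. overlap U V i j * (e i * ln (e i)))) at_top"
  proof (intro tendsto_sum)
    fix i j assume ij: "i \<in> {..<n}" "j \<in> {..<n}"
    show "((\<lambda>s. overlap U V i j * (e i * ln (g j * inverse s + e i))) \<longlongrightarrow> overlap U V i j * (e i * ln (e i))) at_top"
    proof (cases "e i = 0")
      case False
      have "((\<lambda>s. g j * inverse s + e i) \<longlongrightarrow> g j * 0 + e i) at_top"
        by (intro tendsto_intros tendsto_inverse_0_at_top filterlim_ident)
      then have "((\<lambda>s. ln (g j * inverse s + e i)) \<longlongrightarrow> ln (e i)) at_top"
        using False by (intro tendsto_ln) auto
      then show ?thesis by (intro tendsto_mult tendsto_const)
    qed simp
  qed
  then have lim: "((\<lambda>s. \<Sum>i<n. \<Sum>j<n. overlap U V i j * (e i * ln (g j * inverse s + e i))) \<longlongrightarrow>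
     (\<Sum>i<n. e i * ln (e i))) at_top" unfolding marginal .
  have "\<forall>\<^sub>F s in at_top. (\<Sum>i<n. \<Sum>j<n. overlap U V i j * (e i * ln (g j * inverse s + e i))) =
     log_sum n U e V g s - (\<Sum>i<n. e i) * ln s"
    using eventually_gt_at_top[of 0]
  proof (rule eventually_mono)
    fix s :: real assume s: "s > 0"
    have "log_sum n U e V g s - (\<Sum>i<n. e i) * ln s =
      (\<Sum>i<n. \<Sum>j<n. overlap U V i j * (e i * ln (g j + s * e i))) - (\<Sum>i<n. \<Sum>j<n. overlap U V i j * (e i * ln s))"
      using marginal[of "\<lambda>_. ln s"] by (simp add: log_sum_def sum_distrib_right)
    also have "\<dots> = (\<Sum>i<n. \<Sum>j<n. overlap U V i j * (e i * ln (g j * inverse s + e i)))"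
      unfolding sum_subtractf[symmetric]
    proof (intro sum.cong refl)
      fix i j assume ij: "i \<in> {..<n}" "j \<in> {..<n}"
      show "overlap U V i j * (e i * ln (g j + s * e i)) - overlap U V i j * (e i * ln s) =
        overlap U V i j * (e i * ln (g j * inverse s + e i))"
      proof (cases "e i = 0")
        case False
        then have "e i > 0" "g j \<ge> 0" using e[of i] g[of j] ij by auto
        then have "g j * inverse s + e i > 0" using s by (simp add: add_nonneg_pos)
        then have "ln (s * (g j * inverse s + e i)) = ln s + ln (g j * inverse s + e i)"
          using s by (subst ln_mult) auto
        moreover have "s * (g j * inverse s + e i) = g j + s * e i" using s by (simp add: field_simps)
        ultimately have "ln (g j + s * e i) = ln s + ln (g j * inverse s + e i)" by simp
        then show ?thesis by (simp add: algebra_simps)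
      qed simp
    qed
    finally show "(\<Sum>i<n. \<Sum>j<n. overlap U V i j * (e i * ln (g j * inverse s + e i))) =
       log_sum n U e V g s - (\<Sum>i<n. e i) * ln s" ..
  qed
  then show ?thesis using lim by (rule Lim_transform_eventually[rotated])
qed

(* As ln 0 = 0, this is the relative entropy only if the kernel of B is contained in that of A,
   which is what dominated n A B expresses for positive semidefinite matrices. *)
definition relative_entropy :: "complex mat \<Rightarrow> complex mat \<Rightarrow> real" where
  "relative_entropy A B = Re (mat_trace (A * mat_fun ln A)) - Re (mat_trace (A * mat_fun ln B))"

text \<open>Hides the eigenbases: later arguments see only a function with the right limits whose
  derivative is the maximum of \<open>variational\<close>.\<close>

lemma relative_entropy_limits:
  assumes A: "psd n A" and B: "psd n B" and dom: "dominated n A B"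
  obtains h h' h0 h1 where
    "\<forall>s>0. (h has_real_derivative h' s) (at s)"
    "(h \<longlongrightarrow> h0) (at_right 0)" "((\<lambda>s. h s - Re (mat_trace A) * ln s) \<longlongrightarrow> h1) at_top"
    "relative_entropy A B = h1 - h0"
    "\<forall>s>0. \<forall>X\<in>carrier_mat n n. variational s A B X \<le> h' s"
    "\<forall>s>0. \<exists>X\<in>carrier_mat n n. variational s A B X = h' s"
proof -
  obtain U e where U: "diagonalizes n U e A" using hermitian_diagonalizable[OF psd_hermitian[OF A]] by auto
  obtain V g where V: "diagonalizes n V g B" using hermitian_diagonalizable[OF psd_hermitian[OF B]] by auto
  note e = psd_eigenvalue_nonneg[OF U A] and g = psd_eigenvalue_nonneg[OF V B]
  show thesis
  proof (rule that)
    show "\<forall>s>0. (log_sum n U e V g has_real_derivative resolvent_sum n U e V g s) (at s)"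
      using log_sum_derivative[of n e g _ U V] e g by blast
    show "(log_sum n U e V g \<longlongrightarrow> (\<Sum>i<n. \<Sum>j<n. overlap U V i j * (e i * ln (g j)))) (at_right 0)"
      by (rule log_sum_at_0) (rule dominated_overlap[OF U A V dom])
    show "((\<lambda>s. log_sum n U e V g s - Re (mat_trace A) * ln s) \<longlongrightarrow> (\<Sum>i<n. e i * ln (e i))) at_top"
      using log_sum_at_top[OF diagonalizesD(1)[OF U] diagonalizesD(1)[OF V], of e g] e g by (simp add: trace_diagonalizes[OF U])
    show "relative_entropy A B = (\<Sum>i<n. e i * ln (e i)) - (\<Sum>i<n. \<Sum>j<n. overlap U V i j * (e i * ln (g j)))"
      unfolding relative_entropy_def trace_mult_mat_fun_self[OF U] trace_mult_mat_fun[OF U V] by simp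
    show "\<forall>s>0. \<forall>X\<in>carrier_mat n n. variational s A B X \<le> resolvent_sum n U e V g s"
      using variational_le[OF U A V B] by blast
    show "\<forall>s>0. \<exists>X\<in>carrier_mat n n. variational s A B X = resolvent_sum n U e V g s"
      using variational_attained[OF U A V B] by blast
  qed
qed

text \<open>The comparison principle behind all later inequalities: it suffices to answer each trial
  matrix Y by trial matrices for the other two pairs. Equality of the traces makes the terms in ln s
  cancel at infinity. The three sizes are independent, since a channel changes the size.\<close>

theorem relative_entropy_le_add:
  assumes A: "psd n A" "psd n B" "dominated n A B"
    and A1: "psd k A1" "psd k B1" "dominated k A1 B1"
    and A2: "psd l A2" "psd l B2" "dominated l A2 B2"
    and tr: "mat_trace A = mat_trace A1 + mat_trace A2"
    and var: "\<And>s Y. s > 0 \<Longrightarrow> Y \<in> carrier_mat n n \<Longrightarrow>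
      \<exists>X1\<in>carrier_mat k k. \<exists>X2\<in>carrier_mat l l. variational s A B Y \<le> variational s A1 B1 X1 + variational s A2 B2 X2"
  shows "relative_entropy A B \<le> relative_entropy A1 B1 + relative_entropy A2 B2"
proof -
  obtain h h' h0 h1 where h:
    "\<forall>s>0. (h has_real_derivative h' s) (at s)"
    "(h \<longlongrightarrow> h0) (at_right 0)" "((\<lambda>s. h s - Re (mat_trace A) * ln s) \<longlongrightarrow> h1) at_top"
    "relative_entropy A B = h1 - h0"
    "\<forall>s>0. \<forall>X\<in>carrier_mat n n. variational s A B X \<le> h' s"
    "\<forall>s>0. \<exists>X\<in>carrier_mat n n. variational s A B X = h' s"
    by (rule relative_entropy_limits[OF A]) (rule that)
  note h = h[rule_format]
  obtain p p' p0 p1 where p: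
    "\<forall>s>0. (p has_real_derivative p' s) (at s)"
    "(p \<longlongrightarrow> p0) (at_right 0)" "((\<lambda>s. p s - Re (mat_trace A1) * ln s) \<longlongrightarrow> p1) at_top"
    "relative_entropy A1 B1 = p1 - p0"
    "\<forall>s>0. \<forall>X\<in>carrier_mat k k. variational s A1 B1 X \<le> p' s"
    "\<forall>s>0. \<exists>X\<in>carrier_mat k k. variational s A1 B1 X = p' s"
    by (rule relative_entropy_limits[OF A1]) (rule that)
  note p = p[rule_format]
  obtain q q' q0 q1 where q:
    "\<forall>s>0. (q has_real_derivative q' s) (at s)"
    "(q \<longlongrightarrow> q0) (at_right 0)" "((\<lambda>s. q s - Re (mat_trace A2) * ln s) \<longlongrightarrow> q1) at_top"
    "relative_entropy A2 B2 = q1 - q0"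
    "\<forall>s>0. \<forall>X\<in>carrier_mat l l. variational s A2 B2 X \<le> q' s"
    "\<forall>s>0. \<exists>X\<in>carrier_mat l l. variational s A2 B2 X = q' s"
    by (rule relative_entropy_limits[OF A2]) (rule that)
  note q = q[rule_format]
  have "h1 - h0 \<le> (p1 + q1) - (p0 + q0)"
  proof (rule derivative_comparison)
    show "(h has_real_derivative h' s) (at s)" if "s > 0" for s by (rule h(1)[OF that])
    show "((\<lambda>s. p s + q s) has_real_derivative p' s + q' s) (at s)" if "s > 0" for s
      by (intro DERIV_add p(1) q(1) that)
    show "h' s \<le> p' s + q' s" if s: "s > 0" for s
    proof -
      obtain Y where Y: "Y \<in> carrier_mat n n" "variational s A B Y = h' s" using h(6)[OF s] by auto
      obtain X1 X2 where X: "X1 \<in> carrier_mat k k" "X2 \<in> carrier_mat l l"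
        "variational s A B Y \<le> variational s A1 B1 X1 + variational s A2 B2 X2"
        using var[OF s Y(1)] by auto
      show ?thesis using X(3) p(5)[OF s X(1)] q(5)[OF s X(2)] Y(2) by simp
    qed
    show "(h \<longlongrightarrow> h0) (at_right 0)" by (rule h(2))
    show "((\<lambda>s. p s + q s) \<longlongrightarrow> p0 + q0) (at_right 0)" by (intro tendsto_add p(2) q(2))
    show "((\<lambda>s. h s - Re (mat_trace A) * ln s) \<longlongrightarrow> h1) at_top" by (rule h(3))
    have "((\<lambda>s. (p s - Re (mat_trace A1) * ln s) + (q s - Re (mat_trace A2) * ln s)) \<longlongrightarrow> p1 + q1) at_top"
      by (intro tendsto_add p(3) q(3))
    then show "((\<lambda>s. p s + q s - Re (mat_trace A) * ln s) \<longlongrightarrow> p1 + q1) at_top"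
      unfolding tr by (simp add: algebra_simps)
  qed
  then show ?thesis using h(4) p(4) q(4) by simp
qed

corollary relative_entropy_le:
  assumes A: "psd n A" "psd n B" "dominated n A B"
    and A1: "psd k A1" "psd k B1" "dominated k A1 B1"
    and tr: "mat_trace A = mat_trace A1"
    and var: "\<And>s Y. s > 0 \<Longrightarrow> Y \<in> carrier_mat n n \<Longrightarrow>
      \<exists>X\<in>carrier_mat k k. variational s A B Y \<le> variational s A1 B1 X"
  shows "relative_entropy A B \<le> relative_entropy A1 B1"
proof -
  \<comment> \<open>A pair of matrices of size 0 is a neutral second summand.\<close>
  let ?Z = "0\<^sub>m 0 0 :: complex mat"
  have "relative_entropy A B \<le> relative_entropy A1 B1 + relative_entropy ?Z ?Z"
  proof (rule relative_entropy_le_add[OF A A1])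
    show "psd 0 ?Z" by (auto simp: psd_iff hermitian_def intro!: eq_matI)
    then show "psd 0 ?Z" .
    show "dominated 0 ?Z ?Z" by (simp add: dominated_def)
    show "mat_trace A = mat_trace A1 + mat_trace ?Z" using tr by (simp add: mat_trace_def)
    fix s :: real and Y :: "complex mat" assume "s > 0" "Y \<in> carrier_mat n n"
    then obtain X where X: "X \<in> carrier_mat k k" "variational s A B Y \<le> variational s A1 B1 X" using var by blast
    have "variational s ?Z ?Z ?Z = 0" by (simp add: variational_def mat_trace_def)
    then show "\<exists>X1\<in>carrier_mat k k. \<exists>X2\<in>carrier_mat 0 0.
        variational s A B Y \<le> variational s A1 B1 X1 + variational s ?Z ?Z X2"
      using X by (intro bexI[of _ X] bexI[of _ ?Z]) auto
  qed
  also have "relative_entropy ?Z ?Z = 0" by (simp add: relative_entropy_def mat_trace_def)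
  finally show ?thesis by simp
qed

section \<open>Subadditivity and monotonicity of the relative entropy\<close>

lemma quad_nonneg: "psd n A \<Longrightarrow> 0 \<le> quad n A f"
  unfolding quad_def by (rule psd_form_nonneg)

lemma quad_add:
  "A \<in> carrier_mat n n \<Longrightarrow> B \<in> carrier_mat n n \<Longrightarrow> quad n (A + B) f = quad n A f + quad n B f"
  unfolding quad_def sum.distrib[symmetric] by (intro sum.cong refl) (auto simp: algebra_simps)

lemma dominated_add:
  assumes psd: "psd n A1" "psd n B1" "psd n A2" "psd n B2" and dom: "dominated n A1 B1" "dominated n A2 B2"
  shows "dominated n (A1 + A2) (B1 + B2)"
  unfolding dominated_def
proof (intro allI impI)
  fix f assume "quad n (B1 + B2) f = 0"
  then have "quad n B1 f = 0 \<and> quad n B2 f = 0"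
    using quad_nonneg[OF psd(2), of f] quad_nonneg[OF psd(4), of f]
    by (simp add: quad_add psd[THEN psd_carrier] add_nonneg_eq_0_iff)
  then show "quad n (A1 + A2) f = 0"
    using dom by (simp add: quad_add psd[THEN psd_carrier] dominated_def)
qed

lemma dominated_refl: "dominated n A A"
  by (simp add: dominated_def)

lemma dominated_add_right:
  assumes "psd n A" "psd n P"
  shows "dominated n A (A + P)"
  unfolding dominated_def
proof (intro allI impI)
  fix f assume "quad n (A + P) f = 0"
  then show "quad n A f = 0"
    using quad_nonneg[OF assms(1), of f] quad_nonneg[OF assms(2), of f]
    by (simp add: quad_add assms[THEN psd_carrier] add_nonneg_eq_0_iff)
qed

lemma trace_sandwich_add:
  assumes "X \<in> carrier_mat n n" "A \<in> carrier_mat n n" "B \<in> carrier_mat n n" "Y \<in> carrier_mat n n"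
  shows "mat_trace (X * (A + B) * Y) = mat_trace (X * A * Y) + mat_trace (X * B * Y)"
  unfolding mult_add_distrib_mat[OF assms(1-3)]
    add_mult_distrib_mat[OF mult_carrier_mat[OF assms(1,2)] mult_carrier_mat[OF assms(1,3)] assms(4)]
  using assms by (intro trace_add[of _ n]) auto

lemma variational_add:
  assumes "A1 \<in> carrier_mat n n" "A2 \<in> carrier_mat n n" "B1 \<in> carrier_mat n n" "B2 \<in> carrier_mat n n"
    and X: "X \<in> carrier_mat n n"
  shows "variational s (A1 + A2) (B1 + B2) X = variational s A1 B1 X + variational s A2 B2 X"
proof -
  note c = assms(1-4)
  have "mat_trace ((A1 + A2) * X) = mat_trace (A1 * X) + mat_trace (A2 * X)"
    using c X by (simp add: add_mult_distrib_mat[of _ n n] trace_add[of _ n])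
  moreover have "mat_trace (X * (B1 + B2) * mat_adjoint X) = mat_trace (X * B1 * mat_adjoint X) + mat_trace (X * B2 * mat_adjoint X)"
    using c X by (intro trace_sandwich_add[of _ n]) auto
  moreover have "mat_trace (mat_adjoint X * (A1 + A2) * X) = mat_trace (mat_adjoint X * A1 * X) + mat_trace (mat_adjoint X * A2 * X)"
    using c X by (intro trace_sandwich_add[of _ n]) auto
  ultimately show ?thesis by (simp add: variational_def algebra_simps)
qed

text \<open>By linearity in the pair, the trial matrix Y itself serves for both summands.\<close>

theorem relative_entropy_subadditive:
  assumes "psd n A1" "psd n B1" "dominated n A1 B1" "psd n A2" "psd n B2" "dominated n A2 B2"
  shows "relative_entropy (A1 + A2) (B1 + B2) \<le> relative_entropy A1 B1 + relative_entropy A2 B2"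
proof (rule relative_entropy_le_add)
  show "psd n (A1 + A2)" "psd n (B1 + B2)" using assms by (auto intro: psd_add)
  show "dominated n (A1 + A2) (B1 + B2)" using assms by (intro dominated_add)
  show "mat_trace (A1 + A2) = mat_trace A1 + mat_trace A2"
    using assms by (intro trace_add psd_carrier)
  fix s :: real and Y :: "complex mat" assume "Y \<in> carrier_mat n n"
  then show "\<exists>X1\<in>carrier_mat n n. \<exists>X2\<in>carrier_mat n n.
      variational s (A1 + A2) (B1 + B2) Y \<le> variational s A1 B1 X1 + variational s A2 B2 X2"
    using variational_add[of A1 n A2 B1 B2 Y s] assms(1,2,4,5)[THEN psd_carrier] by (auto intro!: bexI[of _ Y])
qed (use assms in auto)

lemma relative_entropy_self [simp]: "relative_entropy A A = 0"
  by (simp add: relative_entropy_def)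

text \<open>Enlarging the second argument by P only adds the trace of Y P Y', which enters with a
  negative sign. In other words tr A ln A <= tr A ln (A + P), which is the source of the
  subadditivity of entropy.\<close>

lemma relative_entropy_add_right:
  assumes A: "psd n A" and P: "psd n P"
  shows "relative_entropy A (A + P) \<le> 0"
proof -
  note c = psd_carrier[OF A] psd_carrier[OF P]
  have "relative_entropy A (A + P) \<le> relative_entropy A A"
  proof (rule relative_entropy_le[OF A psd_add[OF A P] dominated_add_right[OF A P] A A dominated_refl refl])
    fix s :: real and Y :: "complex mat" assume Y: "Y \<in> carrier_mat n n"
    have "mat_trace (Y * (A + P) * mat_adjoint Y) = mat_trace (Y * A * mat_adjoint Y) + mat_trace (Y * P * mat_adjoint Y)"
      using c Y by (intro trace_sandwich_add[of _ n]) auto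
    moreover have "0 \<le> Re (mat_trace (Y * P * mat_adjoint Y))"
      using psd_trace[OF psd_sandwich[OF P Y]] by (simp add: less_eq_complex_def)
    ultimately have "variational s A (A + P) Y \<le> variational s A A Y"
      by (simp add: variational_def)
    then show "\<exists>X\<in>carrier_mat n n. variational s A (A + P) Y \<le> variational s A A X" using Y by blast
  qed
  then show ?thesis by simp
qed

section \<open>Index splitting, superoperators and block matrices\<close>

lemma sum_product_index:
  fixes f :: "nat \<Rightarrow> 'a::comm_monoid_add"
  shows "(\<Sum>r<k * m. f r) = (\<Sum>a<k. \<Sum>i<m. f (a * m + i))"
proof -
  have "(\<Sum>i<m. f (a * m + i)) = sum f {a * m..<a * m + m}" for a
    using sum.shift_bounds_nat_ivl[of f 0 "a * m" m] by (simp add: atLeast0LessThan add.commute)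
  then show ?thesis using sum.nat_group[of f m k] by simp
qed

lemma product_index_less: "a < k \<Longrightarrow> i < m \<Longrightarrow> a * m + i < k * m" for a i k m :: nat
  using mult_le_mono1[of "Suc a" k m] by simp

lemma product_index_cases:
  fixes r k m :: nat
  assumes "r < k * m"
  obtains a i where "r = a * m + i" "a < k" "i < m"
proof (rule that)
  have "m > 0" using assms by (cases m) auto
  then show "r mod m < m" by simp
  show "r div m < k" using assms by (simp add: less_mult_imp_div_less)
qed simp

definition matrix_unit :: "nat \<Rightarrow> nat \<Rightarrow> nat \<Rightarrow> complex mat" where
  "matrix_unit m i j = mat m m (\<lambda>(a, b). if a = i \<and> b = j then 1 else 0)"

lemma linear_functional_expand:
  fixes f :: "complex mat \<Rightarrow> complex"
  assumes add: "\<And>A B. A \<in> carrier_mat m m \<Longrightarrow> B \<in> carrier_mat m m \<Longrightarrow> f (A + B) = f A + f B"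
    and smult: "\<And>c A. A \<in> carrier_mat m m \<Longrightarrow> f (c \<cdot>\<^sub>m A) = c * f A"
    and A: "A \<in> carrier_mat m m"
  shows "f A = (\<Sum>i<m. \<Sum>j<m. A $$ (i, j) * f (matrix_unit m i j))"
proof -
  \<comment> \<open>A with all entries outside S replaced by 0; the induction adds one entry at a
    time.\<close>
  define R where "R S = mat m m (\<lambda>x. if x \<in> S then A $$ x else 0)" for S
  have Rc: "R S \<in> carrier_mat m m" for S by (simp add: R_def)
  have "f (R S) = (\<Sum>x\<in>S. A $$ x * f (matrix_unit m (fst x) (snd x)))"
    if "finite S" for S using that
  proof (induction S rule: finite_induct)
    case empty
    have "f (0 \<cdot>\<^sub>m R {}) = 0 * f (R {})" by (rule smult[OF Rc])
    moreover have "0 \<cdot>\<^sub>m R {} = R {}" by (intro eq_matI) (auto simp: R_def)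
    ultimately show ?case by simp
  next
    case (insert x S)
    let ?E = "matrix_unit m (fst x) (snd x)"
    have E: "?E \<in> carrier_mat m m" by (simp add: matrix_unit_def)
    have "R (insert x S) = R S + A $$ x \<cdot>\<^sub>m ?E"
      using insert(2) by (intro eq_matI) (auto simp: R_def matrix_unit_def)
    then have "f (R (insert x S)) = f (R S) + A $$ x * f ?E"
      using add[OF Rc, of "A $$ x \<cdot>\<^sub>m ?E" S] smult[OF E] E by simp
    then show ?case using insert by simp
  qed
  from this[of "{..<m} \<times> {..<m}"] have "f (R ({..<m} \<times> {..<m})) = (\<Sum>i<m. \<Sum>j<m. A $$ (i, j) * f (matrix_unit m i j))"
    by (simp add: sum.cartesian_product case_prod_beta)
  moreover have "R ({..<m} \<times> {..<m}) = A" using A by (intro eq_matI) (auto simp: R_def)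
  ultimately show ?thesis by simp
qed

lemma superopD:
  assumes "superop m p \<Phi>"
  shows "A \<in> carrier_mat m m \<Longrightarrow> \<Phi> A \<in> carrier_mat p p"
    "A \<in> carrier_mat m m \<Longrightarrow> B \<in> carrier_mat m m \<Longrightarrow> \<Phi> (A + B) = \<Phi> A + \<Phi> B"
    "A \<in> carrier_mat m m \<Longrightarrow> \<Phi> (c \<cdot>\<^sub>m A) = c \<cdot>\<^sub>m \<Phi> A"
  using assms by (auto simp: superop_def)

lemma cptpD:
  assumes "cptp m p \<Phi>"
  shows "superop m p \<Phi>" "psd (k * m) A \<Longrightarrow> psd (k * p) (id_tensor k m p \<Phi> A)"
    "A \<in> carrier_mat m m \<Longrightarrow> mat_trace (\<Phi> A) = mat_trace A"
  using assms by (auto simp: cptp_def completely_positive_def trace_preserving_def)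

lemma superop_zero:
  assumes "superop m p \<Phi>"
  shows "\<Phi> (0\<^sub>m m m) = 0\<^sub>m p p"
proof -
  have "\<Phi> (0 \<cdot>\<^sub>m 0\<^sub>m m m) = 0 \<cdot>\<^sub>m \<Phi> (0\<^sub>m m m)" by (rule superopD(3)[OF assms]) simp
  also have "\<dots> = 0\<^sub>m p p" using superopD(1)[OF assms, of "0\<^sub>m m m"] by (intro eq_matI) auto
  finally show ?thesis by simp
qed

lemma mat_block_carrier [simp, intro]: "mat_block m A a b \<in> carrier_mat m m"
  by (simp add: mat_block_def)

lemma id_tensor_carrier [simp, intro]: "id_tensor k m p \<Phi> A \<in> carrier_mat (k * p) (k * p)"
  by (simp add: id_tensor_def)

lemma id_tensor_one:
  assumes "superop m p \<Phi>" "A \<in> carrier_mat m m"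
  shows "id_tensor 1 m p \<Phi> A = \<Phi> A"
proof -
  have "mat_block m A 0 0 = A" using assms(2) by (intro eq_matI) (auto simp: mat_block_def)
  then show ?thesis using superopD(1)[OF assms] by (intro eq_matI) (auto simp: id_tensor_def)
qed

lemma id_tensor_index:
  assumes "a < k" "b < k" "i < p" "j < p"
  shows "id_tensor k m p \<Phi> A $$ (a * p + i, b * p + j) = \<Phi> (mat_block m A a b) $$ (i, j)"
  using assms product_index_less[of a k i p] product_index_less[of b k j p] by (simp add: id_tensor_def)

lemma mat_block_id_tensor:
  assumes "superop m p \<Phi>" "a < k" "b < k"
  shows "mat_block p (id_tensor k m p \<Phi> A) a b = \<Phi> (mat_block m A a b)"
  using superopD(1)[OF assms(1) mat_block_carrier, of A a b] assms(2,3)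
  by (intro eq_matI) (auto simp: mat_block_def[of p] id_tensor_index)

lemma psd_channel:
  assumes "cptp m p \<Phi>" "psd m A"
  shows "psd p (\<Phi> A)"
  using cptpD(2)[OF assms(1), of 1 A] assms(2) id_tensor_one[OF cptpD(1)[OF assms(1)] psd_carrier[OF assms(2)]]
  by simp

text \<open>L is the block column with entries F 0, ..., F (k - 1).\<close>

lemma mat_block_sandwich:
  assumes F: "\<And>a. a < k \<Longrightarrow> F a \<in> carrier_mat m l" and S: "S \<in> carrier_mat l l" and ab: "a < k" "b < k"
    and L: "L = mat (k * m) l (\<lambda>(r, j). F (r div m) $$ (r mod m, j))"
  shows "mat_block m (L * S * mat_adjoint L) a b = F a * S * mat_adjoint (F b)"
proof (rule eq_matI)
  fix i j assume "i < dim_row (F a * S * mat_adjoint (F b))" "j < dim_col (F a * S * mat_adjoint (F b))"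
  then have ij: "i < m" "j < m" using F[OF ab(1)] F[OF ab(2)] by auto
  have Lc: "L \<in> carrier_mat (k * m) l" by (simp add: L)
  have "mat_block m (L * S * mat_adjoint L) a b $$ (i, j) = (L * S * mat_adjoint L) $$ (a * m + i, b * m + j)"
    using ij by (simp add: mat_block_def del: index_mult_mat(1))
  also have "\<dots> = (\<Sum>r<l. \<Sum>s<l. L $$ (a * m + i, r) * S $$ (r, s) * cnj (L $$ (b * m + j, s)))"
    using ij ab by (intro sandwich_index[OF Lc S Lc] product_index_less)
  also have "\<dots> = (\<Sum>r<l. \<Sum>s<l. F a $$ (i, r) * S $$ (r, s) * cnj (F b $$ (j, s)))"
    using ij ab by (intro sum.cong refl) (simp add: L product_index_less)
  also have "\<dots> = (F a * S * mat_adjoint (F b)) $$ (i, j)"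
    using ij ab F S by (intro sandwich_index[symmetric]) auto
  finally show "mat_block m (L * S * mat_adjoint L) a b $$ (i, j) = (F a * S * mat_adjoint (F b)) $$ (i, j)" .
qed (use F ab in \<open>auto simp: mat_block_def\<close>)

text \<open>R is the block row with entries F 0, ..., F (k - 1).\<close>

lemma trace_block_sandwich:
  assumes F: "\<And>a. a < k \<Longrightarrow> F a \<in> carrier_mat l m" and T: "T \<in> carrier_mat (k * m) (k * m)"
    and R: "R = mat l (k * m) (\<lambda>(i, s). F (s div m) $$ (i, s mod m))"
  shows "mat_trace (R * T * mat_adjoint R) = (\<Sum>a<k. \<Sum>b<k. mat_trace (F a * mat_block m T a b * mat_adjoint (F b)))"
proof -
  have Rc: "R \<in> carrier_mat l (k * m)" by (simp add: R)
  have "mat_trace (R * T * mat_adjoint R) = (\<Sum>x<l. (R * T * mat_adjoint R) $$ (x, x))"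
    by (simp add: mat_trace_def R)
  also have "\<dots> = (\<Sum>x<l. \<Sum>r<k * m. \<Sum>s<k * m. R $$ (x, r) * T $$ (r, s) * cnj (R $$ (x, s)))"
    by (intro sum.cong refl sandwich_index[OF Rc T Rc]) auto
  also have "\<dots> = (\<Sum>x<l. \<Sum>a<k. \<Sum>i<m. \<Sum>b<k. \<Sum>j<m.
      F a $$ (x, i) * mat_block m T a b $$ (i, j) * cnj (F b $$ (x, j)))"
    unfolding sum_product_index
    by (intro sum.cong refl) (simp add: R mat_block_def product_index_less)
  also have "\<dots> = (\<Sum>a<k. \<Sum>b<k. \<Sum>x<l. \<Sum>i<m. \<Sum>j<m.
      F a $$ (x, i) * mat_block m T a b $$ (i, j) * cnj (F b $$ (x, j)))"
  proof -
    have "(\<Sum>x<l. \<Sum>a<k. \<Sum>i<m. \<Sum>b<k. \<Sum>j<m. g x a i b j) =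
      (\<Sum>a<k. \<Sum>b<k. \<Sum>x<l. \<Sum>i<m. \<Sum>j<m. g x a i b j)" for g :: "nat \<Rightarrow> nat \<Rightarrow> nat \<Rightarrow> nat \<Rightarrow> nat \<Rightarrow> complex"
    proof -
      have "(\<Sum>x<l. \<Sum>a<k. \<Sum>i<m. \<Sum>b<k. \<Sum>j<m. g x a i b j) = (\<Sum>x<l. \<Sum>a<k. \<Sum>b<k. \<Sum>i<m. \<Sum>j<m. g x a i b j)"
        by (intro sum.cong refl sum.swap)
      also have "\<dots> = (\<Sum>a<k. \<Sum>x<l. \<Sum>b<k. \<Sum>i<m. \<Sum>j<m. g x a i b j)" by (rule sum.swap)
      also have "\<dots> = (\<Sum>a<k. \<Sum>b<k. \<Sum>x<l. \<Sum>i<m. \<Sum>j<m. g x a i b j)"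
        by (intro sum.cong refl sum.swap)
      finally show ?thesis .
    qed
    then show ?thesis .
  qed
  also have "\<dots> = (\<Sum>a<k. \<Sum>b<k. mat_trace (F a * mat_block m T a b * mat_adjoint (F b)))"
  proof (intro sum.cong refl)
    fix a b assume ab: "a \<in> {..<k}" "b \<in> {..<k}"
    have "mat_trace (F a * mat_block m T a b * mat_adjoint (F b)) =
      (\<Sum>x<l. (F a * mat_block m T a b * mat_adjoint (F b)) $$ (x, x))"
      using F[of a] ab by (simp add: mat_trace_def)
    also have "\<dots> = (\<Sum>x<l. \<Sum>i<m. \<Sum>j<m. F a $$ (x, i) * mat_block m T a b $$ (i, j) * cnj (F b $$ (x, j)))"
      using F ab by (intro sum.cong refl sandwich_index) auto
    finally show "(\<Sum>x<l. \<Sum>i<m. \<Sum>j<m. F a $$ (x, i) * mat_block m T a b $$ (i, j) * cnj (F b $$ (x, j))) =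
      mat_trace (F a * mat_block m T a b * mat_adjoint (F b))" ..
  qed
  finally show ?thesis .
qed

section \<open>Channels and data processing\<close>

(* The Schwarz inequality from 2-positivity: with C' and Y' the adjoints of C and Y, the channel
   maps the blocks C S C', C S, S C', S of a positive matrix to the blocks of a positive matrix T,
   and the second claim is tr (R T R') >= 0 for the row R = (1, -Y). *)
lemma channel_block_psd:
  assumes \<Phi>: "cptp m p \<Phi>" and S: "psd m S" and C: "C \<in> carrier_mat m m" and Y: "Y \<in> carrier_mat p p"
  shows "\<Phi> (S * mat_adjoint C) = mat_adjoint (\<Phi> (C * S))"
    and "Re (mat_trace (Y * \<Phi> S * mat_adjoint Y)) \<ge>
      2 * Re (mat_trace (\<Phi> (C * S) * mat_adjoint Y)) - Re (mat_trace (C * S * mat_adjoint C))"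
proof -
  note sup = cptpD(1)[OF \<Phi>]
  note Sc = psd_carrier[OF S]
  define F where "F a = (if a = 0 then C else 1\<^sub>m m)" for a :: nat
  define L where "L = mat (2 * m) m (\<lambda>(r, j). F (r div m) $$ (r mod m, j))"
  define T where "T = id_tensor 2 m p \<Phi> (L * S * mat_adjoint L)"
  have T: "psd (2 * p) T"
    unfolding T_def by (intro cptpD(2)[OF \<Phi>] psd_sandwich[OF S]) (simp add: L_def)
  have F: "F a \<in> carrier_mat m m" for a using C by (simp add: F_def)
  have block: "mat_block p T a b = \<Phi> (F a * S * mat_adjoint (F b))" if "a < 2" "b < 2" for a b
    unfolding T_def mat_block_id_tensor[OF sup that]
    using mat_block_sandwich[of 2 F m m S a b L, OF F Sc that L_def] by simp
  have one: "C * S * 1\<^sub>m m = C * S" "1\<^sub>m m * S * mat_adjoint C = S * mat_adjoint C" "1\<^sub>m m * S * 1\<^sub>m m = S"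
    using C Sc by (auto simp: right_mult_one_mat[of _ m m])
  have b00: "mat_block p T 0 0 = \<Phi> (C * S * mat_adjoint C)"
    and b01: "mat_block p T 0 1 = \<Phi> (C * S)"
    and b10: "mat_block p T 1 0 = \<Phi> (S * mat_adjoint C)"
    and b11: "mat_block p T 1 1 = \<Phi> S"
    using block[of 0 0] block[of 0 1] block[of 1 0] block[of 1 1] one by (auto simp: F_def)
  note car = mat_block_carrier[of p T]
  have "mat_block p T 1 0 = mat_adjoint (mat_block p T 0 1)"
  proof (rule eq_matI)
    fix i j assume "i < dim_row (mat_adjoint (mat_block p T 0 1))" "j < dim_col (mat_adjoint (mat_block p T 0 1))"
    then have "i < p" "j < p" by (auto simp: mat_block_def)
    then show "mat_block p T 1 0 $$ (i, j) = mat_adjoint (mat_block p T 0 1) $$ (i, j)"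
      using hermitianD(3)[OF psd_hermitian[OF T], of "1 * p + i" "0 * p + j"]
      by (simp add: mat_block_def)
  qed (auto simp: mat_block_def)
  then show adj: "\<Phi> (S * mat_adjoint C) = mat_adjoint (\<Phi> (C * S))" unfolding b01 b10 .
  define G where "G a = (if a = 0 then 1\<^sub>m p else - 1 \<cdot>\<^sub>m Y)" for a :: nat
  define R where "R = mat p (2 * p) (\<lambda>(i, s). G (s div p) $$ (i, s mod p))"
  have G: "G a \<in> carrier_mat p p" for a using Y by (simp add: G_def)
  have R: "R \<in> carrier_mat p (2 * p)" by (simp add: R_def)
  have Y': "mat_adjoint (- 1 \<cdot>\<^sub>m Y) = - 1 \<cdot>\<^sub>m mat_adjoint Y" by (simp add: adjoint_smult)
  have "0 \<le> Re (mat_trace (R * T * mat_adjoint R))"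
    using psd_trace[OF psd_sandwich[OF T R]] by (simp add: less_eq_complex_def)
  also have "mat_trace (R * T * mat_adjoint R) = (\<Sum>a<2. \<Sum>b<2. mat_trace (G a * mat_block p T a b * mat_adjoint (G b)))"
    using trace_block_sandwich[of 2 G p p T R, OF G psd_carrier[OF T] R_def] .
  also have "\<dots> = mat_trace (mat_block p T 0 0) - mat_trace (mat_block p T 0 1 * mat_adjoint Y)
      - mat_trace (Y * mat_block p T 1 0) + mat_trace (Y * mat_block p T 1 1 * mat_adjoint Y)"
  proof -
    note Ya = adjoint_carrier[OF Y]
    have 0: "mat_trace (1\<^sub>m p * M * mat_adjoint (1\<^sub>m p)) = mat_trace M"
      and 1: "mat_trace (1\<^sub>m p * M * mat_adjoint (- 1 \<cdot>\<^sub>m Y)) = - mat_trace (M * mat_adjoint Y)"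
      and 2: "mat_trace (- 1 \<cdot>\<^sub>m Y * M * mat_adjoint (1\<^sub>m p)) = - mat_trace (Y * M)"
      and 3: "mat_trace (- 1 \<cdot>\<^sub>m Y * M * mat_adjoint (- 1 \<cdot>\<^sub>m Y)) = mat_trace (Y * M * mat_adjoint Y)"
      if M: "M \<in> carrier_mat p p" for M
    proof -
      note YM = mult_carrier_mat[OF Y M]
      show "mat_trace (1\<^sub>m p * M * mat_adjoint (1\<^sub>m p)) = mat_trace M"
        unfolding adjoint_one left_mult_one_mat[OF M] right_mult_one_mat[OF M] ..
      show "mat_trace (1\<^sub>m p * M * mat_adjoint (- 1 \<cdot>\<^sub>m Y)) = - mat_trace (M * mat_adjoint Y)"
        unfolding Y' left_mult_one_mat[OF M] mult_smult_distrib[OF M Ya] trace_smult[OF mult_carrier_mat[OF M Ya]] by simp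
      show "mat_trace (- 1 \<cdot>\<^sub>m Y * M * mat_adjoint (1\<^sub>m p)) = - mat_trace (Y * M)"
        unfolding adjoint_one mult_smult_assoc_mat[OF Y M] right_mult_one_mat[OF smult_carrier_mat[OF YM]] trace_smult[OF YM] by simp
      show "mat_trace (- 1 \<cdot>\<^sub>m Y * M * mat_adjoint (- 1 \<cdot>\<^sub>m Y)) = mat_trace (Y * M * mat_adjoint Y)"
        unfolding Y' mult_smult_assoc_mat[OF Y M] mult_smult_assoc_mat[OF YM smult_carrier_mat[OF Ya]]
          mult_smult_distrib[OF YM Ya] trace_smult[OF smult_carrier_mat[OF mult_carrier_mat[OF YM Ya]]]
          trace_smult[OF mult_carrier_mat[OF YM Ya]] by simp
    qed
    show ?thesis
      using 0[OF car, of 0 0] 1[OF car, of 0 1] 2[OF car, of 1 0] 3[OF car, of 1 1]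
      by (simp add: numeral_2_eq_2 G_def del: adjoint_one)
  qed
  also have "mat_trace (Y * mat_block p T 1 0) = cnj (mat_trace (mat_block p T 0 1 * mat_adjoint Y))"
  proof -
    have c: "\<Phi> (C * S) \<in> carrier_mat p p" using superopD(1)[OF sup, of "C * S"] C Sc by simp
    have "mat_adjoint (\<Phi> (C * S) * mat_adjoint Y) = Y * mat_adjoint (\<Phi> (C * S))"
      using c Y by (simp add: adjoint_mult)
    then show ?thesis unfolding b10 b01 adj
      using trace_adjoint[of "\<Phi> (C * S) * mat_adjoint Y" p] c Y by simp
  qed
  finally show "Re (mat_trace (Y * \<Phi> S * mat_adjoint Y)) \<ge>
      2 * Re (mat_trace (\<Phi> (C * S) * mat_adjoint Y)) - Re (mat_trace (C * S * mat_adjoint C))"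
    unfolding b00 b01 b11 using cptpD(3)[OF \<Phi> mult_carrier_mat[OF mult_carrier_mat[OF C Sc] adjoint_carrier[OF C]]] by simp
qed

text \<open>X is the image of Y under the adjoint of \<Phi> for the bilinear pairing tr (A Y); its
  entries are read off by pairing with matrix units, which explains the transposed indices.\<close>

lemma adjoint_superop_exists:
  assumes \<Phi>: "superop m p \<Phi>" and Y: "Y \<in> carrier_mat p p"
  obtains X where "X \<in> carrier_mat m m" "\<And>A. A \<in> carrier_mat m m \<Longrightarrow> mat_trace (\<Phi> A * Y) = mat_trace (A * X)"
proof -
  define X where "X = mat m m (\<lambda>(j, i). mat_trace (\<Phi> (matrix_unit m i j) * Y))"
  have "mat_trace (\<Phi> A * Y) = mat_trace (A * X)" if A: "A \<in> carrier_mat m m" for A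
  proof -
    have "mat_trace (\<Phi> A * Y) = (\<Sum>i<m. \<Sum>j<m. A $$ (i, j) * mat_trace (\<Phi> (matrix_unit m i j) * Y))"
    proof (rule linear_functional_expand[where f = "\<lambda>A. mat_trace (\<Phi> A * Y)"])
      fix A B :: "complex mat" assume AB: "A \<in> carrier_mat m m" "B \<in> carrier_mat m m"
      show "mat_trace (\<Phi> (A + B) * Y) = mat_trace (\<Phi> A * Y) + mat_trace (\<Phi> B * Y)"
        using superopD(1)[OF \<Phi> AB(1)] superopD(1)[OF \<Phi> AB(2)] Y
        by (simp add: superopD(2)[OF \<Phi> AB] add_mult_distrib_mat[of _ p p] trace_add[of _ p])
    next
      fix c and A :: "complex mat" assume A: "A \<in> carrier_mat m m"
      show "mat_trace (\<Phi> (c \<cdot>\<^sub>m A) * Y) = c * mat_trace (\<Phi> A * Y)"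
        using superopD(1)[OF \<Phi> A] Y
        by (simp add: superopD(3)[OF \<Phi> A] mult_smult_assoc_mat[of _ p p _ p] trace_smult[of _ p])
    qed (rule A)
    also have "\<dots> = mat_trace (A * X)"
      using A by (subst trace_mult[of _ m m]) (auto simp: X_def)
    finally show ?thesis .
  qed
  then show thesis by (intro that[of X]) (auto simp: X_def)
qed

theorem data_processing:
  assumes \<Phi>: "cptp m p \<Phi>" and A: "psd m A" and B: "psd m B"
    and dom: "dominated m A B" "dominated p (\<Phi> A) (\<Phi> B)"
  shows "relative_entropy (\<Phi> A) (\<Phi> B) \<le> relative_entropy A B"
proof (rule relative_entropy_le[OF psd_channel[OF \<Phi> A] psd_channel[OF \<Phi> B] dom(2) A B dom(1)])
  note sup = cptpD(1)[OF \<Phi>]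
  note Ac = psd_carrier[OF A] and Bc = psd_carrier[OF B]
  show "mat_trace (\<Phi> A) = mat_trace A" by (rule cptpD(3)[OF \<Phi> Ac])
  fix s :: real and Y :: "complex mat" assume s: "s > 0" and Y: "Y \<in> carrier_mat p p"
  obtain X where X: "X \<in> carrier_mat m m"
    and XY: "\<And>A. A \<in> carrier_mat m m \<Longrightarrow> mat_trace (\<Phi> A * Y) = mat_trace (A * X)"
    using adjoint_superop_exists[OF sup Y] by auto
  \<comment> \<open>The lower bound of \<open>channel_block_psd\<close> with C = X has the form 2 x
    - x, where x = Re tr (X B X'): duality identifies its first trace with the conjugate of tr (X B
    X').\<close>
  have "Re (mat_trace (X * B * mat_adjoint X)) \<le> Re (mat_trace (Y * \<Phi> B * mat_adjoint Y))"
  proof -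
    have c: "\<Phi> (X * B) \<in> carrier_mat p p" using superopD(1)[OF sup, of "X * B"] X Bc by simp
    have "cnj (mat_trace (\<Phi> (X * B) * mat_adjoint Y)) = mat_trace (mat_adjoint (\<Phi> (X * B) * mat_adjoint Y))"
      using c Y by (intro trace_adjoint[symmetric, of _ p]) auto
    also have "mat_adjoint (\<Phi> (X * B) * mat_adjoint Y) = Y * \<Phi> (B * mat_adjoint X)"
      using c Y by (simp add: adjoint_mult channel_block_psd(1)[OF \<Phi> B X Y])
    also have "mat_trace \<dots> = mat_trace (\<Phi> (B * mat_adjoint X) * Y)"
      using superopD(1)[OF sup, of "B * mat_adjoint X"] X Bc Y by (intro trace_comm[of _ p p]) auto
    also have "\<dots> = mat_trace (B * mat_adjoint X * X)"
      using X Bc by (intro XY) auto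
    also have "\<dots> = mat_trace (X * B * mat_adjoint X)"
      using X Bc trace_comm[of "B * mat_adjoint X" m m X] by (simp add: mult_assoc_dim)
    finally have "Re (mat_trace (\<Phi> (X * B) * mat_adjoint Y)) = Re (mat_trace (X * B * mat_adjoint X))"
      by (metis cnj.simps(1))
    then show ?thesis using channel_block_psd(2)[OF \<Phi> B X Y] by simp
  qed
  \<comment> \<open>The same bound with the adjoints of X and Y in place of X and Y; here duality
    applies without conjugation.\<close>
  moreover have "Re (mat_trace (mat_adjoint X * A * X)) \<le> Re (mat_trace (mat_adjoint Y * \<Phi> A * Y))"
  proof -
    have "mat_trace (\<Phi> (mat_adjoint X * A) * Y) = mat_trace (mat_adjoint X * A * X)"
      using X Ac by (intro XY) auto
    then show ?thesis
      using channel_block_psd(2)[OF \<Phi> A adjoint_carrier[OF X] adjoint_carrier[OF Y]] by simp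
  qed
  ultimately have "variational s (\<Phi> A) (\<Phi> B) Y \<le> variational s A B X"
    using s unfolding variational_def XY[OF Ac] by (intro diff_mono mult_left_mono) auto
  then show "\<exists>X\<in>carrier_mat m m. variational s (\<Phi> A) (\<Phi> B) Y \<le> variational s A B X" using X by blast
qed

section \<open>Partial traces\<close>

lemma mat_eq_blockI:
  assumes "A \<in> carrier_mat (k * m) (k * m)" "B \<in> carrier_mat (k * m) (k * m)"
    and "\<And>a b i j. a < k \<Longrightarrow> b < k \<Longrightarrow> i < m \<Longrightarrow> j < m \<Longrightarrow> A $$ (a * m + i, b * m + j) = B $$ (a * m + i, b * m + j)"
  shows "A = B"
proof (rule eq_matI)
  fix r s assume "r < dim_row B" "s < dim_col B"
  then have "r < k * m" "s < k * m" using assms(2) by auto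
  then show "A $$ (r, s) = B $$ (r, s)" using assms(3) by (metis product_index_cases)
qed (use assms in auto)

definition one_tensor :: "nat \<Rightarrow> nat \<Rightarrow> complex mat \<Rightarrow> complex mat" where
  "one_tensor k m L = mat (k * m) (k * m) (\<lambda>(r, s). if r div m = s div m then L $$ (r mod m, s mod m) else 0)"

lemma one_tensor_carrier [simp, intro]: "one_tensor k m L \<in> carrier_mat (k * m) (k * m)"
  by (simp add: one_tensor_def)

lemma one_tensor_index:
  assumes "a < k" "b < k" "i < m" "j < m"
  shows "one_tensor k m L $$ (a * m + i, b * m + j) = (if a = b then L $$ (i, j) else 0)"
  using assms product_index_less[of a k i m] product_index_less[of b k j m] by (simp add: one_tensor_def)

lemma one_tensor_mult:
  assumes L: "L \<in> carrier_mat m m" and M: "M \<in> carrier_mat m m"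
  shows "one_tensor k m L * one_tensor k m M = one_tensor k m (L * M)"
proof (rule mat_eq_blockI)
  fix a b i j assume *: "a < k" "b < k" "i < m" "j < m"
  have "(one_tensor k m L * one_tensor k m M) $$ (a * m + i, b * m + j) =
    (\<Sum>c<k. \<Sum>l<m. one_tensor k m L $$ (a * m + i, c * m + l) * one_tensor k m M $$ (c * m + l, b * m + j))"
    using * by (subst mult_index[OF one_tensor_carrier one_tensor_carrier])
      (auto simp: product_index_less sum_product_index)
  also have "\<dots> = (\<Sum>c<k. if c = a then (\<Sum>l<m. L $$ (i, l) * (if a = b then M $$ (l, j) else 0)) else 0)"
    using * by (intro sum.cong refl) (auto simp: one_tensor_index intro!: sum.neutral)
  also have "\<dots> = (if a = b then (\<Sum>l<m. L $$ (i, l) * M $$ (l, j)) else 0)"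
    using * by simp
  also have "\<dots> = one_tensor k m (L * M) $$ (a * m + i, b * m + j)"
    using * by (simp add: one_tensor_index mult_index[OF L M] del: index_mult_mat(1))
  finally show "(one_tensor k m L * one_tensor k m M) $$ (a * m + i, b * m + j) =
    one_tensor k m (L * M) $$ (a * m + i, b * m + j)" .
qed (use mult_carrier_mat[OF one_tensor_carrier one_tensor_carrier] in auto)

lemma one_tensor_adjoint:
  assumes L: "L \<in> carrier_mat m m"
  shows "mat_adjoint (one_tensor k m L) = one_tensor k m (mat_adjoint L)"
proof (rule mat_eq_blockI)
  fix a b i j assume *: "a < k" "b < k" "i < m" "j < m"
  have "mat_adjoint (one_tensor k m L) $$ (a * m + i, b * m + j) = cnj (one_tensor k m L $$ (b * m + j, a * m + i))"
    using * by (intro adjoint_index) (auto simp: one_tensor_def product_index_less)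
  then show "mat_adjoint (one_tensor k m L) $$ (a * m + i, b * m + j) = one_tensor k m (mat_adjoint L) $$ (a * m + i, b * m + j)"
    using * L by (simp add: one_tensor_index)
qed auto

lemma one_tensor_one: "one_tensor k m (1\<^sub>m m) = 1\<^sub>m (k * m)"
proof (rule mat_eq_blockI)
  fix a b i j assume *: "a < k" "b < k" "i < m" "j < m"
  have "a * m + i = b * m + j \<longleftrightarrow> a = b \<and> i = j"
    using * by (metis div_mult_self3 mod_mult_self3 div_less mod_less add_0_right less_nat_zero_code)
  then show "one_tensor k m (1\<^sub>m m) $$ (a * m + i, b * m + j) = 1\<^sub>m (k * m) $$ (a * m + i, b * m + j)"
    using * by (simp add: one_tensor_index product_index_less)
qed auto

lemma one_tensor_real_diag: "one_tensor k m (real_diag m e) = real_diag (k * m) (\<lambda>r. e (r mod m))"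
proof (rule mat_eq_blockI)
  fix a b i j assume *: "a < k" "b < k" "i < m" "j < m"
  have "a * m + i = b * m + j \<longleftrightarrow> a = b \<and> i = j"
    using * by (metis div_mult_self3 mod_mult_self3 div_less mod_less add_0_right less_nat_zero_code)
  then show "one_tensor k m (real_diag m e) $$ (a * m + i, b * m + j) = real_diag (k * m) (\<lambda>r. e (r mod m)) $$ (a * m + i, b * m + j)"
    using * by (simp add: one_tensor_index product_index_less real_diag_index)
qed auto

lemma diagonalizes_one_tensor:
  assumes "diagonalizes m U e L"
  shows "diagonalizes (k * m) (one_tensor k m U) (\<lambda>r. e (r mod m)) (one_tensor k m L)"
proof -
  note U = diagonalizesD[OF assms]
  have "unitary (k * m) (one_tensor k m U)"
    using U(5) unitaryD(2)[OF U(1)]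
    by (intro unitaryI) (simp_all add: one_tensor_adjoint one_tensor_mult one_tensor_one)
  moreover have "one_tensor k m L = one_tensor k m U * real_diag (k * m) (\<lambda>r. e (r mod m)) * mat_adjoint (one_tensor k m U)"
    unfolding U(2) one_tensor_real_diag[symmetric] one_tensor_adjoint[OF U(5)]
      one_tensor_mult[OF U(5) real_diag_carrier]
      one_tensor_mult[OF mult_carrier_mat[OF U(5) real_diag_carrier] adjoint_carrier[OF U(5)]] ..
  ultimately show ?thesis by (simp add: diagonalizes_def)
qed

lemma mat_fun_one_tensor:
  assumes "hermitian m L"
  shows "mat_fun f (one_tensor k m L) = one_tensor k m (mat_fun f L)"
proof -
  obtain U e where U: "diagonalizes m U e L" using hermitian_diagonalizable[OF assms] by auto
  have "mat_fun f (one_tensor k m L) = one_tensor k m U * real_diag (k * m) (\<lambda>r. f (e (r mod m))) * mat_adjoint (one_tensor k m U)"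
    by (rule mat_fun_eq[OF diagonalizes_one_tensor[OF U]])
  also have "\<dots> = one_tensor k m (mat_fun f L)"
    using diagonalizesD(2)[OF diagonalizes_one_tensor[OF diagonalizes_mat_fun[OF U, of f], of k]] by simp
  finally show ?thesis .
qed

lemma psd_one_tensor:
  assumes "psd m L"
  shows "psd (k * m) (one_tensor k m L)"
proof -
  obtain U e where U: "diagonalizes m U e L" using hermitian_diagonalizable[OF psd_hermitian[OF assms]] by auto
  show ?thesis
  proof (rule psd_diagonalizes[OF diagonalizes_one_tensor[OF U]])
    fix r assume "r < k * m"
    then have "r mod m < m" by (cases m) auto
    then show "0 \<le> e (r mod m)" by (rule psd_eigenvalue_nonneg[OF U assms])
  qed
qed

section \<open>The left partial trace: duality, positivity and kernels\<close>

lemma ptrace_left_carrier [simp, intro]: "ptrace_left k m A \<in> carrier_mat m m"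
  by (simp add: ptrace_left_def)

lemma ptrace_right_carrier [simp, intro]: "ptrace_right k m A \<in> carrier_mat k k"
  by (simp add: ptrace_right_def)

text \<open>The partial trace is dual to L -> 1 (x) L; this is how entropies of marginals enter the
  relative entropy.\<close>

lemma trace_mult_one_tensor:
  assumes A: "A \<in> carrier_mat (k * m) (k * m)" and L: "L \<in> carrier_mat m m"
  shows "mat_trace (A * one_tensor k m L) = mat_trace (ptrace_left k m A * L)"
proof -
  have "mat_trace (A * one_tensor k m L) =
    (\<Sum>a<k. \<Sum>i<m. \<Sum>b<k. \<Sum>j<m. A $$ (a * m + i, b * m + j) * one_tensor k m L $$ (b * m + j, a * m + i))"
    by (subst trace_mult[OF A one_tensor_carrier]) (simp add: sum_product_index)
  also have "\<dots> = (\<Sum>a<k. \<Sum>i<m. \<Sum>b<k. if b = a then (\<Sum>j<m. A $$ (a * m + i, a * m + j) * L $$ (j, i)) else 0)"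
    by (intro sum.cong refl) (auto simp: one_tensor_index intro!: sum.neutral)
  also have "\<dots> = (\<Sum>a<k. \<Sum>i<m. \<Sum>j<m. A $$ (a * m + i, a * m + j) * L $$ (j, i))"
    by simp
  also have "\<dots> = (\<Sum>i<m. \<Sum>j<m. \<Sum>a<k. A $$ (a * m + i, a * m + j) * L $$ (j, i))"
    by (subst sum.swap, subst (2) sum.swap) simp
  also have "\<dots> = mat_trace (ptrace_left k m A * L)"
    by (subst trace_mult[OF ptrace_left_carrier L]) (simp add: ptrace_left_def sum_distrib_right)
  finally show ?thesis .
qed

lemma trace_ptrace_left:
  assumes "A \<in> carrier_mat (k * m) (k * m)"
  shows "mat_trace (ptrace_left k m A) = mat_trace A"
  using trace_mult_one_tensor[OF assms one_carrier_mat] assms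
  by (simp add: one_tensor_one right_mult_one_mat[of _ m m] right_mult_one_mat[of _ "k * m" "k * m"])

text \<open>A vector supported on one block sees only the corresponding diagonal block, and the
  partial trace is the sum of the diagonal blocks.\<close>

lemma quad_block_diagonal:
  assumes c: "c < k"
  shows "quad (k * m) A (\<lambda>r. if r div m = c then f r else 0) = quad m (mat_block m A c c) (\<lambda>i. f (c * m + i))"
proof -
  let ?f = "\<lambda>r. if r div m = c then f r else 0"
  have "quad (k * m) A ?f = (\<Sum>a<k. \<Sum>i<m. \<Sum>b<k. \<Sum>j<m. cnj (?f (a * m + i)) * A $$ (a * m + i, b * m + j) * ?f (b * m + j))"
    by (simp add: quad_def sum_product_index)
  also have "\<dots> = (\<Sum>a<k. if a = c then (\<Sum>i<m. \<Sum>b<k. if b = c then (\<Sum>j<m. cnj (f (c * m + i)) * A $$ (c * m + i, c * m + j) * f (c * m + j)) else 0) else 0)"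
  proof (intro sum.cong refl)
    fix a
    show "(\<Sum>i<m. \<Sum>b<k. \<Sum>j<m. cnj (?f (a * m + i)) * A $$ (a * m + i, b * m + j) * ?f (b * m + j)) =
      (if a = c then (\<Sum>i<m. \<Sum>b<k. if b = c then (\<Sum>j<m. cnj (f (c * m + i)) * A $$ (c * m + i, c * m + j) * f (c * m + j)) else 0) else 0)"
    proof (cases "a = c")
      case True
      show ?thesis unfolding True if_P[OF refl]
        by (intro sum.cong refl) (auto intro!: sum.neutral)
    qed (auto intro!: sum.neutral)
  qed
  also have "\<dots> = quad m (mat_block m A c c) (\<lambda>i. f (c * m + i))"
    using c by (simp add: quad_def mat_block_def)
  finally show ?thesis .
qed

lemma quad_ptrace_left: "quad m (ptrace_left k m A) f = (\<Sum>c<k. quad m (mat_block m A c c) f)"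
proof -
  have "quad m (ptrace_left k m A) f = (\<Sum>i<m. \<Sum>j<m. \<Sum>c<k. cnj (f i) * A $$ (c * m + i, c * m + j) * f j)"
    unfolding quad_def by (intro sum.cong refl) (simp add: ptrace_left_def sum_distrib_left sum_distrib_right)
  also have "\<dots> = (\<Sum>c<k. \<Sum>i<m. \<Sum>j<m. cnj (f i) * A $$ (c * m + i, c * m + j) * f j)"
    by (subst (2) sum.swap, subst sum.swap) simp
  also have "\<dots> = (\<Sum>c<k. quad m (mat_block m A c c) f)"
    by (simp add: quad_def mat_block_def)
  finally show ?thesis .
qed

lemma quad_one_tensor: "quad (k * m) (one_tensor k m L) f = (\<Sum>a<k. quad m L (\<lambda>i. f (a * m + i)))"
proof -
  have "quad (k * m) (one_tensor k m L) f =
    (\<Sum>a<k. \<Sum>i<m. \<Sum>b<k. \<Sum>j<m. cnj (f (a * m + i)) * one_tensor k m L $$ (a * m + i, b * m + j) * f (b * m + j))"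
    by (simp add: quad_def sum_product_index)
  also have "\<dots> = (\<Sum>a<k. \<Sum>i<m. \<Sum>b<k. if b = a then (\<Sum>j<m. cnj (f (a * m + i)) * L $$ (i, j) * f (a * m + j)) else 0)"
    by (intro sum.cong refl) (auto simp: one_tensor_index intro!: sum.neutral)
  also have "\<dots> = (\<Sum>a<k. quad m L (\<lambda>i. f (a * m + i)))"
    by (simp add: quad_def)
  finally show ?thesis .
qed

lemma quad_diagonal_block_nonneg:
  assumes "psd (k * m) A" "c < k"
  shows "0 \<le> quad m (mat_block m A c c) f"
proof -
  have "quad m (mat_block m A c c) (\<lambda>i. f (c * m + i - c * m)) =
      quad (k * m) A (\<lambda>r. if r div m = c then f (r - c * m) else 0)"
    using quad_block_diagonal[OF assms(2), of m A "\<lambda>r. f (r - c * m)"] by simp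
  then show ?thesis using quad_nonneg[OF assms(1)] by simp
qed

lemma psd_ptrace_left:
  assumes A: "psd (k * m) A"
  shows "psd m (ptrace_left k m A)"
proof (rule psdI)
  show "hermitian m (ptrace_left k m A)"
  proof (rule hermitianI)
    fix i j assume ij: "i < m" "j < m"
    have "A $$ (a * m + i, a * m + j) = cnj (A $$ (a * m + j, a * m + i))" if "a < k" for a
      using ij that by (intro hermitianD(3)[OF psd_hermitian[OF A]] product_index_less)
    then show "ptrace_left k m A $$ (i, j) = cnj (ptrace_left k m A $$ (j, i))"
      using ij by (simp add: ptrace_left_def)
  qed simp
  fix f
  have "0 \<le> quad m (ptrace_left k m A) f"
    unfolding quad_ptrace_left by (intro sum_nonneg quad_diagonal_block_nonneg[OF A]) auto
  then show "0 \<le> (\<Sum>i<m. \<Sum>j<m. cnj (f i) * ptrace_left k m A $$ (i, j) * f j)"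
    by (simp add: quad_def)
qed

lemma quad_parallelogram:
  "quad n A (\<lambda>i. f i + g i) + quad n A (\<lambda>i. f i - g i) = 2 * quad n A f + 2 * quad n A g"
  unfolding quad_def sum.distrib[symmetric] sum_distrib_left
  by (intro sum.cong refl) (simp add: algebra_simps)

text \<open>By the parallelogram law the values at f + g and f - g are nonnegative numbers with sum
  0.\<close>

lemma quad_zero_add:
  assumes A: "psd n A" and "quad n A f = 0" "quad n A g = 0"
  shows "quad n A (\<lambda>i. f i + g i) = 0"
  using quad_parallelogram[of n A f g] quad_nonneg[OF A, of "\<lambda>i. f i + g i"] quad_nonneg[OF A, of "\<lambda>i. f i - g i"] assms
  by (simp add: add_nonneg_eq_0_iff)

lemma quad_zero_sum:
  assumes A: "psd n A" and "finite S" "\<And>a. a \<in> S \<Longrightarrow> quad n A (F a) = 0"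
  shows "quad n A (\<lambda>i. \<Sum>a\<in>S. F a i) = 0"
  using assms(2,3)
proof (induction S rule: finite_induct)
  case empty
  then show ?case by (simp add: quad_def)
next
  case (insert x S)
  have "quad n A (\<lambda>i. F x i + (\<Sum>a\<in>S. F a i)) = 0"
    using insert by (intro quad_zero_add[OF A]) auto
  then show ?case using insert by simp
qed

text \<open>If the form of 1 (x) tr_1 A vanishes at f, then every diagonal block of A has a
  vanishing form at every block of f. In particular this holds for block a of A at block a of f, so
  each block of f, extended by 0, is a zero of the form of A. Their sum f is then a zero
  too.\<close>

lemma dominated_one_tensor:
  assumes A: "psd (k * m) A"
  shows "dominated (k * m) A (one_tensor k m (ptrace_left k m A))"
  unfolding dominated_def
proof (intro allI impI)
  fix f assume "quad (k * m) (one_tensor k m (ptrace_left k m A)) f = 0"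
  then have "(\<Sum>a<k. \<Sum>c<k. quad m (mat_block m A c c) (\<lambda>i. f (a * m + i))) = 0"
    by (simp add: quad_one_tensor quad_ptrace_left)
  then have "\<forall>a\<in>{..<k}. (\<Sum>c<k. quad m (mat_block m A c c) (\<lambda>i. f (a * m + i))) = 0"
    using quad_diagonal_block_nonneg[OF A] by (subst (asm) sum_nonneg_eq_0_iff) (auto intro!: sum_nonneg)
  then have zero: "quad m (mat_block m A a a) (\<lambda>i. f (a * m + i)) = 0" if "a < k" for a
    using that quad_diagonal_block_nonneg[OF A] by (subst (asm) sum_nonneg_eq_0_iff) auto
  have "quad (k * m) A (\<lambda>r. \<Sum>a<k. if r div m = a then f r else 0) = 0"
    using zero by (intro quad_zero_sum[OF A]) (auto simp: quad_block_diagonal)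
  also have "quad (k * m) A (\<lambda>r. \<Sum>a<k. if r div m = a then f r else 0) = quad (k * m) A f"
    unfolding quad_def by (intro sum.cong refl) (simp add: less_mult_imp_div_less)
  finally show "quad (k * m) A f = 0" .
qed

section \<open>Channels tensored with the identity\<close>

lemma id_tensor_dim [simp]:
  "dim_row (id_tensor k m p \<Phi> A) = k * p" "dim_col (id_tensor k m p \<Phi> A) = k * p"
  by (simp_all add: id_tensor_def)

lemma superop_sum:
  assumes \<Phi>: "superop m p \<Phi>" and "finite S" and F: "\<And>a. a \<in> S \<Longrightarrow> F a \<in> carrier_mat m m"
  shows "\<Phi> (mat m m (\<lambda>x. \<Sum>a\<in>S. F a $$ x)) = mat p p (\<lambda>x. \<Sum>a\<in>S. \<Phi> (F a) $$ x)"
  using assms(2,3)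
proof (induction S rule: finite_induct)
  case empty
  have "mat m m (\<lambda>x. \<Sum>a\<in>{}. F a $$ x) = 0\<^sub>m m m" by (intro eq_matI) auto
  moreover have "mat p p (\<lambda>x. \<Sum>a\<in>{}. \<Phi> (F a) $$ x) = 0\<^sub>m p p" by (intro eq_matI) auto
  ultimately show ?case using superop_zero[OF \<Phi>] by simp
next
  case (insert b S)
  let ?M = "mat m m (\<lambda>x. \<Sum>a\<in>S. F a $$ x)"
  have Fb: "F b \<in> carrier_mat m m" and M: "?M \<in> carrier_mat m m" using insert by auto
  have "mat m m (\<lambda>x. \<Sum>a\<in>insert b S. F a $$ x) = F b + ?M"
    using insert(1,2) Fb by (intro eq_matI) auto
  then have "\<Phi> (mat m m (\<lambda>x. \<Sum>a\<in>insert b S. F a $$ x)) = \<Phi> (F b) + \<Phi> ?M"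
    using superopD(2)[OF \<Phi> Fb M] by simp
  also have "\<dots> = \<Phi> (F b) + mat p p (\<lambda>x. \<Sum>a\<in>S. \<Phi> (F a) $$ x)"
    using insert by simp
  also have "\<dots> = mat p p (\<lambda>x. \<Sum>a\<in>insert b S. \<Phi> (F a) $$ x)"
    using insert(1,2) superopD(1)[OF \<Phi> Fb] by (intro eq_matI) auto
  finally show ?case .
qed

text \<open>Both sides read an index by the same digits, only grouped differently. Hence complete
  positivity of I (x) \<Phi> against j further copies is that of \<Phi> against j k copies.\<close>

lemma id_tensor_id_tensor:
  assumes \<Phi>: "superop m p \<Phi>" and A: "A \<in> carrier_mat (j * (k * m)) (j * (k * m))"
  shows "id_tensor j (k * m) (k * p) (id_tensor k m p \<Phi>) A = id_tensor (j * k) m p \<Phi> A"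
proof (rule mat_eq_blockI)
  show "id_tensor j (k * m) (k * p) (id_tensor k m p \<Phi>) A \<in> carrier_mat (j * k * p) (j * k * p)"
    using id_tensor_carrier[of j "k * m" "k * p"] by (simp add: mult.assoc)
  fix r s i i' assume *: "r < j * k" "s < j * k" "i < p" "i' < p"
  obtain a b where r: "r = a * k + b" "a < j" "b < k" using *(1) by (rule product_index_cases)
  obtain a' b' where s: "s = a' * k + b'" "a' < j" "b' < k" using *(2) by (rule product_index_cases)
  have idx: "(a * k + b) * p + i = a * (k * p) + (b * p + i)" for a b p i by (simp add: algebra_simps)
  have block: "mat_block m (mat_block (k * m) A a a') b b' = mat_block m A (a * k + b) (a' * k + b')"
    using r s by (intro eq_matI) (auto simp: mat_block_def product_index_less idx)
  have "id_tensor j (k * m) (k * p) (id_tensor k m p \<Phi>) A $$ (r * p + i, s * p + i') =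
    id_tensor k m p \<Phi> (mat_block (k * m) A a a') $$ (b * p + i, b' * p + i')"
    unfolding r(1) s(1) idx using r s * by (intro id_tensor_index product_index_less)
  also have "\<dots> = \<Phi> (mat_block m A r s) $$ (i, i')"
    using r s * by (simp add: id_tensor_index block)
  also have "\<dots> = id_tensor (j * k) m p \<Phi> A $$ (r * p + i, s * p + i')"
    using * by (simp add: id_tensor_index)
  finally show "id_tensor j (k * m) (k * p) (id_tensor k m p \<Phi>) A $$ (r * p + i, s * p + i') =
    id_tensor (j * k) m p \<Phi> A $$ (r * p + i, s * p + i')" .
qed auto

lemma mat_block_add:
  assumes "a < k" "b < k" "A \<in> carrier_mat (k * m) (k * m)" "B \<in> carrier_mat (k * m) (k * m)"
  shows "mat_block m (A + B) a b = mat_block m A a b + mat_block m B a b"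
  using assms product_index_less[OF assms(1)] product_index_less[OF assms(2)]
  by (intro eq_matI) (auto simp: mat_block_def)

lemma mat_block_smult:
  assumes "a < k" "b < k" "A \<in> carrier_mat (k * m) (k * m)"
  shows "mat_block m (c \<cdot>\<^sub>m A) a b = c \<cdot>\<^sub>m mat_block m A a b"
  using assms product_index_less[OF assms(1)] product_index_less[OF assms(2)]
  by (intro eq_matI) (auto simp: mat_block_def)

lemma trace_id_tensor:
  assumes \<Phi>: "cptp m p \<Phi>" and A: "A \<in> carrier_mat (k * m) (k * m)"
  shows "mat_trace (id_tensor k m p \<Phi> A) = mat_trace A"
proof -
  have "mat_trace (id_tensor k m p \<Phi> A) = (\<Sum>a<k. \<Sum>i<p. \<Phi> (mat_block m A a a) $$ (i, i))"
    by (simp add: mat_trace_def sum_product_index id_tensor_index)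
  also have "\<dots> = (\<Sum>a<k. mat_trace (\<Phi> (mat_block m A a a)))"
    by (simp add: mat_trace_def carrier_matD(1)[OF superopD(1)[OF cptpD(1)[OF \<Phi>] mat_block_carrier]])
  also have "\<dots> = (\<Sum>a<k. \<Sum>i<m. A $$ (a * m + i, a * m + i))"
    using cptpD(3)[OF \<Phi> mat_block_carrier] by (simp add: mat_trace_def mat_block_def)
  also have "\<dots> = mat_trace A" using A by (simp add: mat_trace_def sum_product_index)
  finally show ?thesis .
qed

lemma cptp_id_tensor:
  assumes \<Phi>: "cptp m p \<Phi>"
  shows "cptp (k * m) (k * p) (id_tensor k m p \<Phi>)"
proof -
  note sup = cptpD(1)[OF \<Phi>]
  have "superop (k * m) (k * p) (id_tensor k m p \<Phi>)"
    unfolding superop_def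
  proof (intro conjI ballI allI)
    fix A B :: "complex mat" assume AB: "A \<in> carrier_mat (k * m) (k * m)" "B \<in> carrier_mat (k * m) (k * m)"
    show "id_tensor k m p \<Phi> (A + B) = id_tensor k m p \<Phi> A + id_tensor k m p \<Phi> B"
    proof (rule mat_eq_blockI)
      fix a b i j assume *: "a < k" "b < k" "i < p" "j < p"
      then show "id_tensor k m p \<Phi> (A + B) $$ (a * p + i, b * p + j) =
          (id_tensor k m p \<Phi> A + id_tensor k m p \<Phi> B) $$ (a * p + i, b * p + j)"
        using superopD(1)[OF sup mat_block_carrier, of A a b] superopD(1)[OF sup mat_block_carrier, of B a b]
        by (simp add: id_tensor_index mat_block_add[OF *(1,2) AB] superopD(2)[OF sup] product_index_less)
    qed auto
  next
    fix c and A :: "complex mat" assume A: "A \<in> carrier_mat (k * m) (k * m)"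
    show "id_tensor k m p \<Phi> (c \<cdot>\<^sub>m A) = c \<cdot>\<^sub>m id_tensor k m p \<Phi> A"
    proof (rule mat_eq_blockI)
      fix a b i j assume *: "a < k" "b < k" "i < p" "j < p"
      then show "id_tensor k m p \<Phi> (c \<cdot>\<^sub>m A) $$ (a * p + i, b * p + j) =
          (c \<cdot>\<^sub>m id_tensor k m p \<Phi> A) $$ (a * p + i, b * p + j)"
        using superopD(1)[OF sup mat_block_carrier, of A a b]
        by (simp add: id_tensor_index mat_block_smult[OF *(1,2) A] superopD(3)[OF sup] product_index_less)
    qed auto
  qed auto
  moreover have "completely_positive (k * m) (k * p) (id_tensor k m p \<Phi>)"
    unfolding completely_positive_def
  proof (intro allI impI)
    fix j A assume A: "psd (j * (k * m)) A"
    then have "psd (j * k * p) (id_tensor (j * k) m p \<Phi> A)"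
      by (intro cptpD(2)[OF \<Phi>]) (simp add: mult.assoc)
    then show "psd (j * (k * p)) (id_tensor j (k * m) (k * p) (id_tensor k m p \<Phi>) A)"
      using id_tensor_id_tensor[OF sup psd_carrier[OF A]] by (simp add: mult.assoc)
  qed
  moreover have "trace_preserving (k * m) (id_tensor k m p \<Phi>)"
    using trace_id_tensor[OF \<Phi>] by (simp add: trace_preserving_def)
  ultimately show ?thesis by (simp add: cptp_def)
qed

lemma id_tensor_one_tensor:
  assumes \<Phi>: "superop m p \<Phi>" and L: "L \<in> carrier_mat m m"
  shows "id_tensor k m p \<Phi> (one_tensor k m L) = one_tensor k p (\<Phi> L)"
proof (rule mat_eq_blockI)
  fix a b i j assume *: "a < k" "b < k" "i < p" "j < p"
  have "mat_block m (one_tensor k m L) a b = (if a = b then L else 0\<^sub>m m m)"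
    using * L by (intro eq_matI) (auto simp: mat_block_def one_tensor_index)
  then show "id_tensor k m p \<Phi> (one_tensor k m L) $$ (a * p + i, b * p + j) = one_tensor k p (\<Phi> L) $$ (a * p + i, b * p + j)"
    using * superop_zero[OF \<Phi>] by (simp add: id_tensor_index one_tensor_index)
qed auto

text \<open>The traced factor k and the surviving factor j both lie to the left of the channel. The
  case j = 1 gives the pair created by a channel, the case j = d the action of the next channel on
  that pair.\<close>

lemma ptrace_left_id_tensor_product:
  assumes \<Phi>: "superop m p \<Phi>"
  shows "ptrace_left k (j * p) (id_tensor (k * j) m p \<Phi> A) = id_tensor j m p \<Phi> (ptrace_left k (j * m) A)"
proof (rule mat_eq_blockI)
  fix b b' i i' assume *: "b < j" "b' < j" "i < p" "i' < p"
  have idx: "a * (j * m) + (b * m + i) = (a * j + b) * m + i" for a b m i by (simp add: algebra_simps)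
  have block: "mat_block m (ptrace_left k (j * m) A) b b' =
      mat m m (\<lambda>x. \<Sum>a<k. mat_block m A (a * j + b) (a * j + b') $$ x)"
    using * by (intro eq_matI) (auto simp: mat_block_def ptrace_left_def product_index_less idx)
  have "ptrace_left k (j * p) (id_tensor (k * j) m p \<Phi> A) $$ (b * p + i, b' * p + i') =
    (\<Sum>a<k. id_tensor (k * j) m p \<Phi> A $$ ((a * j + b) * p + i, (a * j + b') * p + i'))"
    using * by (simp add: ptrace_left_def product_index_less idx)
  also have "\<dots> = (\<Sum>a<k. \<Phi> (mat_block m A (a * j + b) (a * j + b')) $$ (i, i'))"
    using * by (intro sum.cong refl id_tensor_index product_index_less) auto
  also have "\<dots> = \<Phi> (mat_block m (ptrace_left k (j * m) A) b b') $$ (i, i')"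
    unfolding block using * by (subst superop_sum[OF \<Phi>]) auto
  also have "\<dots> = id_tensor j m p \<Phi> (ptrace_left k (j * m) A) $$ (b * p + i, b' * p + i')"
    using * by (simp add: id_tensor_index)
  finally show "ptrace_left k (j * p) (id_tensor (k * j) m p \<Phi> A) $$ (b * p + i, b' * p + i') =
    id_tensor j m p \<Phi> (ptrace_left k (j * m) A) $$ (b * p + i, b' * p + i')" .
qed auto

lemma ptrace_left_id_tensor:
  assumes \<Phi>: "superop m p \<Phi>"
  shows "ptrace_left k p (id_tensor k m p \<Phi> A) = \<Phi> (ptrace_left k m A)"
  using ptrace_left_id_tensor_product[OF \<Phi>, of k 1 A] id_tensor_one[OF \<Phi> ptrace_left_carrier, of k A] by simp

text \<open>Trace preservation, applied to each block: a channel does not affect the marginal of the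
  sites it does not touch.\<close>

lemma ptrace_right_id_tensor:
  assumes \<Phi>: "cptp m p \<Phi>"
  shows "ptrace_right k p (id_tensor k m p \<Phi> A) = ptrace_right k m A"
proof (rule eq_matI)
  fix a b assume "a < dim_row (ptrace_right k m A)" "b < dim_col (ptrace_right k m A)"
  then have ab: "a < k" "b < k" by (auto simp: ptrace_right_def)
  have "ptrace_right k p (id_tensor k m p \<Phi> A) $$ (a, b) = mat_trace (\<Phi> (mat_block m A a b))"
    using ab superopD(1)[OF cptpD(1)[OF \<Phi>] mat_block_carrier, of A a b]
    by (simp add: ptrace_right_def mat_trace_def id_tensor_index)
  also have "\<dots> = mat_trace (mat_block m A a b)"
    by (rule cptpD(3)[OF \<Phi> mat_block_carrier])
  also have "\<dots> = ptrace_right k m A $$ (a, b)"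
    using ab by (simp add: ptrace_right_def mat_trace_def mat_block_def)
  finally show "ptrace_right k p (id_tensor k m p \<Phi> A) $$ (a, b) = ptrace_right k m A $$ (a, b)" .
qed (auto simp: ptrace_right_def)

lemma ptrace_right_product:
  "ptrace_right k (m * l) A = ptrace_right k m (ptrace_right (k * m) l A)"
proof (rule eq_matI)
  have idx: "a * (m * l) + (i * l + j) = (a * m + i) * l + j" for a i j by (simp add: algebra_simps)
  fix a b assume "a < dim_row (ptrace_right k m (ptrace_right (k * m) l A))" "b < dim_col (ptrace_right k m (ptrace_right (k * m) l A))"
  then show "ptrace_right k (m * l) A $$ (a, b) = ptrace_right k m (ptrace_right (k * m) l A) $$ (a, b)"
    by (simp add: ptrace_right_def sum_product_index product_index_less idx)
qed (auto simp: ptrace_right_def)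

lemma ptrace_left_product:
  "ptrace_left (k * l) m A = ptrace_left l m (ptrace_left k (l * m) A)"
proof (rule eq_matI)
  have idx: "a * (l * m) + (b * m + j) = (a * l + b) * m + j" for a b j by (simp add: algebra_simps)
  fix i j assume "i < dim_row (ptrace_left l m (ptrace_left k (l * m) A))" "j < dim_col (ptrace_left l m (ptrace_left k (l * m) A))"
  then have ij: "i < m" "j < m" by (auto simp: ptrace_left_def)
  have "ptrace_left (k * l) m A $$ (i, j) = (\<Sum>a<k. \<Sum>b<l. A $$ ((a * l + b) * m + i, (a * l + b) * m + j))"
    using ij by (simp add: ptrace_left_def sum_product_index)
  also have "\<dots> = (\<Sum>b<l. \<Sum>a<k. A $$ ((a * l + b) * m + i, (a * l + b) * m + j))" by (rule sum.swap)
  also have "\<dots> = ptrace_left l m (ptrace_left k (l * m) A) $$ (i, j)"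
    using ij by (simp add: ptrace_left_def product_index_less idx)
  finally show "ptrace_left (k * l) m A $$ (i, j) = ptrace_left l m (ptrace_left k (l * m) A) $$ (i, j)" .
qed (auto simp: ptrace_left_def)

lemma ptrace_left_right:
  "ptrace_left k m (ptrace_right (k * m) l A) = ptrace_right m l (ptrace_left k (m * l) A)"
proof (rule eq_matI)
  have idx: "a * (m * l) + (b * l + j) = (a * m + b) * l + j" for a b j by (simp add: algebra_simps)
  fix i j assume "i < dim_row (ptrace_right m l (ptrace_left k (m * l) A))" "j < dim_col (ptrace_right m l (ptrace_left k (m * l) A))"
  then have ij: "i < m" "j < m" by (auto simp: ptrace_right_def)
  have "ptrace_left k m (ptrace_right (k * m) l A) $$ (i, j) = (\<Sum>a<k. \<Sum>x<l. A $$ ((a * m + i) * l + x, (a * m + j) * l + x))"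
    using ij by (simp add: ptrace_left_def ptrace_right_def product_index_less)
  also have "\<dots> = (\<Sum>x<l. \<Sum>a<k. A $$ ((a * m + i) * l + x, (a * m + j) * l + x))" by (rule sum.swap)
  also have "\<dots> = ptrace_right m l (ptrace_left k (m * l) A) $$ (i, j)"
    using ij by (simp add: ptrace_left_def ptrace_right_def product_index_less idx)
  finally show "ptrace_left k m (ptrace_right (k * m) l A) $$ (i, j) = ptrace_right m l (ptrace_left k (m * l) A) $$ (i, j)" .
qed (auto simp: ptrace_left_def ptrace_right_def)

section \<open>Conditional entropy\<close>

definition ln_entropy :: "complex mat \<Rightarrow> real" where
  "ln_entropy A = - Re (mat_trace (A * mat_fun ln A))"

text \<open>The conditioning system is the right factor, because each channel of the chain acts on
  the rightmost site present.\<close>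

definition cond_entropy :: "nat \<Rightarrow> nat \<Rightarrow> complex mat \<Rightarrow> real" where
  "cond_entropy k m A = ln_entropy A - ln_entropy (ptrace_left k m A)"

text \<open>Functional calculus commutes with L -> 1 (x) L, and duality turns the trace of A ln (1
  (x) tr_1 A) into the negative entropy of tr_1 A.\<close>

lemma relative_entropy_one_tensor:
  assumes A: "psd (k * m) A"
  shows "relative_entropy A (one_tensor k m (ptrace_left k m A)) = - cond_entropy k m A"
proof -
  have h: "hermitian m (ptrace_left k m A)" by (intro psd_hermitian psd_ptrace_left A)
  obtain U e where U: "diagonalizes m U e (ptrace_left k m A)" using hermitian_diagonalizable[OF h] by auto
  show ?thesis
    unfolding relative_entropy_def mat_fun_one_tensor[OF h]
      trace_mult_one_tensor[OF psd_carrier[OF A] diagonalizesD(3)[OF diagonalizes_mat_fun[OF U]]]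
    by (simp add: cond_entropy_def ln_entropy_def)
qed

theorem cond_entropy_channel:
  assumes \<Phi>: "cptp m p \<Phi>" and A: "psd (k * m) A"
  shows "cond_entropy k m A \<le> cond_entropy k p (id_tensor k m p \<Phi> A)"
proof -
  let ?L = "ptrace_left k m A"
  have L: "psd m ?L" by (rule psd_ptrace_left[OF A])
  have B: "psd (k * p) (id_tensor k m p \<Phi> A)" by (rule cptpD(2)[OF \<Phi> A])
  \<comment> \<open>The channel acts on the right factor only, so it takes the reference matrix 1
    (x) tr_1 A to the reference matrix of the image.\<close>
  have eq: "one_tensor k p (ptrace_left k p (id_tensor k m p \<Phi> A)) = id_tensor k m p \<Phi> (one_tensor k m ?L)"
    by (simp add: ptrace_left_id_tensor[OF cptpD(1)[OF \<Phi>]] id_tensor_one_tensor[OF cptpD(1)[OF \<Phi>]])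
  have "relative_entropy (id_tensor k m p \<Phi> A) (id_tensor k m p \<Phi> (one_tensor k m ?L))
      \<le> relative_entropy A (one_tensor k m ?L)"
    using dominated_one_tensor[OF B] unfolding eq
    by (intro data_processing[OF cptp_id_tensor[OF \<Phi>] A psd_one_tensor[OF L] dominated_one_tensor[OF A]])
  then show ?thesis
    using relative_entropy_one_tensor[OF B] relative_entropy_one_tensor[OF A] unfolding eq by simp
qed

text \<open>Conditional entropy is homogeneous of degree one, so this is its concavity.\<close>

theorem cond_entropy_superadditive:
  assumes A: "psd (k * m) A" and B: "psd (k * m) B"
  shows "cond_entropy k m A + cond_entropy k m B \<le> cond_entropy k m (A + B)"
proof -
  note c = psd_carrier[OF A] psd_carrier[OF B]
  have pt: "ptrace_left k m (A + B) = ptrace_left k m A + ptrace_left k m B"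
    using c by (intro eq_matI) (auto simp: ptrace_left_def product_index_less sum.distrib)
  have "one_tensor k m (ptrace_left k m A + ptrace_left k m B) =
      one_tensor k m (ptrace_left k m A) + one_tensor k m (ptrace_left k m B)"
    by (rule mat_eq_blockI)
      (auto simp: one_tensor_index product_index_less ptrace_left_def one_tensor_def)
  then have eq: "one_tensor k m (ptrace_left k m (A + B)) =
      one_tensor k m (ptrace_left k m A) + one_tensor k m (ptrace_left k m B)" by (simp add: pt)
  have "relative_entropy (A + B) (one_tensor k m (ptrace_left k m (A + B)))
    \<le> relative_entropy A (one_tensor k m (ptrace_left k m A)) + relative_entropy B (one_tensor k m (ptrace_left k m B))"
    unfolding eq
    by (intro relative_entropy_subadditive[of "k * m"] A B psd_one_tensor psd_ptrace_left dominated_one_tensor)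
  then show ?thesis
    using relative_entropy_one_tensor[OF A] relative_entropy_one_tensor[OF B]
      relative_entropy_one_tensor[OF psd_add[OF A B]] by simp
qed

section \<open>Entropy inequalities\<close>

lemma ln_entropy_eq:
  "diagonalizes n U e A \<Longrightarrow> ln_entropy A = - (\<Sum>i<n. e i * ln (e i))"
  by (simp add: ln_entropy_def trace_mult_mat_fun_self)

lemma vn_entropy_eq:
  assumes "hermitian n A"
  shows "vn_entropy b A = ln_entropy A / ln b"
proof -
  obtain U e where U: "diagonalizes n U e A" using hermitian_diagonalizable[OF assms] by auto
  show ?thesis unfolding vn_entropy_def trace_mult_mat_fun_self[OF U] ln_entropy_eq[OF U]
    by (simp add: log_def sum_divide_distrib)
qed

text \<open>The trace of (A + P) ln (A + P) splits into two terms, and replacing the logarithm by ln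
  A, respectively ln P, does not increase them.\<close>

lemma ln_entropy_subadditive:
  assumes A: "psd n A" and P: "psd n P"
  shows "ln_entropy (A + P) \<le> ln_entropy A + ln_entropy P"
proof -
  note c = psd_carrier[OF A] psd_carrier[OF P]
  have h: "hermitian n (A + P)" by (intro psd_hermitian psd_add A P)
  obtain U e where U: "diagonalizes n U e (A + P)" using hermitian_diagonalizable[OF h] by auto
  let ?L = "mat_fun ln (A + P)"
  have L: "?L \<in> carrier_mat n n" by (rule diagonalizesD(3)[OF diagonalizes_mat_fun[OF U]])
  have comm: "P + A = A + P" using c by (intro comm_add_mat) auto
  have "mat_trace ((A + P) * ?L) = mat_trace (A * ?L) + mat_trace (P * ?L)"
    unfolding add_mult_distrib_mat[OF c L] using c L by (intro trace_add[of _ n]) auto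
  then show ?thesis
    using relative_entropy_add_right[OF A P] relative_entropy_add_right[OF P A] unfolding comm
    by (simp add: relative_entropy_def ln_entropy_def)
qed

lemma psd_trace_zero:
  assumes A: "psd n A" and tr: "Re (mat_trace A) = 0"
  shows "A = 0\<^sub>m n n"
proof -
  obtain U e where U: "diagonalizes n U e A" using hermitian_diagonalizable[OF psd_hermitian[OF A]] by auto
  have "(\<Sum>i<n. e i) = 0" using tr by (simp add: trace_diagonalizes[OF U])
  then have "\<forall>i\<in>{..<n}. e i = 0"
    using psd_eigenvalue_nonneg[OF U A] by (subst (asm) sum_nonneg_eq_0_iff) auto
  then have "real_diag n e = 0\<^sub>m n n" by (intro eq_matI) (auto simp: real_diag_index)
  then show ?thesis using diagonalizesD[OF U] by (metis adjoint_carrier left_mult_zero_mat right_mult_zero_mat)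
qed

lemma diagonalizes_real_diag: "diagonalizes n (1\<^sub>m n) e (real_diag n e)"
proof -
  have "1\<^sub>m n * real_diag n e * mat_adjoint (1\<^sub>m n) = real_diag n e"
    by (simp add: right_mult_one_mat[OF real_diag_carrier] left_mult_one_mat[OF real_diag_carrier])
  then show ?thesis by (simp add: diagonalizes_def unitary_def)
qed

lemma relative_entropy_scalar:
  assumes A: "psd n A"
  shows "relative_entropy A (real_diag n (\<lambda>_. c)) = - ln_entropy A - Re (mat_trace A) * ln c"
proof -
  obtain U e where U: "diagonalizes n U e A" using hermitian_diagonalizable[OF psd_hermitian[OF A]] by auto
  have "(\<Sum>i<n. \<Sum>j<n. overlap U (1\<^sub>m n) i j * (e i * ln c)) = (\<Sum>i<n. e i) * ln c"
    using overlap_row_sum[OF diagonalizesD(1)[OF U] diagonalizesD(1)[OF diagonalizes_real_diag]]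
    by (simp add: sum_distrib_right[symmetric])
  then show ?thesis
    unfolding relative_entropy_def trace_mult_mat_fun[OF U diagonalizes_real_diag]
    by (simp add: ln_entropy_def trace_diagonalizes[OF U])
qed

text \<open>Only trace 0 needs care: the scalar matrix is then 0, but so is A by positivity.\<close>

lemma dominated_scalar:
  assumes A: "psd n A"
  shows "dominated n A (real_diag n (\<lambda>_. Re (mat_trace A)))"
proof (cases "Re (mat_trace A) = 0")
  case True
  then have "A = 0\<^sub>m n n" by (rule psd_trace_zero[OF A])
  then show ?thesis by (simp add: dominated_def quad_def)
next
  case False
  let ?c = "Re (mat_trace A)"
  show ?thesis unfolding dominated_def
  proof (intro allI impI)
    fix f assume "quad n (real_diag n (\<lambda>_. ?c)) f = 0"
    moreover have "quad n (real_diag n (\<lambda>_. ?c)) f = (\<Sum>i<n. \<Sum>j<n. if j = i then of_real (?c * (cmod (f i))\<^sup>2) else 0)"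
      unfolding quad_def
      by (intro sum.cong refl) (auto simp: real_diag_index complex_norm_square mult_ac simp del: of_real_power)
    ultimately have "of_real (?c * (\<Sum>i<n. (cmod (f i))\<^sup>2)) = (0 :: complex)"
      by (simp add: sum_distrib_left)
    then have "(\<Sum>i<n. (cmod (f i))\<^sup>2) = 0" using False by (metis mult_eq_0_iff of_real_eq_0_iff)
    then have "\<forall>i\<in>{..<n}. (cmod (f i))\<^sup>2 = 0" by (subst (asm) sum_nonneg_eq_0_iff) auto
    then show "quad n A f = 0" by (auto simp: quad_def intro!: sum.neutral)
  qed
qed

text \<open>Concavity of entropy without normalization: for u > 0 the quantity
  \<open>ln_entropy A + u * ln u\<close> is u times the entropy of A / u. It is the negative of the
  relative entropy of A to u times the identity, and these reference matrices add up
  correctly.\<close>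

lemma ln_entropy_superadditive:
  assumes A: "psd n A" and B: "psd n B"
  defines "u \<equiv> Re (mat_trace A)" and "v \<equiv> Re (mat_trace B)"
  shows "ln_entropy A + u * ln u + (ln_entropy B + v * ln v) \<le> ln_entropy (A + B) + (u + v) * ln (u + v)"
proof -
  have uv: "0 \<le> u" "0 \<le> v" using psd_trace[OF A] psd_trace[OF B] by (auto simp: u_def v_def less_eq_complex_def)
  have sum: "real_diag n (\<lambda>_. u) + real_diag n (\<lambda>_. v) = real_diag n (\<lambda>_. u + v)"
    by (intro eq_matI) (auto simp: real_diag_index)
  have "relative_entropy (A + B) (real_diag n (\<lambda>_. u) + real_diag n (\<lambda>_. v)) \<le>
      relative_entropy A (real_diag n (\<lambda>_. u)) + relative_entropy B (real_diag n (\<lambda>_. v))"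
    using uv dominated_scalar[OF A] dominated_scalar[OF B]
    by (intro relative_entropy_subadditive[of n] A B psd_real_diag) (auto simp: u_def v_def)
  moreover have "Re (mat_trace (A + B)) = u + v"
    using trace_add[OF psd_carrier[OF A] psd_carrier[OF B]] by (simp add: u_def v_def)
  ultimately show ?thesis
    unfolding sum relative_entropy_scalar[OF A] relative_entropy_scalar[OF B] relative_entropy_scalar[OF psd_add[OF A B]]
    by (simp add: u_def v_def)
qed

text \<open>From ln z <= z - 1 at z = y / x; the case x = 0 relies on 0 ln 0 = 0.\<close>

lemma klein_scalar:
  fixes x y :: real
  assumes "0 \<le> x" "0 < y"
  shows "x - y \<le> x * ln x - x * ln y"
proof (cases "x = 0")
  case False
  then have x: "x > 0" using assms by simp
  have "ln (y / x) \<le> y / x - 1" using x assms by (intro ln_le_minus_one) simp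
  then have "x * ln (y / x) \<le> x * (y / x - 1)" using x by (intro mult_left_mono) auto
  then show ?thesis using x assms by (simp add: ln_div algebra_simps)
qed (use assms in simp)

text \<open>For t > 0 this says that the entropy of A / t lies between 0 and ln n. Below, every
  eigenvalue is at most t; above, Klein's inequality is applied against the uniform value t /
  n.\<close>

lemma ln_entropy_bounds:
  assumes A: "psd n A"
  defines "t \<equiv> Re (mat_trace A)"
  shows "- t * ln t \<le> ln_entropy A" "ln_entropy A \<le> - t * ln t + t * ln (real n)"
proof -
  obtain U e where U: "diagonalizes n U e A" using hermitian_diagonalizable[OF psd_hermitian[OF A]] by auto
  note e = psd_eigenvalue_nonneg[OF U A]
  have t: "t = (\<Sum>i<n. e i)" by (simp add: t_def trace_diagonalizes[OF U])
  have "(\<Sum>i<n. e i * ln (e i)) \<le> (\<Sum>i<n. e i * ln t)"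
  proof (rule sum_mono)
    fix i assume i: "i \<in> {..<n}"
    then have "e i \<le> t" unfolding t using e by (intro member_le_sum) auto
    then show "e i * ln (e i) \<le> e i * ln t"
      using e[of i] i by (cases "e i = 0") (auto intro!: mult_left_mono)
  qed
  then show "- t * ln t \<le> ln_entropy A"
    unfolding ln_entropy_eq[OF U] by (simp add: t sum_distrib_right)
  show "ln_entropy A \<le> - t * ln t + t * ln (real n)"
  proof (cases "t = 0")
    case True
    then have "\<forall>i\<in>{..<n}. e i = 0" unfolding t using e by (subst (asm) sum_nonneg_eq_0_iff) auto
    then show ?thesis unfolding ln_entropy_eq[OF U] using True by simp
  next
    case False
    then have tp: "t > 0" using e unfolding t by (metis lessThan_iff order_le_less sum_nonneg)
    then have n: "n > 0" unfolding t by (cases n) auto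
    let ?y = "t / real n"
    have "(\<Sum>i<n. e i - ?y) \<le> (\<Sum>i<n. e i * ln (e i) - e i * ln ?y)"
      using e tp n by (intro sum_mono klein_scalar) auto
    then have "0 \<le> (\<Sum>i<n. e i * ln (e i)) - t * ln ?y"
      using n by (simp add: sum_subtractf t sum_distrib_right)
    then show ?thesis unfolding ln_entropy_eq[OF U] using tp n by (simp add: ln_div algebra_simps)
  qed
qed

section \<open>Continuity of the conditional entropy\<close>

lemma trace_norm_hermitian:
  assumes U: "diagonalizes n U e A"
  shows "trace_norm A = (\<Sum>i<n. \<bar>e i\<bar>)"
proof -
  note U' = diagonalizesD[OF U]
  have sq: "real_diag n e * real_diag n e = real_diag n (\<lambda>i. (e i)\<^sup>2)"
  proof (rule eq_matI)
    fix i j assume "i < dim_row (real_diag n (\<lambda>i. (e i)\<^sup>2))" "j < dim_col (real_diag n (\<lambda>i. (e i)\<^sup>2))"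
    then show "(real_diag n e * real_diag n e) $$ (i, j) = real_diag n (\<lambda>i. (e i)\<^sup>2) $$ (i, j)"
      by (auto simp: mult_real_diag_index[OF real_diag_carrier] real_diag_index power2_eq_square simp del: index_mult_mat(1))
  qed auto
  have "mat_adjoint A * A = U * (real_diag n e * real_diag n e) * mat_adjoint U"
    unfolding hermitianD(2)[OF U'(4)] unfolding U'(2) using U'(5-) unitary_cancel[OF U'(1)]
    by (simp add: mult_assoc_dim)
  then have S: "diagonalizes n U (\<lambda>i. (e i)\<^sup>2) (mat_adjoint A * A)"
    using U'(1) by (simp add: diagonalizes_def sq)
  show ?thesis unfolding trace_norm_def trace_diagonalizes[OF diagonalizes_mat_fun[OF S]] by simp
qed

text \<open>P and N take the positive and negative parts of the eigenvalues. Trace 0 makes their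
  traces equal, and these add up to the trace norm.\<close>

lemma jordan_decomposition:
  assumes D: "hermitian n D" and tr: "mat_trace D = 0"
  obtains P N where "psd n P" "psd n N" "D = P - N"
    "Re (mat_trace P) = trace_norm D / 2" "Re (mat_trace N) = trace_norm D / 2"
proof -
  obtain U e where U: "diagonalizes n U e D" using hermitian_diagonalizable[OF D] by auto
  note U' = diagonalizesD[OF U]
  define p where "p i = max (e i) 0" for i
  define q where "q i = max (- e i) 0" for i
  define P where "P = U * real_diag n p * mat_adjoint U"
  define N where "N = U * real_diag n q * mat_adjoint U"
  have P: "diagonalizes n U p P" and N: "diagonalizes n U q N"
    using U'(1) by (auto simp: diagonalizes_def P_def N_def)
  have part: "(\<Sum>i<n. e i) = (\<Sum>i<n. p i) - (\<Sum>i<n. q i)"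
    unfolding sum_subtractf[symmetric] by (intro sum.cong refl) (simp add: p_def q_def max_def)
  have diff: "real_diag n e = real_diag n p - real_diag n q"
    by (intro eq_matI) (auto simp: real_diag_index p_def q_def max_def)
  have "D = P - N"
    unfolding U'(2) P_def N_def diff mult_minus_distrib_mat[OF U'(5) real_diag_carrier real_diag_carrier]
    using U'(5) by (intro minus_mult_distrib_mat[of _ n n]) auto
  moreover have "psd n P" "psd n N"
    by (auto intro!: psd_diagonalizes[OF P] psd_diagonalizes[OF N] simp: p_def q_def)
  moreover have "(\<Sum>i<n. e i) = 0" using tr unfolding trace_diagonalizes[OF U] by (metis of_real_eq_0_iff)
  then have "(\<Sum>i<n. p i) = (\<Sum>i<n. q i)"
    by (simp add: part)
  moreover have "trace_norm D = (\<Sum>i<n. p i) + (\<Sum>i<n. q i)"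
    unfolding trace_norm_hermitian[OF U] sum.distrib[symmetric]
    by (intro sum.cong refl) (auto simp: p_def q_def max_def)
  ultimately show thesis
    by (intro that[of P N]) (auto simp: trace_diagonalizes[OF P] trace_diagonalizes[OF N])
qed

(* With A - B = P - N, both A and B are completed to the same matrix A + N = B + P, as in the proof
   of the Alicki-Fannes-Winter bound.  The matrices are not normalized, so t = 0 needs no case. *)
lemma cond_entropy_trace_norm_bound:
  assumes A: "density (k * m) A" and B: "density (k * m) B"
  defines "t \<equiv> trace_norm (A - B) / 2"
  shows "0 \<le> t"
    "cond_entropy k m B \<le> cond_entropy k m A + t * (ln (real (k * m)) + ln (real m)) + (1 + t) * ln (1 + t) - t * ln t"
proof -
  have pA: "psd (k * m) A" "mat_trace A = 1" and pB: "psd (k * m) B" "mat_trace B = 1"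
    using A B by (auto simp: density_def)
  note c = psd_carrier[OF pA(1)] psd_carrier[OF pB(1)]
  have "mat_trace (A - B) = 0" using trace_minus[OF c] pA pB by simp
  then obtain P N where P: "psd (k * m) P" and N: "psd (k * m) N" and D: "A - B = P - N"
    and tP: "Re (mat_trace P) = t" and tN: "Re (mat_trace N) = t"
    unfolding t_def using jordan_decomposition[OF hermitian_minus[OF pA(1)[THEN psd_hermitian] pB(1)[THEN psd_hermitian]]] by metis
  note cPN = psd_carrier[OF P] psd_carrier[OF N]
  show t0: "0 \<le> t" using psd_trace[OF P] tP by (simp add: less_eq_complex_def)
  have eq: "B + P = A + N"
  proof (rule eq_matI)
    fix i j assume "i < dim_row (A + N)" "j < dim_col (A + N)"
    then have ij: "i < k * m" "j < k * m" using cPN by auto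
    have "(A - B) $$ (i, j) = (P - N) $$ (i, j)" using D by simp
    then show "(B + P) $$ (i, j) = (A + N) $$ (i, j)" using ij c cPN by (simp add: algebra_simps)
  qed (use c cPN in auto)
  have pt: "ptrace_left k m (A + N) = ptrace_left k m A + ptrace_left k m N"
    using c cPN by (intro eq_matI) (auto simp: ptrace_left_def product_index_less sum.distrib)
  have "cond_entropy k m B + cond_entropy k m P \<le> cond_entropy k m (A + N)"
    using cond_entropy_superadditive[OF pB(1) P] by (simp add: eq)
  also have "cond_entropy k m (A + N) = ln_entropy (A + N) - ln_entropy (ptrace_left k m A + ptrace_left k m N)"
    by (simp add: cond_entropy_def pt)
  finally have "cond_entropy k m B + cond_entropy k m P \<le> ln_entropy (A + N) - ln_entropy (ptrace_left k m A + ptrace_left k m N)" .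
  \<comment> \<open>The joint entropy is bounded above by subadditivity, that of the marginal below
    by concavity; the traces 1 and t in the latter produce the terms (1 + t) ln (1 + t) and t ln
    t.\<close>
  moreover have "ln_entropy (A + N) \<le> ln_entropy A + ln_entropy N"
    by (rule ln_entropy_subadditive[OF pA(1) N])
  moreover have "ln_entropy (ptrace_left k m A) + (ln_entropy (ptrace_left k m N) + t * ln t)
      \<le> ln_entropy (ptrace_left k m A + ptrace_left k m N) + (1 + t) * ln (1 + t)"
    using ln_entropy_superadditive[OF psd_ptrace_left[OF pA(1)] psd_ptrace_left[OF N]]
    by (simp add: trace_ptrace_left[OF c(1)] trace_ptrace_left[OF cPN(2)] pA tN)
  \<comment> \<open>In the four bounds on N, P and their partial traces the terms t ln t cancel.
    What remains is t ln (k m) from N and t ln m from the partial trace of P, together 3 t ln d for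
    k = m = d.\<close>
  moreover have "ln_entropy N \<le> - t * ln t + t * ln (real (k * m))"
    using ln_entropy_bounds(2)[OF N] by (simp add: tN)
  moreover have "- t * ln t \<le> ln_entropy P"
    using ln_entropy_bounds(1)[OF P] by (simp add: tP)
  moreover have "- t * ln t \<le> ln_entropy (ptrace_left k m N)"
    using ln_entropy_bounds(1)[OF psd_ptrace_left[OF N]] by (simp add: trace_ptrace_left[OF cPN(2)] tN)
  moreover have "ln_entropy (ptrace_left k m P) \<le> - t * ln t + t * ln (real m)"
    using ln_entropy_bounds(2)[OF psd_ptrace_left[OF P]] by (simp add: trace_ptrace_left[OF cPN(1)] tP)
  ultimately show "cond_entropy k m B \<le> cond_entropy k m A + t * (ln (real (k * m)) + ln (real m)) + (1 + t) * ln (1 + t) - t * ln t"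
    by (simp add: cond_entropy_def algebra_simps)
qed

lemma ln_4: "ln 4 = 2 * ln (2 :: real)"
  using ln_realpow[of "2 :: real" 2] by simp

lemma half_le_ln_2: "1 / 2 \<le> ln (2 :: real)"
proof -
  have "exp (1 :: real) \<le> 4" using exp_le by simp
  then have "ln (exp (1 :: real)) \<le> ln 4" by (intro ln_mono) auto
  then show ?thesis by (simp add: ln_4)
qed

text \<open>Used with x = \<epsilon> / 2, l = ln d and t half the trace norm; the right-hand side is
  then 4 \<epsilon> ln d - 4 \<epsilon> ln (2 \<epsilon>).\<close>

lemma continuity_modulus_bound:
  fixes t x l :: real
  assumes t: "0 \<le> t" "t \<le> x" and x: "x \<le> 1 / 4" and l: "ln 2 \<le> l"
  shows "3 * t * l + (1 + t) * ln (1 + t) - t * ln t \<le> 8 * x * l - 8 * x * ln (4 * x)"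
proof (cases "x = 0")
  case False
  then have xp: "x > 0" using t by simp
  have lx: "ln x \<le> - 2 * ln 2"
  proof -
    have "ln x \<le> ln (1 / 4)" using xp x by (intro ln_mono) auto
    then show ?thesis by (simp add: ln_div ln_4)
  qed
  have "(1 + t) * ln (1 + t) \<le> (1 + t) * t" using t ln_add_one_self_le_self[of t] by (intro mult_left_mono) auto
  then have "(1 + t) * ln (1 + t) \<le> t + t * t" by (simp only: distrib_right mult_1)
  \<comment> \<open>This bounds - t ln t by x - t - t ln x, and the summand - t cancels the linear
    term of the preceding bound t + t * t.\<close>
  moreover have "t - x \<le> t * ln t - t * ln x" by (rule klein_scalar[OF t(1) xp])
  moreover have "- (t * ln x) \<le> - (x * ln x)" using t lx half_le_ln_2 by (simp add: mult_right_mono_neg)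
  moreover have "t * t \<le> x * x" using t by (intro mult_mono) auto
  ultimately have "(1 + t) * ln (1 + t) - t * ln t \<le> x * x + - (x * ln x) + x"
    by linarith
  moreover have "3 * t * l \<le> 3 * x * l" using t l half_le_ln_2 by (intro mult_right_mono) auto
  moreover have "x * x + - (x * ln x) + x + 3 * x * l \<le> 8 * x * l - 8 * x * ln (4 * x)"
  proof -
    have "ln (4 * x) = 2 * ln 2 + ln x" using xp by (simp add: ln_mult ln_4)
    then have "8 * x * l - 8 * x * ln (4 * x) - (x * x + - (x * ln x) + x + 3 * x * l) =
       x * (5 * l - 16 * ln 2 - 7 * ln x - x - 1)" by (simp add: algebra_simps)
    \<comment> \<open>Since l >= ln 2 and ln x <= - 2 ln 2, the second factor is at least 3 ln 2 - x
      - 1, which is at least 3/2 - 1/4 - 1 > 0.\<close>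
    also have "0 \<le> \<dots>" using xp lx l x half_le_ln_2 by (intro mult_nonneg_nonneg) auto
    finally show ?thesis by simp
  qed
  ultimately show ?thesis by linarith
qed (use t in simp)

lemma binary_entropy_lower_bound:
  fixes p :: real
  assumes "0 \<le> p" "p \<le> 1"
  shows "0 \<le> - p * ln p" "- p * ln p \<le> - p * ln p - (1 - p) * ln (1 - p)"
proof -
  have "x * ln x \<le> 0" if "0 \<le> x" "x \<le> 1" for x :: real
    using that by (cases "x = 0") (auto intro: mult_nonneg_nonpos)
  from this[of p] this[of "1 - p"] assms
  show "0 \<le> - p * ln p" "- p * ln p \<le> - p * ln p - (1 - p) * ln (1 - p)" by auto
qed

text \<open>The binary entropy at 2 \<epsilon> is at least - 2 \<epsilon> ln (2 \<epsilon>), so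
  \<open>continuity_modulus_bound\<close> gives the claim.\<close>

theorem cond_entropy_continuity:
  assumes A: "density (d * d) A" and B: "density (d * d) B" and d: "d > 0"
    and \<epsilon>: "trace_norm (A - B) \<le> \<epsilon>" "\<epsilon> \<le> 1 / 2"
  shows "cond_entropy d d B \<le> cond_entropy d d A + (4 * \<epsilon> * ln (real d)
    + 2 * (- (2 * \<epsilon>) * ln (2 * \<epsilon>) - (1 - 2 * \<epsilon>) * ln (1 - 2 * \<epsilon>)))"
proof -
  define t where "t = trace_norm (A - B) / 2"
  have t: "0 \<le> t" and bound: "cond_entropy d d B \<le> cond_entropy d d A + t * (ln (real (d * d)) + ln (real d))
      + (1 + t) * ln (1 + t) - t * ln t"
    using cond_entropy_trace_norm_bound[OF A B] by (auto simp: t_def)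
  have tx: "t \<le> \<epsilon> / 2" using \<epsilon> by (simp add: t_def)
  have h: "0 \<le> - (2 * \<epsilon>) * ln (2 * \<epsilon>)"
    "- (2 * \<epsilon>) * ln (2 * \<epsilon>) \<le> - (2 * \<epsilon>) * ln (2 * \<epsilon>) - (1 - 2 * \<epsilon>) * ln (1 - 2 * \<epsilon>)"
    using binary_entropy_lower_bound[of "2 * \<epsilon>"] t tx \<epsilon> by auto
  show ?thesis
  proof (cases "d = 1")
    \<comment> \<open>The modulus bound requires ln d >= ln 2. In dimension one all states have
      entropy 0, and the error term is nonnegative.\<close>
    case True
    have ent: "ln_entropy X = 0" if "psd 1 X" "mat_trace X = 1" for X
      using ln_entropy_bounds[OF that(1)] that(2) by simp
    have "cond_entropy d d X = 0" if "density (d * d) X" for X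
      using that ent[of X] ent[of "ptrace_left 1 1 X"] psd_ptrace_left[of 1 1 X] trace_ptrace_left[of X 1 1] True
      by (auto simp: density_def cond_entropy_def dest: psd_carrier)
    then show ?thesis using A B h True by simp
  next
    case False
    then have "ln 2 \<le> ln (real d)" using d by (intro ln_mono) auto
    then have "3 * t * ln (real d) + (1 + t) * ln (1 + t) - t * ln t \<le> 8 * (\<epsilon> / 2) * ln (real d) - 8 * (\<epsilon> / 2) * ln (4 * (\<epsilon> / 2))"
      using t tx \<epsilon> by (intro continuity_modulus_bound) auto
    moreover have "ln (real (d * d)) = 2 * ln (real d)" using d by (simp add: ln_mult)
    ultimately show ?thesis using bound h by (simp add: algebra_simps)
  qed
qed

section \<open>Minimizers of the free energy\<close>

lemma mat_fun_ident:
  assumes "hermitian n A"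
  shows "mat_fun (\<lambda>x. x) A = A"
proof -
  obtain U e where U: "diagonalizes n U e A" using hermitian_diagonalizable[OF assms] by auto
  show ?thesis unfolding mat_fun_eq[OF U] by (rule diagonalizesD(2)[OF U, symmetric])
qed

lemma trace_mult_diagonalizes:
  assumes A: "diagonalizes n U e A" and B: "diagonalizes n V g B"
  shows "Re (mat_trace (A * B)) = (\<Sum>i<n. \<Sum>j<n. overlap U V i j * (e i * g j))"
  using trace_mult_mat_fun[OF A B, of "\<lambda>x. x"] by (simp add: mat_fun_ident[OF diagonalizesD(4)[OF B]])

text \<open>Klein's scalar inequality, averaged with the doubly stochastic weights
  \<open>overlap\<close>; the linear terms sum to the difference of the traces, which is 0.\<close>

lemma relative_entropy_nonneg:
  assumes A: "psd n A" and B: "diagonalizes n V g B" "\<And>j. j < n \<Longrightarrow> g j > 0"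
    and tr: "mat_trace A = mat_trace B"
  shows "0 \<le> relative_entropy A B"
proof -
  obtain U e where U: "diagonalizes n U e A" using hermitian_diagonalizable[OF psd_hermitian[OF A]] by auto
  note UV = diagonalizesD(1)[OF U] diagonalizesD(1)[OF B(1)]
  have rows: "(\<Sum>i<n. \<Sum>j<n. overlap U V i j * c i) = (\<Sum>i<n. c i)" for c
    using overlap_row_sum[OF UV] by (simp add: sum_distrib_right[symmetric])
  have cols: "(\<Sum>i<n. \<Sum>j<n. overlap U V i j * c j) = (\<Sum>j<n. c j)" for c
    by (subst sum.swap) (use overlap_col_sum[OF UV] in \<open>simp add: sum_distrib_right[symmetric]\<close>)
  have "(\<Sum>i<n. e i) = (\<Sum>j<n. g j)"
    using tr unfolding trace_diagonalizes[OF U] trace_diagonalizes[OF B(1)] of_real_eq_iff .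
  then have "0 = (\<Sum>i<n. \<Sum>j<n. overlap U V i j * e i) - (\<Sum>i<n. \<Sum>j<n. overlap U V i j * g j)"
    by (simp add: rows cols)
  also have "\<dots> = (\<Sum>i<n. \<Sum>j<n. overlap U V i j * (e i - g j))"
    by (simp add: sum_subtractf right_diff_distrib)
  also have "\<dots> \<le> (\<Sum>i<n. \<Sum>j<n. overlap U V i j * (e i * ln (e i) - e i * ln (g j)))"
    using B(2) psd_eigenvalue_nonneg[OF U A] by (intro sum_mono mult_left_mono klein_scalar) auto
  also have "\<dots> = (\<Sum>i<n. \<Sum>j<n. overlap U V i j * (e i * ln (e i))) - (\<Sum>i<n. \<Sum>j<n. overlap U V i j * (e i * ln (g j)))"
    by (simp add: sum_subtractf right_diff_distrib)
  also have "\<dots> = relative_entropy A B"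
    unfolding relative_entropy_def trace_mult_mat_fun_self[OF U] trace_mult_mat_fun[OF U B(1)] rows by simp
  finally show ?thesis .
qed

lemma density_diagonalizes:
  assumes "diagonalizes n U e A" "\<And>i. i < n \<Longrightarrow> 0 \<le> e i" "(\<Sum>i<n. e i) = 1"
  shows "density n A"
  using assms psd_diagonalizes[OF assms(1,2)] by (simp add: density_def trace_diagonalizes[OF assms(1)])

text \<open>The minimizer is the projector onto an eigenvector of the lowest eigenvalue
  \<open>h k\<close>: the energy of any state is a convex combination of the eigenvalues of
  H.\<close>

lemma ground_state_minimizes:
  assumes H: "hermitian n H" and n: "n > 0"
  shows "\<exists>\<sigma>. is_arg_min (free_energy b 0 H) (density n) \<sigma>"
proof -
  obtain U h where U: "diagonalizes n U h H" using hermitian_diagonalizable[OF H] by auto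
  note U' = diagonalizesD[OF U]
  obtain k where k: "k < n" "\<And>j. j < n \<Longrightarrow> h k \<le> h j"
    using arg_min_if_finite(1)[of "{..<n}" h] arg_min_least[of "{..<n}" _ h] n
    by (metis empty_iff finite_lessThan lessThan_iff)
  define e where "e i = (if i = k then 1 else 0 :: real)" for i
  let ?S = "U * real_diag n e * mat_adjoint U"
  have S: "diagonalizes n U e ?S" using U'(1) by (simp add: diagonalizes_def)
  have dens: "density n ?S" using k(1) by (intro density_diagonalizes[OF S]) (auto simp: e_def)
  have "Re (mat_trace (?S * H)) = (\<Sum>i<n. \<Sum>j<n. overlap U U i j * (e i * h j))"
    by (rule trace_mult_diagonalizes[OF S U])
  also have "\<dots> = (\<Sum>i<n. if i = k then (\<Sum>j<n. if j = k then h k else 0) else 0)"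
  proof (intro sum.cong refl)
    fix i assume "i \<in> {..<n}"
    show "(\<Sum>j<n. overlap U U i j * (e i * h j)) = (if i = k then (\<Sum>j<n. if j = k then h k else 0) else 0)"
    proof (cases "i = k")
      case True
      show ?thesis unfolding True if_P[OF refl]
        using k(1) by (intro sum.cong refl) (auto simp: e_def overlap_self[OF U'(1)])
    qed (simp add: e_def)
  qed
  finally have val: "Re (mat_trace (?S * H)) = h k" using k by simp
  have "h k \<le> Re (mat_trace (A * H))" if A: "density n A" for A
  proof -
    have pA: "psd n A" "mat_trace A = 1" using A by (auto simp: density_def)
    obtain V g where V: "diagonalizes n V g A" using hermitian_diagonalizable[OF psd_hermitian[OF pA(1)]] by auto
    have "(\<Sum>i<n. g i) = 1" using pA(2) unfolding trace_diagonalizes[OF V] of_real_eq_1_iff .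
    then have "h k = (\<Sum>i<n. g i) * h k" by simp
    also have "\<dots> = (\<Sum>i<n. \<Sum>j<n. overlap V U i j * (g i * h k))"
      using overlap_row_sum[OF diagonalizesD(1)[OF V] U'(1)] by (simp flip: sum_distrib_right)
    also have "\<dots> \<le> (\<Sum>i<n. \<Sum>j<n. overlap V U i j * (g i * h j))"
      using k psd_eigenvalue_nonneg[OF V pA(1)] by (intro sum_mono mult_left_mono) auto
    also have "\<dots> = Re (mat_trace (A * H))" by (rule trace_mult_diagonalizes[OF V U, symmetric])
    finally show ?thesis .
  qed
  then show ?thesis using dens val
    by (intro exI[of _ ?S]) (auto simp: is_arg_min_def free_energy_def not_less)
qed

text \<open>The Gibbs variational principle: as ln G = - \<beta> H - ln Z, the free energy of a
  state equals its relative entropy to G divided by \<beta>, up to an additive constant.\<close>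

lemma gibbs_state_minimizes:
  assumes H: "hermitian n H" and n: "n > 0" and T: "T > 0" and b: "b > 1"
  shows "\<exists>\<sigma>. is_arg_min (free_energy b T H) (density n) \<sigma>"
proof -
  obtain U h where U: "diagonalizes n U h H" using hermitian_diagonalizable[OF H] by auto
  note U' = diagonalizesD[OF U]
  \<comment> \<open>The inverse temperature; the factor ln b accounts for entropies measured to base
    b.\<close>
  define \<beta> where "\<beta> = ln b / T"
  have \<beta>: "\<beta> > 0" using b T by (simp add: \<beta>_def)
  define Z where "Z = (\<Sum>i<n. exp (- \<beta> * h i))"
  have Z: "Z > 0" unfolding Z_def using n by (intro sum_pos) auto
  define p where "p i = exp (- \<beta> * h i) / Z" for i
  have p: "p i > 0" for i using Z by (simp add: p_def)
  have lnp: "ln (p i) = - \<beta> * h i - ln Z" for i using Z by (simp add: p_def ln_div)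
  let ?G = "U * real_diag n p * mat_adjoint U"
  have G: "diagonalizes n U p ?G" using U'(1) by (simp add: diagonalizes_def)
  have dens: "density n ?G"
  proof (intro density_diagonalizes[OF G])
    show "(\<Sum>i<n. p i) = 1" using Z by (simp add: p_def Z_def flip: sum_divide_distrib)
  qed (use p in \<open>simp add: less_imp_le\<close>)
  have F: "free_energy b T H A = (relative_entropy A ?G - ln Z) / \<beta>" if A: "density n A" for A
  proof -
    have pA: "psd n A" "mat_trace A = 1" using A by (auto simp: density_def)
    obtain V g where V: "diagonalizes n V g A" using hermitian_diagonalizable[OF psd_hermitian[OF pA(1)]] by auto
    have sum: "(\<Sum>i<n. g i) = 1" using pA(2) unfolding trace_diagonalizes[OF V] of_real_eq_1_iff .
    have "(\<Sum>i<n. \<Sum>j<n. overlap V U i j * (g i * ln (p j))) =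
      (\<Sum>i<n. \<Sum>j<n. - \<beta> * (overlap V U i j * (g i * h j)) - overlap V U i j * (g i * ln Z))"
      by (intro sum.cong refl) (simp add: lnp algebra_simps)
    also have "\<dots> = - \<beta> * (\<Sum>i<n. \<Sum>j<n. overlap V U i j * (g i * h j)) - (\<Sum>i<n. \<Sum>j<n. overlap V U i j * (g i * ln Z))"
      by (simp add: sum_subtractf sum_distrib_left sum_negf)
    also have "(\<Sum>i<n. \<Sum>j<n. overlap V U i j * (g i * ln Z)) = ln Z"
      using overlap_row_sum[OF diagonalizesD(1)[OF V] U'(1)] sum by (simp flip: sum_distrib_right)
    finally have "relative_entropy A ?G = - ln_entropy A + \<beta> * Re (mat_trace (A * H)) + ln Z"
      unfolding relative_entropy_def trace_mult_mat_fun[OF V G] trace_mult_diagonalizes[OF V U, symmetric]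
      by (simp add: ln_entropy_def)
    moreover have "T * vn_entropy b A = ln_entropy A / \<beta>"
      unfolding vn_entropy_eq[OF psd_hermitian[OF pA(1)]] \<beta>_def by simp
    ultimately show ?thesis unfolding free_energy_def using \<beta> by (simp add: field_simps)
  qed
  have "free_energy b T H ?G \<le> free_energy b T H A" if A: "density n A" for A
    unfolding F[OF A] F[OF dens]
    using relative_entropy_nonneg[of n A, OF _ G p] A dens \<beta> by (simp add: density_def diff_divide_distrib)
  then show ?thesis using dens by (intro exI[of _ ?G]) (auto simp: is_arg_min_def not_less)
qed

text \<open>The form at f is the sum over x of the forms of A at f (x) e_x.\<close>

lemma psd_ptrace_right:
  assumes A: "psd (k * m) A"
  shows "psd k (ptrace_right k m A)"
proof (rule psdI)
  show "hermitian k (ptrace_right k m A)"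
  proof (rule hermitianI)
    fix a b assume ab: "a < k" "b < k"
    have "A $$ (a * m + i, b * m + i) = cnj (A $$ (b * m + i, a * m + i))" if "i < m" for i
      using ab that by (intro hermitianD(3)[OF psd_hermitian[OF A]] product_index_less)
    then show "ptrace_right k m A $$ (a, b) = cnj (ptrace_right k m A $$ (b, a))"
      using ab by (simp add: ptrace_right_def)
  qed simp
  fix f
  have slice: "quad (k * m) A (\<lambda>r. if r mod m = x then f (r div m) else 0) =
      (\<Sum>a<k. \<Sum>b<k. cnj (f a) * A $$ (a * m + x, b * m + x) * f b)" if x: "x < m" for x
  proof -
    have "quad (k * m) A (\<lambda>r. if r mod m = x then f (r div m) else 0) =
      (\<Sum>a<k. \<Sum>i<m. if i = x then (\<Sum>b<k. \<Sum>j<m. if j = x then cnj (f a) * A $$ (a * m + x, b * m + x) * f b else 0) else 0)"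
      unfolding quad_def sum_product_index
    proof (intro sum.cong refl)
      fix a i assume "a \<in> {..<k}" "i \<in> {..<m}"
      show "(\<Sum>b<k. \<Sum>j<m. cnj (if (a * m + i) mod m = x then f ((a * m + i) div m) else 0) * A $$ (a * m + i, b * m + j) *
            (if (b * m + j) mod m = x then f ((b * m + j) div m) else 0)) =
         (if i = x then (\<Sum>b<k. \<Sum>j<m. if j = x then cnj (f a) * A $$ (a * m + x, b * m + x) * f b else 0) else 0)"
      proof (cases "i = x")
        case True
        show ?thesis unfolding True if_P[OF refl]
          using x by (intro sum.cong refl) auto
      qed (use \<open>i \<in> {..<m}\<close> in simp)
    qed
    then show ?thesis using x by simp
  qed
  have "(\<Sum>a<k. \<Sum>b<k. cnj (f a) * ptrace_right k m A $$ (a, b) * f b) =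
    (\<Sum>a<k. \<Sum>b<k. \<Sum>x<m. cnj (f a) * A $$ (a * m + x, b * m + x) * f b)"
    by (intro sum.cong refl) (simp add: ptrace_right_def sum_distrib_left sum_distrib_right)
  also have "\<dots> = (\<Sum>x<m. \<Sum>a<k. \<Sum>b<k. cnj (f a) * A $$ (a * m + x, b * m + x) * f b)"
    by (subst (2) sum.swap, subst sum.swap) simp
  also have "\<dots> = (\<Sum>x<m. quad (k * m) A (\<lambda>r. if r mod m = x then f (r div m) else 0))"
    by (simp add: slice)
  also have "0 \<le> \<dots>" by (intro sum_nonneg quad_nonneg[OF A])
  finally show "0 \<le> (\<Sum>a<k. \<Sum>b<k. cnj (f a) * ptrace_right k m A $$ (a, b) * f b)" .
qed

lemma density_ptrace_right: "density (k * m) A \<Longrightarrow> density k (ptrace_right k m A)"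
  using psd_ptrace_right[of k m A] psd_carrier[of "k * m" A]
  by (simp add: density_def mat_trace_def sum_product_index) (simp add: ptrace_right_def)

lemma density_ptrace_left: "density (k * m) A \<Longrightarrow> density m (ptrace_left k m A)"
  using psd_ptrace_left[of k m A] trace_ptrace_left[of A k m] psd_carrier[of "k * m" A]
  by (simp add: density_def)

lemma density_id_tensor:
  assumes "cptp m p \<Phi>" "density (k * m) A"
  shows "density (k * p) (id_tensor k m p \<Phi> A)"
  using assms cptpD(2)[OF assms(1)] trace_id_tensor[OF assms(1)] by (auto simp: density_def dest: psd_carrier)

section \<open>Markovian matrix product density operators\<close>

(* The state of the sites m + 1, m + 2 directly after the channel on site m + 1; the sites are
   counted from 1 as in mpdo_chain, hence the shift. *)
definition mpdo_pair :: "nat \<Rightarrow> (nat \<Rightarrow> complex mat \<Rightarrow> complex mat) \<Rightarrow> complex mat \<Rightarrow> nat \<Rightarrow> complex mat" where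
  "mpdo_pair d \<Phi> \<tau> m = \<Phi> (Suc m) (mpdo_site d \<Phi> \<tau> (Suc m))"

text \<open>Tracing out the sites to the left commutes with the channel, so the pair is a marginal
  of the chain right after that channel.\<close>

lemma mpdo_pair_eq:
  assumes "cptp d (d ^ 2) (\<Phi> (Suc m))"
  shows "mpdo_pair d \<Phi> \<tau> m = ptrace_left (d ^ m) (d ^ 2) (mpdo_chain d \<Phi> \<tau> (Suc m))"
  using ptrace_left_id_tensor[OF cptpD(1)[OF assms]] by (simp add: mpdo_pair_def mpdo_site_def)

lemma mpdo_site_Suc:
  assumes "cptp d (d ^ 2) (\<Phi> (Suc m))"
  shows "mpdo_site d \<Phi> \<tau> (Suc (Suc m)) = ptrace_left d d (mpdo_pair d \<Phi> \<tau> m)"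
  using ptrace_left_product[of "d ^ m" d d "mpdo_chain d \<Phi> \<tau> (Suc m)"]
  by (simp add: mpdo_pair_eq[of d \<Phi> m \<tau>, OF assms] mpdo_site_def power2_eq_square mult.commute del: mpdo_chain.simps)

lemma density_mpdo_chain:
  assumes "\<forall>i\<in>{1..M}. cptp d (d ^ 2) (\<Phi> i)" "density d \<tau>"
  shows "density (d ^ Suc M) (mpdo_chain d \<Phi> \<tau> M)"
  using assms
proof (induction M)
  case (Suc M)
  have "density (d ^ M * d ^ 2) (id_tensor (d ^ M) d (d ^ 2) (\<Phi> (Suc M)) (mpdo_chain d \<Phi> \<tau> M))"
    using Suc by (intro density_id_tensor) (auto simp: mult.commute)
  then show ?case by (simp add: power2_eq_square mult_ac)
qed simp

lemma density_mpdo_pair: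
  assumes "\<forall>i\<in>{1..M}. cptp d (d ^ 2) (\<Phi> i)" "density d \<tau>" "m < M"
  shows "density (d * d) (mpdo_pair d \<Phi> \<tau> m)"
proof -
  have c: "cptp d (d ^ 2) (\<Phi> (Suc m))" and m: "\<forall>i\<in>{1..Suc m}. cptp d (d ^ 2) (\<Phi> i)" using assms by auto
  have "density (d ^ m * d ^ 2) (mpdo_chain d \<Phi> \<tau> (Suc m))"
    using density_mpdo_chain[OF m assms(2)] by (simp add: power2_eq_square mult_ac del: mpdo_chain.simps)
  then show ?thesis
    unfolding mpdo_pair_eq[of d \<Phi> m \<tau>, OF c] by (simp add: density_ptrace_left flip: power2_eq_square)
qed

text \<open>By \<open>cond_entropy_channel\<close>, each channel raises the entropy of the chain by
  at least the entropy of the pair it creates minus that of the site it consumes. This site is the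
  right member of the previous pair, so the differences regroup into conditional entropies.\<close>

lemma mpdo_chain_entropy_bound:
  assumes \<Phi>: "\<forall>i\<in>{1..Suc N}. cptp d (d ^ 2) (\<Phi> i)" and \<tau>: "density d \<tau>"
  shows "ln_entropy (mpdo_pair d \<Phi> \<tau> N) + (\<Sum>m<N. cond_entropy d d (mpdo_pair d \<Phi> \<tau> m))
    \<le> ln_entropy (mpdo_chain d \<Phi> \<tau> (Suc N))"
proof -
  have step: "ln_entropy (mpdo_chain d \<Phi> \<tau> M) - ln_entropy (mpdo_site d \<Phi> \<tau> (Suc M)) \<le>
    ln_entropy (mpdo_chain d \<Phi> \<tau> (Suc M)) - ln_entropy (mpdo_pair d \<Phi> \<tau> M)" if M: "M \<le> N" for M
  proof -
    have c: "cptp d (d ^ 2) (\<Phi> (Suc M))" and m: "\<forall>i\<in>{1..M}. cptp d (d ^ 2) (\<Phi> i)" using \<Phi> M by auto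
    have "psd (d ^ M * d) (mpdo_chain d \<Phi> \<tau> M)"
      using density_mpdo_chain[OF m \<tau>] by (simp add: density_def mult.commute)
    from cond_entropy_channel[OF c this] show ?thesis
      using mpdo_pair_eq[of d \<Phi> M \<tau>, OF c] by (simp add: cond_entropy_def mpdo_site_def)
  qed
  show ?thesis
    using step \<Phi>
  proof (induction N)
    case 0
    \<comment> \<open>Before the first channel the chain consists of the single site about to be
      consumed, so the two entropies cancel.\<close>
    have "mpdo_site d \<Phi> \<tau> (Suc 0) = \<tau>"
      using \<tau> by (intro eq_matI) (auto simp: mpdo_site_def ptrace_left_def density_def dest!: psd_carrier)
    then show ?case using "0.prems"(1)[of 0] by simp
  next
    case (Suc N)
    have c: "cptp d (d ^ 2) (\<Phi> (Suc N))" using Suc.prems by auto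
    have "ln_entropy (mpdo_pair d \<Phi> \<tau> N) + (\<Sum>m<N. cond_entropy d d (mpdo_pair d \<Phi> \<tau> m))
      \<le> ln_entropy (mpdo_chain d \<Phi> \<tau> (Suc N))"
      using Suc.prems by (intro Suc.IH) auto
    then show ?case
      using Suc.prems(1)[of "Suc N"] mpdo_site_Suc[of d \<Phi> N \<tau>, OF c]
      by (simp add: cond_entropy_def del: mpdo_chain.simps)
  qed
qed

text \<open>Channel j is the last one to alter the sites 1, ..., j. Later channels act on sites that
  are traced out, and site j + 1 is all that remains to be traced out after channel j.\<close>

lemma ptrace_right_mpdo_chain:
  assumes "j \<le> M" and "\<forall>i\<in>{1..M}. cptp d (d ^ 2) (\<Phi> i)"
  shows "ptrace_right (d ^ j) (d ^ (Suc M - j)) (mpdo_chain d \<Phi> \<tau> M) = ptrace_right (d ^ j) d (mpdo_chain d \<Phi> \<tau> j)"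
  using assms
proof (induction M rule: dec_induct)
  case base
  then show ?case by simp
next
  case (step M)
  have c: "cptp d (d ^ 2) (\<Phi> (Suc M))" using step by auto
  have j: "d ^ j * d ^ (M - j) = d ^ M" using step by (simp flip: power_add)
  have "d ^ (Suc (Suc M) - j) = d ^ (M - j) * d ^ 2" using step by (simp add: Suc_diff_le power2_eq_square)
  then have "ptrace_right (d ^ j) (d ^ (Suc (Suc M) - j)) (mpdo_chain d \<Phi> \<tau> (Suc M)) =
    ptrace_right (d ^ j) (d ^ (M - j)) (ptrace_right (d ^ M) (d ^ 2) (mpdo_chain d \<Phi> \<tau> (Suc M)))"
    using ptrace_right_product[of "d ^ j" "d ^ (M - j)" "d ^ 2"] j by simp
  also have "\<dots> = ptrace_right (d ^ j) (d ^ (M - j)) (ptrace_right (d ^ M) d (mpdo_chain d \<Phi> \<tau> M))"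
    using ptrace_right_id_tensor[OF c] by simp
  also have "\<dots> = ptrace_right (d ^ j) (d ^ (Suc M - j)) (mpdo_chain d \<Phi> \<tau> M)"
    using ptrace_right_product[of "d ^ j" "d ^ (M - j)" d] j step by (simp add: Suc_diff_le mult.commute)
  also have "\<dots> = ptrace_right (d ^ j) d (mpdo_chain d \<Phi> \<tau> j)"
    using step by (intro step.IH) auto
  finally show ?case .
qed

text \<open>The next channel acts once more on the right site of the pair, so the marginal differs
  from \<open>mpdo_pair\<close>. It is exactly the second matrix in the approximation condition,
  with i = m + 2.\<close>

lemma reduced_pair_mpdo_chain:
  assumes \<Phi>: "\<forall>i\<in>{1..Suc N}. cptp d (d ^ 2) (\<Phi> i)" and m: "m < N"
  shows "reduced d (Suc (Suc N)) (Suc m) (Suc (Suc m)) (mpdo_chain d \<Phi> \<tau> (Suc N)) =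
    ptrace_right (d ^ 2) d (id_tensor d d (d ^ 2) (\<Phi> (Suc (Suc m))) (mpdo_pair d \<Phi> \<tau> m))"
proof -
  have c1: "cptp d (d ^ 2) (\<Phi> (Suc m))" and c2: "cptp d (d ^ 2) (\<Phi> (Suc (Suc m)))" using \<Phi> m by auto
  let ?C = "mpdo_chain d \<Phi> \<tau>"
  have dims: "d ^ Suc (Suc m) = d ^ m * d ^ 2" "d ^ 2 * d = d * d ^ 2" "d ^ Suc m = d ^ m * d"
    by (simp_all add: power2_eq_square mult_ac)
  have "ptrace_right (d ^ Suc (Suc m)) (d ^ (Suc (Suc N) - Suc (Suc m))) (?C (Suc N)) =
      ptrace_right (d ^ Suc (Suc m)) d (?C (Suc (Suc m)))"
    using m \<Phi> by (intro ptrace_right_mpdo_chain) auto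
  then have "reduced d (Suc (Suc N)) (Suc m) (Suc (Suc m)) (?C (Suc N)) =
    ptrace_left (d ^ m) (d ^ 2) (ptrace_right (d ^ m * d ^ 2) d (?C (Suc (Suc m))))"
    by (simp add: reduced_def power2_eq_square mult_ac del: mpdo_chain.simps)
  also have "\<dots> = ptrace_right (d ^ 2) d (ptrace_left (d ^ m) (d * d ^ 2) (?C (Suc (Suc m))))"
    unfolding ptrace_left_right dims(2) ..
  also have "ptrace_left (d ^ m) (d * d ^ 2) (?C (Suc (Suc m))) =
      id_tensor d d (d ^ 2) (\<Phi> (Suc (Suc m))) (ptrace_left (d ^ m) (d * d) (?C (Suc m)))"
    unfolding mpdo_chain.simps(2)[of d \<Phi> \<tau> "Suc m"] dims(3)
    by (rule ptrace_left_id_tensor_product[OF cptpD(1)[OF c2]])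
  also have "ptrace_left (d ^ m) (d * d) (?C (Suc m)) = mpdo_pair d \<Phi> \<tau> m"
    by (simp add: mpdo_pair_eq[of d \<Phi> m \<tau>, OF c1] power2_eq_square del: mpdo_chain.simps)
  finally show ?thesis .
qed

text \<open>No channel follows the last pair, so it contributes no error.\<close>

lemma reduced_last_pair_mpdo_chain:
  assumes \<Phi>: "\<forall>i\<in>{1..Suc N}. cptp d (d ^ 2) (\<Phi> i)" and \<tau>: "density d \<tau>"
  shows "reduced d (Suc (Suc N)) (Suc N) (Suc (Suc N)) (mpdo_chain d \<Phi> \<tau> (Suc N)) = mpdo_pair d \<Phi> \<tau> N"
proof -
  let ?\<rho> = "mpdo_chain d \<Phi> \<tau> (Suc N)"
  have "?\<rho> \<in> carrier_mat (d ^ Suc (Suc N)) (d ^ Suc (Suc N))"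
    using density_mpdo_chain[OF \<Phi> \<tau>] psd_carrier by (auto simp: density_def)
  then have "ptrace_right (d ^ Suc (Suc N)) 1 ?\<rho> = ?\<rho>"
    by (intro eq_matI) (auto simp: ptrace_right_def simp del: power_Suc mpdo_chain.simps)
  then have "reduced d (Suc (Suc N)) (Suc N) (Suc (Suc N)) ?\<rho> = ptrace_left (d ^ N) (d ^ 2) ?\<rho>"
    by (simp add: reduced_def del: power_Suc mpdo_chain.simps)
  also have "\<dots> = mpdo_pair d \<Phi> \<tau> N"
    using \<Phi> by (intro mpdo_pair_eq[symmetric]) auto
  finally show ?thesis .
qed

lemma reduced_site_eq:
  "reduced d n (Suc (Suc m)) (Suc (Suc m)) \<rho> = ptrace_left d d (reduced d n (Suc m) (Suc (Suc m)) \<rho>)"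
  using ptrace_left_product[of "d ^ m" d d]
  by (simp add: reduced_def power2_eq_square mult_ac numeral_2_eq_2)

lemma sum_from_2:
  fixes f :: "nat \<Rightarrow> real"
  shows "(\<Sum>i = 2..Suc N. f i) = (\<Sum>m<N. f (Suc (Suc m)))"
  by (induction N) auto

theorem mpdo_entropy_bound:
  assumes \<rho>: "approx_markovian_mpdo \<epsilon> d n \<rho>" and n: "n \<ge> 2" and \<epsilon>: "\<epsilon> \<le> 1 / 2" and b: "b > 1"
  shows "(\<Sum>i = 2..n. vn_entropy b (reduced d n (i - 1) i \<rho>)) - (\<Sum>i = 2..n - 1. vn_entropy b (reduced d n i i \<rho>))
    \<le> vn_entropy b \<rho> + (real n - 2) * (4 * \<epsilon> * log b (real d) + 2 * bin_entropy b (2 * \<epsilon>))"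
proof -
  obtain N where N: "n = Suc (Suc N)" using n by (metis add_2_eq_Suc le_Suc_ex)
  obtain \<Phi> \<tau> where \<Phi>: "\<forall>i\<in>{1..Suc N}. cptp d (d ^ 2) (\<Phi> i)" and \<tau>: "density d \<tau>"
    and \<rho>_eq: "\<rho> = mpdo_chain d \<Phi> \<tau> (Suc N)"
    and close: "\<forall>i\<in>{2..Suc N}. let \<omega> = \<Phi> (i - 1) (mpdo_site d \<Phi> \<tau> (i - 1))
          in trace_norm (\<omega> - ptrace_right (d ^ 2) d (id_tensor d d (d ^ 2) (\<Phi> i) \<omega>)) \<le> \<epsilon>"
    using \<rho> unfolding approx_markovian_mpdo_def N by auto
  \<comment> \<open>A matrix of size 0 has trace 0 and cannot be a density.\<close>
  have d: "d > 0" using \<tau> by (cases d) (auto simp: density_def mat_trace_def dest!: psd_carrier)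
  let ?W = "mpdo_pair d \<Phi> \<tau>"
  let ?R = "\<lambda>m. reduced d n (Suc m) (Suc (Suc m)) \<rho>"
  \<comment> \<open>The error per conditional entropy in natural units; division by ln b gives the
    constant of the theorem.\<close>
  define K where "K = 4 * \<epsilon> * ln (real d) + 2 * (- (2 * \<epsilon>) * ln (2 * \<epsilon>) - (1 - 2 * \<epsilon>) * ln (1 - 2 * \<epsilon>))"
  have W: "density (d * d) (?W m)" if "m \<le> N" for m
    using that by (intro density_mpdo_pair[OF \<Phi> \<tau>]) auto
  have R: "?R m = ptrace_right (d ^ 2) d (id_tensor d d (d ^ 2) (\<Phi> (Suc (Suc m))) (?W m))" if "m < N" for m
    using reduced_pair_mpdo_chain[OF \<Phi> that] by (simp add: N \<rho>_eq)
  have RN: "?R N = ?W N" using reduced_last_pair_mpdo_chain[OF \<Phi> \<tau>] by (simp add: N \<rho>_eq)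
  have R_density: "density (d * d) (?R m)" if m: "m < N" for m
  proof -
    have "density (d * d ^ 2) (id_tensor d d (d ^ 2) (\<Phi> (Suc (Suc m))) (?W m))"
      using \<Phi> m W by (intro density_id_tensor) auto
    then have "density (d ^ 2 * d) (id_tensor d d (d ^ 2) (\<Phi> (Suc (Suc m))) (?W m))"
      by (simp add: mult.commute)
    then show ?thesis unfolding R[OF m] using density_ptrace_right by (simp flip: power2_eq_square)
  qed
  have R_density': "density (d * d) (?R m)" if "m \<le> N" for m
    using that R_density[of m] RN W[of N] by (cases "m = N") auto
  have cont: "cond_entropy d d (?R m) \<le> cond_entropy d d (?W m) + K" if m: "m < N" for m
  proof -
    have "trace_norm (?W m - ?R m) \<le> \<epsilon>"
      using close[rule_format, of "Suc (Suc m)"] m unfolding R[OF m] by (simp add: Let_def mpdo_pair_def)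
    then show ?thesis unfolding K_def
      using m W R_density d \<epsilon> by (intro cond_entropy_continuity) auto
  qed
  have "(\<Sum>i = 2..n. vn_entropy b (reduced d n (i - 1) i \<rho>)) - (\<Sum>i = 2..n - 1. vn_entropy b (reduced d n i i \<rho>))
    = (\<Sum>m<Suc N. vn_entropy b (?R m)) - (\<Sum>m<N. vn_entropy b (ptrace_left d d (?R m)))"
    using sum_from_2[of "\<lambda>i. vn_entropy b (reduced d n (i - 1) i \<rho>)" "Suc N"]
      sum_from_2[of "\<lambda>i. vn_entropy b (reduced d n i i \<rho>)" N]
    by (simp add: N reduced_site_eq)
  \<comment> \<open>Each subtracted site is the right member of a pair and joins it to a conditional
    entropy. The last pair stays unconditioned, as site n is not subtracted.\<close>
  also have "\<dots> = (ln_entropy (?R N) + (\<Sum>m<N. cond_entropy d d (?R m))) / ln b"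
  proof -
    have "vn_entropy b (?R m) = ln_entropy (?R m) / ln b" if "m \<le> N" for m
      using R_density'[OF that] by (intro vn_entropy_eq psd_hermitian) (auto simp: density_def)
    moreover have "vn_entropy b (ptrace_left d d (?R m)) = ln_entropy (ptrace_left d d (?R m)) / ln b" if "m < N" for m
      using density_ptrace_left[OF R_density[OF that]] by (intro vn_entropy_eq psd_hermitian) (auto simp: density_def)
    ultimately have "(\<Sum>m<Suc N. vn_entropy b (?R m)) - (\<Sum>m<N. vn_entropy b (ptrace_left d d (?R m)))
      = (\<Sum>m<Suc N. ln_entropy (?R m) / ln b) - (\<Sum>m<N. ln_entropy (ptrace_left d d (?R m)) / ln b)"
      by simp
    then show ?thesis
      by (simp add: cond_entropy_def sum_subtractf add_divide_distrib diff_divide_distrib flip: sum_divide_distrib)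
  qed
  also have "\<dots> \<le> (ln_entropy \<rho> + real N * K) / ln b"
  proof (rule divide_right_mono)
    have "(\<Sum>m<N. cond_entropy d d (?R m)) \<le> (\<Sum>m<N. cond_entropy d d (?W m) + K)"
      using cont by (intro sum_mono) auto
    then show "ln_entropy (?R N) + (\<Sum>m<N. cond_entropy d d (?R m)) \<le> ln_entropy \<rho> + real N * K"
      using mpdo_chain_entropy_bound[OF \<Phi> \<tau>] unfolding RN unfolding \<rho>_eq
      by (simp add: sum.distrib del: mpdo_chain.simps)
  qed (use b in simp)
  also have "\<dots> = vn_entropy b \<rho> + (real n - 2) * (4 * \<epsilon> * log b (real d) + 2 * bin_entropy b (2 * \<epsilon>))"
  proof -
    have "vn_entropy b \<rho> = ln_entropy \<rho> / ln b"
      using \<rho> by (intro vn_entropy_eq psd_hermitian) (auto simp: approx_markovian_mpdo_def density_def)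
    moreover have "4 * \<epsilon> * log b (real d) + 2 * bin_entropy b (2 * \<epsilon>) = K / ln b"
      by (simp add: K_def bin_entropy_def log_def add_divide_distrib diff_divide_distrib right_diff_distrib)
    ultimately show ?thesis by (simp add: N add_divide_distrib)
  qed
  finally show ?thesis .
qed

theorem corollary1:
  fixes b T \<epsilon> :: real and d n :: nat and H \<rho> :: "complex mat"
  assumes "b > 1"
    and "n \<ge> 2"
    and "hermitian (d ^ n) H"
    and "T \<ge> 0"
    and "0 \<le> \<epsilon>" and "\<epsilon> \<le> 1 / 2"
    and "approx_markovian_mpdo \<epsilon> d n \<rho>"
  shows "\<exists>\<sigma>. is_arg_min (free_energy b T H) (density (d ^ n)) \<sigma> \<and>
    free_energy b T H \<sigma>
      \<le> Re (mat_trace (\<rho> * H))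
        - T * ((\<Sum>i = 2..n. vn_entropy b (reduced d n (i - 1) i \<rho>))
               - (\<Sum>i = 2..n - 1. vn_entropy b (reduced d n i i \<rho>)))
        + T * (real n - 2) * (4 * \<epsilon> * log b (real d) + 2 * bin_entropy b (2 * \<epsilon>))"
proof -
  have \<rho>: "density (d ^ n) \<rho>" using assms(7) by (simp add: approx_markovian_mpdo_def)
  then have "d ^ n > 0" by (cases "d ^ n") (auto simp: density_def mat_trace_def dest!: psd_carrier)
  \<comment> \<open>The Gibbs state requires a finite inverse temperature, so T = 0 is treated by a
    ground state.\<close>
  then have "\<exists>\<sigma>. is_arg_min (free_energy b T H) (density (d ^ n)) \<sigma>"
    using ground_state_minimizes[OF assms(3)] gibbs_state_minimizes[OF assms(3) _ _ assms(1)] assms(4)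
    by (cases "T = 0") auto
  then obtain \<sigma> where \<sigma>: "is_arg_min (free_energy b T H) (density (d ^ n)) \<sigma>" by blast
  then have "free_energy b T H \<sigma> \<le> free_energy b T H \<rho>"
    using \<rho> by (auto simp: is_arg_min_def not_less)
  moreover have "T * ((\<Sum>i = 2..n. vn_entropy b (reduced d n (i - 1) i \<rho>)) - (\<Sum>i = 2..n - 1. vn_entropy b (reduced d n i i \<rho>)))
    \<le> T * (vn_entropy b \<rho> + (real n - 2) * (4 * \<epsilon> * log b (real d) + 2 * bin_entropy b (2 * \<epsilon>)))"
    using mpdo_entropy_bound[OF assms(7,2,6,1)] assms(4) by (rule mult_left_mono)
  ultimately have "free_energy b T H \<sigma>
      \<le> Re (mat_trace (\<rho> * H))
        - T * ((\<Sum>i = 2..n. vn_entropy b (reduced d n (i - 1) i \<rho>))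
               - (\<Sum>i = 2..n - 1. vn_entropy b (reduced d n i i \<rho>)))
        + T * (real n - 2) * (4 * \<epsilon> * log b (real d) + 2 * bin_entropy b (2 * \<epsilon>))"
    by (simp add: free_energy_def distrib_left mult.assoc)
  then show ?thesis using \<sigma> by blast
qed

end
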